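(* Let $\Sigma$ be a $d$-dimensional finite CW complex and let $\Omega$ be an acyclization of $\Sigma$. Then $$|K^*(\Sigma)|=\sum_{\Upsilon}|\tilde H^{d+1}(\Omega,\Upsilon;\mathbb{Z})|^2=\sum_{\Upsilon}|\tilde H_d(\Omega,\Upsilon;\mathbb{Z})|^2,$$ with both sums over all cellular spanning forests $\Upsilon\subseteq\Sigma$ (and all groups appearing are finite).
   Context: $\Sigma$ is a finite CW complex with the convention that it has a unique cell of dimension $-1$ (so cellular (co)homology is reduced); $d$-cells are facets; $\Sigma_{(i)}$ is the $i$-skeleton. Cells are oriented, $\partial_i$ are cellular boundary maps and $\partial_i^*$ their transposes. An acyclization of $\Sigma$ is a $(d+1)$-dimensional CW complex $\Omega$ with $\Omega_{(d)}=\Sigma$ and $\tilde H_{d+1}(\Omega;\mathbb{Z})=\tilde H_d(\Omega;\mathbb{Z})=0$. The cocritical group is $K^*(\Sigma)=C_{d+1}(\Omega;\mathbb{Z})/\operatorname{im}(\partial_{d+1}^*\partial_{d+1})$ with $\partial_{d+1}=\partial_{d+1}(\Omega)$. A cellular spanning forest of $\Sigma$ is a subcomplex $\Upsilon$ with $\Upsilon_{(d-1)}=\Sigma_{(d-1)}$ whose facets index a basis of the column space of $\partial_d$ over $\mathbb{R}$. *)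

theory Defs
  imports "HOL-Homology.Homology" "HOL-Library.Function_Algebras"
begin

section \<open>Finite CW complexes\<close>

text \<open>The closed unit disc and its boundary sphere, in the library's model of Euclidean space.
  For \<open>n = 0\<close> the disc is a point and its boundary is empty.\<close>

definition unit_disc :: "nat \<Rightarrow> (nat \<Rightarrow> real) topology" where
  "unit_disc n = subtopology (Euclidean_space n) {x. (\<Sum>i<n. x i ^ 2) \<le> 1}"

definition disc_boundary :: "nat \<Rightarrow> (nat \<Rightarrow> real) set" where
  "disc_boundary n = {x \<in> topspace (unit_disc n). (\<Sum>i<n. x i ^ 2) = 1}"

definition disc_interior :: "nat \<Rightarrow> (nat \<Rightarrow> real) set" where
  "disc_interior n = {x \<in> topspace (unit_disc n). (\<Sum>i<n. x i ^ 2) < 1}"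

text \<open>Cells are labels in \<open>'c\<close>. There is a unique cell of dimension \<open>-1\<close>; it carries no points of
  the underlying space and its \<open>char_map\<close> is never used.\<close>

record ('a, 'c) cw_complex =
  cw_space :: "'a topology"
  cells :: "'c set"
  cdim :: "'c \<Rightarrow> int"
  char_map :: "'c \<Rightarrow> (nat \<Rightarrow> real) \<Rightarrow> 'a"

definition cells_of :: "('a, 'c) cw_complex \<Rightarrow> int \<Rightarrow> 'c set" where
  "cells_of X i = {e \<in> cells X. cdim X e = i}"

definition open_cell :: "('a, 'c) cw_complex \<Rightarrow> 'c \<Rightarrow> 'a set" where
  "open_cell X e = (if cdim X e < 0 then {} else char_map X e ` disc_interior (nat (cdim X e)))"

definition closed_cell :: "('a, 'c) cw_complex \<Rightarrow> 'c \<Rightarrow> 'a set" where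
  "closed_cell X e =
    (if cdim X e < 0 then {} else char_map X e ` topspace (unit_disc (nat (cdim X e))))"

definition skeleton_set :: "('a, 'c) cw_complex \<Rightarrow> int \<Rightarrow> 'a set" where
  "skeleton_set X i = (\<Union>e\<in>{e \<in> cells X. cdim X e \<le> i}. open_cell X e)"

text \<open>As there are finitely many cells and the space is Hausdorff, the weak topology and closure
  finiteness conditions of the general definition are automatic, and so is the fact that a
  characteristic map is a homeomorphism from the open disc onto the open cell.\<close>

definition finite_cw_complex :: "('a, 'c) cw_complex \<Rightarrow> bool" where
  "finite_cw_complex X \<longleftrightarrow>
     finite (cells X) \<and>
     (\<forall>e\<in>cells X. cdim X e \<ge> -1) \<and>
     (\<exists>!e. e \<in> cells_of X (-1)) \<and>
     Hausdorff_space (cw_space X) \<and>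
     (\<forall>e\<in>cells X. cdim X e \<ge> 0 \<longrightarrow>
        continuous_map (unit_disc (nat (cdim X e))) (cw_space X) (char_map X e) \<and>
        inj_on (char_map X e) (disc_interior (nat (cdim X e))) \<and>
        char_map X e ` disc_boundary (nat (cdim X e)) \<subseteq> skeleton_set X (cdim X e - 1)) \<and>
     pairwise (\<lambda>e f. disjnt (open_cell X e) (open_cell X f)) (cells X) \<and>
     topspace (cw_space X) = (\<Union>e\<in>cells X. open_cell X e)"

definition has_cw_dim :: "('a, 'c) cw_complex \<Rightarrow> int \<Rightarrow> bool" where
  "has_cw_dim X d \<longleftrightarrow> cells_of X d \<noteq> {} \<and> (\<forall>e\<in>cells X. cdim X e \<le> d)"

definition skeleton :: "('a, 'c) cw_complex \<Rightarrow> int \<Rightarrow> ('a, 'c) cw_complex" where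
  "skeleton X i =
     X\<lparr>cw_space := subtopology (cw_space X) (skeleton_set X i), cells := {e \<in> cells X. cdim X e \<le> i}\<rparr>"

text \<open>Equality of CW complexes, disregarding the values of the record fields outside the cells
  and outside the discs.\<close>

definition cw_eq :: "('a, 'c) cw_complex \<Rightarrow> ('a, 'c) cw_complex \<Rightarrow> bool" where
  "cw_eq X Y \<longleftrightarrow>
     cw_space X = cw_space Y \<and> cells X = cells Y \<and>
     (\<forall>e\<in>cells X. cdim X e = cdim Y e \<and>
        (cdim X e \<ge> 0 \<longrightarrow>
          (\<forall>x\<in>topspace (unit_disc (nat (cdim X e))). char_map X e x = char_map Y e x)))"

text \<open>Subcomplexes are given by their sets of cells; they contain the cell of dimension \<open>-1\<close>.\<close>

definition subcomplex :: "('a, 'c) cw_complex \<Rightarrow> 'c set \<Rightarrow> bool" where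
  "subcomplex X T \<longleftrightarrow>
     T \<subseteq> cells X \<and> cells_of X (-1) \<subseteq> T \<and>
     (\<forall>e\<in>T. closed_cell X e \<subseteq> (\<Union>f\<in>T. open_cell X f))"


section \<open>Cellular chains\<close>

text \<open>A fixed generator of the infinite cyclic group \<open>H\<^sub>n(D\<^sup>n, S\<^sup>n\<^sup>-\<^sup>1)\<close>. A cell of dimension
  \<open>n\<close> is oriented by transporting this generator along its characteristic map, so for \<open>n \<ge> 1\<close> the
  orientation of a cell is reversed by composing its characteristic map with a reflection.\<close>

definition disc_orientation :: "nat \<Rightarrow> (nat \<Rightarrow> real) chain set" where
  "disc_orientation n =
     (let G = relative_homology_group (int n) (unit_disc n) (disc_boundary n)
      in SOME g. g \<in> carrier G \<and> carrier (subgroup_generated G {g}) = carrier G)"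

definition skeletal_homology :: "('a, 'c) cw_complex \<Rightarrow> int \<Rightarrow> 'a chain set monoid" where
  "skeletal_homology X n =
     relative_homology_group n (subtopology (cw_space X) (skeleton_set X n)) (skeleton_set X (n - 1))"

definition cell_class :: "('a, 'c) cw_complex \<Rightarrow> 'c \<Rightarrow> 'a chain set" where
  "cell_class X e =
     hom_induced (cdim X e) (unit_disc (nat (cdim X e))) (disc_boundary (nat (cdim X e)))
       (subtopology (cw_space X) (skeleton_set X (cdim X e))) (skeleton_set X (cdim X e - 1))
       (char_map X e) (disc_orientation (nat (cdim X e)))"

text \<open>The coefficient of \<open>f\<close> in the boundary of \<open>e\<close>. In dimension \<open>n \<ge> 1\<close> the cellular
  boundary map is the composite
  \<open>H\<^sub>n(X\<^sub>n, X\<^sub>n\<^sub>-\<^sub>1) \<rightarrow> H\<^sub>n\<^sub>-\<^sub>1(X\<^sub>n\<^sub>-\<^sub>1) \<rightarrow> H\<^sub>n\<^sub>-\<^sub>1(X\<^sub>n\<^sub>-\<^sub>1, X\<^sub>n\<^sub>-\<^sub>2)\<close>, written in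
  the bases of cell classes; these groups are multiplicative in the library. The boundary of every
  \<open>0\<close>-cell is the cell of dimension \<open>-1\<close>, that is, the boundary map in degree \<open>0\<close> is the
  augmentation.\<close>

definition incidence :: "('a, 'c) cw_complex \<Rightarrow> 'c \<Rightarrow> 'c \<Rightarrow> int" where
  "incidence X e =
     (let n = cdim X e in
      if n \<ge> 1 then
        (THE a. (\<forall>f. f \<notin> cells_of X (n - 1) \<longrightarrow> a f = 0) \<and>
           hom_relboundary n (subtopology (cw_space X) (skeleton_set X n))
             (skeleton_set X (n - 1)) (skeleton_set X (n - 2)) (cell_class X e) =
           (\<Otimes>\<^bsub>skeletal_homology X (n - 1)\<^esub>f\<in>cells_of X (n - 1).
              cell_class X f [^]\<^bsub>skeletal_homology X (n - 1)\<^esub> a f))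
      else if n = 0 then (\<lambda>f. if f \<in> cells_of X (-1) then 1 else 0)
      else (\<lambda>f. 0))"

definition cellular_chains :: "('a, 'c) cw_complex \<Rightarrow> int \<Rightarrow> ('c \<Rightarrow>\<^sub>0 int) monoid" where
  "cellular_chains X i = free_Abelian_group (cells_of X i)"

text \<open>The boundary maps \<open>\<partial>\<^sub>i\<close> and their transposes, in all degrees \<open>i\<close> at once.\<close>

definition bd :: "('a, 'c) cw_complex \<Rightarrow> ('c \<Rightarrow>\<^sub>0 int) \<Rightarrow> ('c \<Rightarrow>\<^sub>0 int)" where
  "bd X = frag_extend (\<lambda>e. \<Sum>f\<in>cells X. frag_cmul (incidence X e f) (frag_of f))"

definition bd_transpose :: "('a, 'c) cw_complex \<Rightarrow> ('c \<Rightarrow>\<^sub>0 int) \<Rightarrow> ('c \<Rightarrow>\<^sub>0 int)" where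
  "bd_transpose X = frag_extend (\<lambda>f. \<Sum>e\<in>cells X. frag_cmul (incidence X e f) (frag_of e))"

text \<open>Cellular homology of \<open>X\<close> relative to the subcomplex with set of cells \<open>T\<close>. As the cell of
  dimension \<open>-1\<close> belongs to the chain complex, the absolute groups are reduced.\<close>

definition rel_cell_cycles :: "('a, 'c) cw_complex \<Rightarrow> 'c set \<Rightarrow> int \<Rightarrow> ('c \<Rightarrow>\<^sub>0 int) set" where
  "rel_cell_cycles X T i =
     {c \<in> carrier (cellular_chains X i). bd X c \<in> carrier (free_Abelian_group (cells_of X (i - 1) \<inter> T))}"

definition rel_cell_boundaries :: "('a, 'c) cw_complex \<Rightarrow> 'c set \<Rightarrow> int \<Rightarrow> ('c \<Rightarrow>\<^sub>0 int) set" where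
  "rel_cell_boundaries X T i =
     {bd X b + u | b u. b \<in> carrier (cellular_chains X (i + 1)) \<and>
                        u \<in> carrier (free_Abelian_group (cells_of X i \<inter> T))}"

definition rel_cellular_homology ::
    "int \<Rightarrow> ('a, 'c) cw_complex \<Rightarrow> 'c set \<Rightarrow> ('c \<Rightarrow>\<^sub>0 int) set monoid" where
  "rel_cellular_homology i X T =
     subgroup_generated (cellular_chains X i) (rel_cell_cycles X T i) Mod rel_cell_boundaries X T i"

abbreviation reduced_cellular_homology ::
    "int \<Rightarrow> ('a, 'c) cw_complex \<Rightarrow> ('c \<Rightarrow>\<^sub>0 int) set monoid" where
  "reduced_cellular_homology i X \<equiv> rel_cellular_homology i X {}"

text \<open>Cochains are identified with chains through the dual basis of the cells, so that the
  coboundary is the transpose of the boundary; the relative cochains are those that vanish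
  on \<open>T\<close>.\<close>

definition rel_cochains ::
    "('a, 'c) cw_complex \<Rightarrow> 'c set \<Rightarrow> int \<Rightarrow> ('c \<Rightarrow>\<^sub>0 int) monoid" where
  "rel_cochains X T i = free_Abelian_group (cells_of X i - T)"

definition rel_cellular_cohomology ::
    "int \<Rightarrow> ('a, 'c) cw_complex \<Rightarrow> 'c set \<Rightarrow> ('c \<Rightarrow>\<^sub>0 int) set monoid" where
  "rel_cellular_cohomology i X T =
     subgroup_generated (rel_cochains X T i) {c \<in> carrier (rel_cochains X T i). bd_transpose X c = 0}
       Mod bd_transpose X ` carrier (rel_cochains X T (i - 1))"


section \<open>Acyclizations, cocritical groups and spanning forests\<close>

text \<open>A \<open>(d+1)\<close>-dimensional complex may have no facets here: this is what happens for an
  acyclization when the top homology of \<open>S\<close> already vanishes.\<close>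

definition acyclization :: "nat \<Rightarrow> ('a, 'c) cw_complex \<Rightarrow> ('a, 'c) cw_complex \<Rightarrow> bool" where
  "acyclization d S W \<longleftrightarrow>
     finite_cw_complex W \<and> (\<forall>e\<in>cells W. cdim W e \<le> int d + 1) \<and>
     cw_eq (skeleton W (int d)) S \<and>
     trivial_group (reduced_cellular_homology (int d + 1) W) \<and>
     trivial_group (reduced_cellular_homology (int d) W)"

definition cocritical_group :: "nat \<Rightarrow> ('a, 'c) cw_complex \<Rightarrow> ('c \<Rightarrow>\<^sub>0 int) set monoid" where
  "cocritical_group d W =
     cellular_chains W (int d + 1) Mod
       (\<lambda>c. bd_transpose W (bd W c)) ` carrier (cellular_chains W (int d + 1))"

definition real_scale :: "real \<Rightarrow> ('c \<Rightarrow> real) \<Rightarrow> 'c \<Rightarrow> real" where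
  "real_scale r v = (\<lambda>x. r * v x)"

interpretation real_fun: vector_space "real_scale :: real \<Rightarrow> ('c \<Rightarrow> real) \<Rightarrow> 'c \<Rightarrow> real"
  by unfold_locales (simp_all add: real_scale_def fun_eq_iff algebra_simps)

definition bd_column :: "('a, 'c) cw_complex \<Rightarrow> 'c \<Rightarrow> 'c \<Rightarrow> real" where
  "bd_column X e = (\<lambda>f. real_of_int (incidence X e f))"

text \<open>The facets of \<open>T\<close> index a basis as a family, hence the injectivity condition.\<close>

definition cellular_spanning_forest :: "nat \<Rightarrow> ('a, 'c) cw_complex \<Rightarrow> 'c set \<Rightarrow> bool" where
  "cellular_spanning_forest d X T \<longleftrightarrow>
     subcomplex X T \<and>
     {e \<in> T. cdim X e \<le> int d - 1} = {e \<in> cells X. cdim X e \<le> int d - 1} \<and>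
     inj_on (bd_column X) (cells_of X (int d) \<inter> T) \<and>
     real_fun.independent (bd_column X ` (cells_of X (int d) \<inter> T)) \<and>
     real_fun.span (bd_column X ` (cells_of X (int d) \<inter> T)) =
       real_fun.span (bd_column X ` cells_of X (int d))"

end

(*
Write D for the matrix of the top boundary map of the acyclization, with rows the d-cells and columns
the (d+1)-cells. Acyclicity says that D is injective and that its image is the kernel of the next
boundary map. Hence the d-cells outside a set S index a basis of the column space of that map
exactly when S has as many elements as there are (d+1)-cells and the minor D_S is nonzero, and the
relative groups are the cokernels of D_S and of its transpose, of order |det D_S|. The cocritical
group is the cokernel of D^T D, so its order is det (D^T D), which is the sum of the squares of the
minors by the Cauchy-Binet formula.

That the incidence numbers are well defined and square to zero requires the cell classes to form a
basis of the homology of (X_n, X_(n-1)). The n-cells are attached one at a time: expanding the disc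
radially and excising shows that a characteristic map induces an isomorphism in relative homology,
and the exact sequence of a triple adds the class of the new cell to those already present.
*)
theory Submission
  imports "Jordan_Normal_Form.Determinant" Defs
begin

section \<open>Discs\<close>

text \<open>Forests are defined over the reals, whereas acyclicity speaks of integral chains. The
  bridge is that the boundary matrices are integral: a real relation among columns with a nonzero
  coefficient at a chosen cell yields an integral relation with the same property, and exactness
  turns that into a boundary. Solvability over the rationals is phrased as solvability over the
  integers up to a nonzero factor \<open>k\<close>. Orders of cokernels come from explicit sets of
  coset representatives, obtained by column reduction of a square matrix; one statement about
  subgroups of free abelian groups then gives all three orders, and finiteness with them. The
  geometric work is forced by the definition of the incidence numbers as a unique solution: nothing
  can be derived from them in positive dimensions until the cell classes are known to be a basis.
  Degree 1 stands apart, because the boundary of a 0-cell is the augmentation by convention and not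
  a connecting map. An acyclization without (d+1)-cells is covered too, the empty determinant being
  1.\<close>

lemma unit_disc_eq:
  "unit_disc n = top_of_set {x. (\<forall>i\<ge>n. x i = 0) \<and> (\<Sum>i<n. (x i)\<^sup>2) \<le> 1}"
  by (simp add: unit_disc_def Euclidean_space_def subtopology_subtopology euclidean_product_topology
      Collect_conj_eq)

lemma topspace_unit_disc:
  "topspace (unit_disc n) = {x. (\<forall>i\<ge>n. x i = 0) \<and> (\<Sum>i<n. (x i)\<^sup>2) \<le> 1}"
  by (simp add: unit_disc_eq)

lemma continuous_map_unit_disc_component: "continuous_map (unit_disc n) euclideanreal (\<lambda>x. x i)"
  by (auto simp: unit_disc_eq intro: continuous_on_subset [OF continuous_on_product_coordinates])

text \<open>The ambient space is a product over all naturals, so boundedness alone does not suffice.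
  The disc is a closed subset of a product of intervals (coordinates below \<open>n\<close>) and of
  points (the other coordinates), which is compact by Tychonoff.\<close>

lemma compact_space_unit_disc: "compact_space (unit_disc n)"
proof -
  let ?D = "{x. (\<forall>i\<ge>n. x i = 0) \<and> (\<Sum>i<n. (x i)\<^sup>2) \<le> (1::real)}"
  let ?P = "PiE UNIV (\<lambda>i. if i < n then {-1..1::real} else {0})"
  have "compactin (powertop_real UNIV) ?P"
    by (subst compactin_PiE) (auto simp: compactin_euclidean_iff)
  moreover have "closedin (powertop_real UNIV) ?D"
  proof -
    have "closed {x::nat\<Rightarrow>real. (\<forall>i. i \<ge> n \<longrightarrow> x i = 0) \<and> (\<Sum>i<n. (x i)\<^sup>2) \<le> 1}"
      unfolding Collect_conj_eq
      by (intro closed_Int closed_Collect_le closed_Collect_all closed_Collect_imp closed_Collect_eq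
          continuous_intros continuous_on_product_coordinates) auto
    then show ?thesis
      by (simp add: euclidean_product_topology)
  qed
  moreover have "?D \<subseteq> ?P"
  proof
    fix x :: "nat \<Rightarrow> real"
    assume x: "x \<in> ?D"
    have "\<bar>x i\<bar> \<le> 1" if "i < n" for i
    proof -
      have "(x i)\<^sup>2 \<le> (\<Sum>i<n. (x i)\<^sup>2)"
        using that by (intro member_le_sum) auto
      with x show ?thesis
        using abs_square_le_1 [of "x i"] by auto
    qed
    with x show "x \<in> ?P"
      by (auto simp: abs_le_iff)
  qed
  ultimately have "compactin (powertop_real UNIV) ?D"
    by (meson closed_compactin)
  then show ?thesis
    by (simp add: unit_disc_eq compact_space_subtopology euclidean_product_topology)
qed

lemma Hausdorff_space_unit_disc: "Hausdorff_space (unit_disc n)"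
  by (simp add: unit_disc_eq Hausdorff_space_subtopology)

lemma topspace_unit_disc_Un: "topspace (unit_disc n) = disc_interior n \<union> disc_boundary n"
  by (auto simp: disc_interior_def disc_boundary_def topspace_unit_disc)

lemma disc_interior_Int_boundary: "disc_interior n \<inter> disc_boundary n = {}"
  by (auto simp: disc_interior_def disc_boundary_def)

lemma closedin_disc_boundary: "closedin (unit_disc n) (disc_boundary n)"
proof -
  have "closedin (unit_disc n) {x \<in> topspace (unit_disc n). (\<Sum>i<n. (x i)\<^sup>2) \<in> {1}}"
    by (rule closedin_continuous_map_preimage [where Y = euclideanreal])
       (auto intro!: continuous_map_sum continuous_map_real_pow continuous_map_unit_disc_component)
  then show ?thesis
    by (simp add: disc_boundary_def)
qed

text \<open>For \<open>n = 0\<close> this is constantly 0: the one point of the disc is interior and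
  the boundary is empty, so 0-cells obey the same lemmas as all others.\<close>

definition disc_norm :: "nat \<Rightarrow> (nat \<Rightarrow> real) \<Rightarrow> real" where
  "disc_norm n x = sqrt (\<Sum>i<n. (x i)\<^sup>2)"

lemma disc_norm_nonneg [simp]: "0 \<le> disc_norm n x"
  by (simp add: disc_norm_def sum_nonneg)

lemma disc_norm_scale: "disc_norm n (\<lambda>i. c * x i) = \<bar>c\<bar> * disc_norm n x"
  by (simp add: disc_norm_def power_mult_distrib real_sqrt_mult flip: sum_distrib_left)

lemma in_unit_disc_iff: "x \<in> topspace (unit_disc n) \<longleftrightarrow> (\<forall>i\<ge>n. x i = 0) \<and> disc_norm n x \<le> 1"
  by (simp add: topspace_unit_disc disc_norm_def)

lemma in_disc_interior_iff: "x \<in> disc_interior n \<longleftrightarrow> (\<forall>i\<ge>n. x i = 0) \<and> disc_norm n x < 1"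
  by (auto simp: disc_interior_def topspace_unit_disc disc_norm_def)

lemma in_disc_boundary_iff: "x \<in> disc_boundary n \<longleftrightarrow> (\<forall>i\<ge>n. x i = 0) \<and> disc_norm n x = 1"
  by (auto simp: disc_boundary_def topspace_unit_disc disc_norm_def)

lemma continuous_map_disc_norm: "continuous_map (unit_disc n) euclideanreal (disc_norm n)"
  unfolding disc_norm_def
  by (intro continuous_map_sum continuous_map_real_pow continuous_map_unit_disc_component continuous_map_sqrt) auto

text \<open>Expansion from the centre, stopped at the boundary; at time 1 everything of norm at least
  \<open>1/2\<close> has reached the boundary.\<close>

definition disc_expand :: "nat \<Rightarrow> real \<Rightarrow> (nat \<Rightarrow> real) \<Rightarrow> nat \<Rightarrow> real" where
  "disc_expand n t x = (\<lambda>i. (1 + t) / max 1 ((1 + t) * disc_norm n x) * x i)"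

lemma disc_norm_expand:
  assumes "0 \<le> t"
  shows "disc_norm n (disc_expand n t x) = min 1 ((1 + t) * disc_norm n x)"
  unfolding disc_expand_def disc_norm_scale using assms
  by (auto simp: max_def min_def)

lemma disc_expand_0: "x \<in> topspace (unit_disc n) \<Longrightarrow> disc_expand n 0 x = x"
  by (cases "disc_norm n x = 1") (auto simp: disc_expand_def in_unit_disc_iff max_def)

lemma disc_expand_boundary: "x \<in> disc_boundary n \<Longrightarrow> 0 \<le> t \<Longrightarrow> disc_expand n t x = x"
  by (simp add: disc_expand_def in_disc_boundary_iff max_def fun_eq_iff)

text \<open>The scaling factor has the denominator \<open>max 1 _\<close>, which is continuous and
  never below 1; hence no case distinction arises where the expansion stops.\<close>

lemma continuous_map_disc_expand:
  "continuous_map (prod_topology (top_of_set {0..1}) (unit_disc n)) (unit_disc n)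
     (\<lambda>(t, x). disc_expand n t x)"
proof -
  let ?X = "prod_topology (top_of_set {0..1::real}) (unit_disc n)"
  have t: "continuous_map ?X euclideanreal (\<lambda>z. 1 + fst z)"
    by (intro continuous_map_add continuous_map_canonical_const)
       (metis continuous_map_fst continuous_map_into_fulltopology)
  have nx: "continuous_map ?X euclideanreal (\<lambda>z. disc_norm n (snd z))"
    using continuous_map_compose [OF continuous_map_snd continuous_map_disc_norm] by (simp add: o_def)
  have x: "continuous_map ?X euclideanreal (\<lambda>z. snd z i)" for i
    using continuous_map_compose [OF continuous_map_snd continuous_map_unit_disc_component]
    by (simp add: o_def)
  have "continuous_map ?X euclideanreal (\<lambda>z. disc_expand n (fst z) (snd z) i)" for i
    unfolding disc_expand_def
    by (intro continuous_map_real_mult continuous_map_real_divide t nx x continuous_map_real_max) auto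
  then have "continuous_map ?X (powertop_real UNIV) (\<lambda>z. disc_expand n (fst z) (snd z))"
    by (simp add: continuous_map_componentwise_UNIV)
  moreover have "disc_expand n t x \<in> topspace (unit_disc n)" if "0 \<le> t" "x \<in> topspace (unit_disc n)" for t x
    using that by (auto simp: in_unit_disc_iff disc_norm_expand) (simp add: disc_expand_def)
  ultimately show ?thesis
    unfolding unit_disc_eq
    by (auto simp: continuous_map_in_subtopology topspace_unit_disc euclidean_product_topology case_prod_unfold)
qed

section \<open>Attaching a cell\<close>

text \<open>This and the next lemma are two-out-of-three for isomorphisms. They cancel the excision
  and enlargement maps when the disc is compared with the space to which it is attached.\<close>

lemma iso_left_factor:
  assumes "g \<circ> f \<in> iso G K" "g \<in> iso H K" "f \<in> hom G H"
  shows "f \<in> iso G H"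
proof -
  have "f ` carrier G \<subseteq> carrier H"
    using assms by (auto simp: hom_def)
  then have "bij_betw f (carrier G) (carrier H)"
    using assms bij_betw_comp_iff2 [of g "carrier H" "carrier K" f "carrier G"] by (auto simp: iso_def)
  with assms show ?thesis
    by (simp add: iso_def)
qed

lemma iso_right_factor:
  assumes "g \<circ> f \<in> iso G K" "f \<in> iso G H" "g \<in> hom H K"
  shows "g \<in> iso H K"
  using assms bij_betw_comp_iff [of f "carrier G" "carrier H" g "carrier K"] by (auto simp: iso_def)

text \<open>The attached cell is the complement of \<open>Z\<close>. Compactness of the disc and the
  Hausdorff property make \<phi> a closed map, and from this follow continuity of the expansion,
  excision and the homeomorphism on the interior. Besides cells of a complex, the disc itself and a
  one-point space are instances.\<close>

locale disc_attachment =
  fixes Y :: "'a topology" and Z :: "'a set" and n :: nat and \<phi> :: "(nat \<Rightarrow> real) \<Rightarrow> 'a"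
  assumes Hausdorff: "Hausdorff_space Y"
    and closed: "closedin Y Z"
    and cont: "continuous_map (unit_disc n) Y \<phi>"
    and inj: "inj_on \<phi> (disc_interior n)"
    and boundary: "\<phi> \<in> disc_boundary n \<rightarrow> Z"
    and interior: "\<phi> ` disc_interior n = topspace Y - Z"
begin

text \<open>The open disc of half the radius. Excision cannot remove \<open>Z\<close> from the pair
  with \<open>Z\<close> itself, so \<open>Z\<close> is first enlarged to the complement of this
  core, a neighbourhood of \<open>Z\<close>. The radius 1/2 fits the expansion factor 2 at time
  1.\<close>

definition core :: "'a set" where
  "core = \<phi> ` {x \<in> topspace (unit_disc n). disc_norm n x < 1/2}"

lemma core_subset: "core \<subseteq> topspace Y - Z"
  using interior by (auto simp: core_def in_unit_disc_iff in_disc_interior_iff)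

lemma Z_subset: "Z \<subseteq> topspace Y"
  using closed closedin_subset by auto

lemma in_Z_iff: "x \<in> topspace (unit_disc n) \<Longrightarrow> \<phi> x \<in> Z \<longleftrightarrow> x \<in> disc_boundary n"
  using boundary interior by (auto simp: topspace_unit_disc_Un)

text \<open>\<phi> need not be injective on the whole disc. A preimage of a point of the core cannot
  lie on the boundary, as the core misses \<open>Z\<close>, and on the interior injectivity
  applies.\<close>

lemma in_core_iff:
  assumes "x \<in> topspace (unit_disc n)"
  shows "\<phi> x \<in> core \<longleftrightarrow> disc_norm n x < 1/2"
proof
  assume "\<phi> x \<in> core"
  then obtain y where y: "y \<in> topspace (unit_disc n)" "disc_norm n y < 1/2" "\<phi> x = \<phi> y"
    by (auto simp: core_def)
  have "\<phi> x \<notin> Z"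
    using \<open>\<phi> x \<in> core\<close> core_subset by auto
  with assms have "x \<in> disc_interior n"
    using in_Z_iff [OF assms] by (auto simp: topspace_unit_disc_Un)
  moreover have "y \<in> disc_interior n"
    using y by (auto simp: in_unit_disc_iff in_disc_interior_iff)
  ultimately show "disc_norm n x < 1/2"
    using y inj by (metis inj_onD)
qed (use assms in \<open>auto simp: core_def\<close>)

text \<open>The expansion of the disc fixes its boundary, so it descends along \<phi> and extends by
  the identity on \<open>Z\<close>. Continuity is pasted from two closed pieces. On \<open>Z\<close>
  the map is a projection; on the image of the disc it is tested after composition with the product
  of the identity and \<phi>, a quotient map because it goes from a compact space onto a Hausdorff
  one.\<close>

lemma expansion:
  obtains H where
    "continuous_map (prod_topology (top_of_set {0..1::real}) Y) Y H"
    "\<And>y. H (0, y) = y"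
    "\<And>t y. y \<in> Z \<Longrightarrow> H (t, y) = y"
    "\<And>t x. \<lbrakk>0 \<le> t; t \<le> 1; x \<in> topspace (unit_disc n)\<rbrakk> \<Longrightarrow> H (t, \<phi> x) = \<phi> (disc_expand n t x)"
proof -
  let ?I = "top_of_set {0..1::real}"
  let ?D = "unit_disc n"
  define H where "H = (\<lambda>(t, y). if y \<in> \<phi> ` disc_interior n
      then \<phi> (disc_expand n t (inv_into (disc_interior n) \<phi> y)) else y)"
  have H0: "H (0, y) = y" for y
    using f_inv_into_f [of y \<phi> "disc_interior n"] inv_into_into [of y \<phi> "disc_interior n"]
    by (auto simp: H_def disc_expand_0 topspace_unit_disc_Un)
  have HZ: "H (t, y) = y" if "y \<in> Z" for t y
    using that by (auto simp: H_def interior)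
  have H\<phi>: "H (t, \<phi> x) = \<phi> (disc_expand n t x)" if "0 \<le> t" "t \<le> 1" "x \<in> topspace ?D" for t x
  proof (cases "x \<in> disc_interior n")
    case True
    then show ?thesis
      using inj by (simp add: H_def)
  next
    case False
    then have "x \<in> disc_boundary n"
      using that by (auto simp: topspace_unit_disc_Un)
    then show ?thesis
      using that HZ boundary by (auto simp: disc_expand_boundary)
  qed
  have img: "\<phi> ` topspace ?D \<subseteq> topspace Y"
    using cont continuous_map_image_subset_topspace by blast
  have "continuous_map (prod_topology ?I Y) Y H"
  proof (rule pasting_lemma_closed [where I = UNIV and f = "\<lambda>_. H"
        and T = "\<lambda>b. {0..1} \<times> (if b then Z else \<phi> ` topspace ?D)"])
    fix b :: bool
    have cl: "closedin Y (\<phi> ` topspace ?D)"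
      using continuous_imp_closed_map [OF cont compact_space_unit_disc Hausdorff]
      by (auto simp: closed_map_def)
    then show "closedin (prod_topology ?I Y) ({0..1} \<times> (if b then Z else \<phi> ` topspace ?D))"
      using closed by (auto simp: closedin_prod_Times_iff)
    show "continuous_map (subtopology (prod_topology ?I Y) ({0..1} \<times> (if b then Z else \<phi> ` topspace ?D))) Y H"
    proof (cases b)
      case True
      have "continuous_map (subtopology (prod_topology ?I Y) ({0..1} \<times> Z)) Y snd"
        by (intro continuous_map_from_subtopology continuous_map_snd)
      then show ?thesis
        using True HZ by (auto elim!: continuous_map_eq)
    next
      case False
      let ?Q = "prod_topology ?I (subtopology Y (\<phi> ` topspace ?D))"
      have sub: "subtopology (prod_topology ?I Y) ({0..1} \<times> \<phi> ` topspace ?D) = ?Q"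
        by (metis subtopology_Times subtopology_topspace topspace_euclidean_subtopology)
      let ?q = "\<lambda>(t, x). (t, \<phi> x)"
      have "quotient_map (prod_topology ?I ?D) ?Q ?q"
      proof (rule continuous_imp_quotient_map)
        have "continuous_map ?D (subtopology Y (\<phi> ` topspace ?D)) \<phi>"
          using cont by (simp add: continuous_map_in_subtopology)
        then show "continuous_map (prod_topology ?I ?D) ?Q ?q"
          by (simp add: continuous_map_prod_top)
        show "compact_space (prod_topology ?I ?D)"
          by (simp add: compact_space_prod_topology compact_space_unit_disc compact_space_subtopology)
        show "Hausdorff_space ?Q"
          by (simp add: Hausdorff_space_prod_topology Hausdorff_space_subtopology Hausdorff)
        show "?q ` topspace (prod_topology ?I ?D) = topspace ?Q"
          using img by force
      qed
      moreover have "continuous_map (prod_topology ?I ?D) Y (H \<circ> ?q)"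
      proof (rule continuous_map_eq)
        show "continuous_map (prod_topology ?I ?D) Y (\<phi> \<circ> (\<lambda>(t, x). disc_expand n t x))"
          by (rule continuous_map_compose [OF continuous_map_disc_expand cont])
      qed (auto simp: H\<phi>)
      ultimately have "continuous_map ?Q Y H"
        by (rule continuous_compose_quotient_map)
      then show ?thesis
        using False sub by simp
    qed
  next
    fix z
    assume "z \<in> topspace (prod_topology ?I Y)"
    then have "fst z \<in> {0..1}" "snd z \<in> topspace Y"
      by auto
    moreover have "snd z \<in> Z \<or> snd z \<in> \<phi> ` topspace ?D"
      using \<open>snd z \<in> topspace Y\<close> interior by (auto simp: topspace_unit_disc_Un)
    ultimately show "\<exists>j. j \<in> UNIV \<and> z \<in> {0..1} \<times> (if j then Z else \<phi> ` topspace ?D) \<and> H z = H z"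
      by (cases z) (metis (full_types) SigmaI UNIV_I fst_conv snd_conv)
  qed auto
  with H0 HZ H\<phi> that show thesis
    by blast
qed

text \<open>The expansion is a homotopy inverse: it maps the enlarged subspace into \<open>Z\<close> at time 1.\<close>

lemma iso_enlarge:
  "hom_induced p Y Z Y (topspace Y - core) id
    \<in> iso (relative_homology_group p Y Z) (relative_homology_group p Y (topspace Y - core))"
proof -
  let ?Z' = "topspace Y - core"
  obtain H where contH: "continuous_map (prod_topology (top_of_set {0..1::real}) Y) Y H"
    and H0: "\<And>y. H (0, y) = y" and HZ: "\<And>t y. y \<in> Z \<Longrightarrow> H (t, y) = y"
    and H\<phi>: "\<And>t x. \<lbrakk>0 \<le> t; t \<le> 1; x \<in> topspace (unit_disc n)\<rbrakk> \<Longrightarrow> H (t, \<phi> x) = \<phi> (disc_expand n t x)"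
    by (rule expansion) blast
  have HT: "H (t, y) \<in> topspace Y" if "t \<in> {0..1}" "y \<in> topspace Y" for t y
    using continuous_map_image_subset_topspace [OF contH] that by auto
  have disc: "disc_expand n t x \<in> topspace (unit_disc n)"
    if "0 \<le> t" "t \<le> 1" "x \<in> topspace (unit_disc n)" for t x
    using continuous_map_image_subset_topspace [OF continuous_map_disc_expand, of n] that by fastforce
  \<comment> \<open>Expanding never decreases the norm below 1, so a point outside the core stays
    outside at every time.\<close>
  have HZ': "H (t, y) \<in> ?Z'" if t: "t \<in> {0..1}" and y: "y \<in> ?Z'" for t y
  proof (cases "y \<in> Z")
    case True
    with y HZ show ?thesis by simp
  next
    case False
    then obtain x where x: "x \<in> disc_interior n" "y = \<phi> x"
      using y interior by blast
    then have xD: "x \<in> topspace (unit_disc n)"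
      by (simp add: topspace_unit_disc_Un)
    have "1/2 \<le> disc_norm n x"
      using in_core_iff [OF xD] y x by simp
    then have "1/2 \<le> (1 + t) * disc_norm n x"
      using t by (smt (verit, best) atLeastAtMost_iff mult_le_cancel_right1 disc_norm_nonneg)
    then show ?thesis
      using HT [of t y] t y x xD H\<phi> [of t x] in_core_iff [OF disc [of t x]]
      by (auto simp: disc_norm_expand)
  qed
  have H1: "H (1, y) \<in> Z" if y: "y \<in> ?Z'" for y
  proof (cases "y \<in> Z")
    case True
    with HZ show ?thesis by simp
  next
    case False
    then obtain x where x: "x \<in> disc_interior n" "y = \<phi> x"
      using y interior by blast
    then have xD: "x \<in> topspace (unit_disc n)"
      by (simp add: topspace_unit_disc_Un)
    have "1/2 \<le> disc_norm n x"
      using in_core_iff [OF xD] y x by simp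
    then have "disc_norm n (disc_expand n 1 x) = 1"
      by (simp add: disc_norm_expand)
    then show ?thesis
      using H\<phi> [of 1 x] xD x in_Z_iff [OF disc [of 1 x]] disc [of 1 x]
      by (auto simp: in_disc_boundary_iff in_unit_disc_iff)
  qed
  have cont1: "continuous_map Y Y (\<lambda>y. H (1, y))"
  proof -
    have "continuous_map Y (prod_topology (top_of_set {0..1::real}) Y) (\<lambda>y. (1, y))"
      by (auto simp: continuous_map_pairwise o_def)
    then show ?thesis
      using continuous_map_compose [OF _ contH] by (auto simp: o_def)
  qed
  have hom: "homotopic_with (\<lambda>h. h \<in> W \<rightarrow> W) Y Y (\<lambda>y. H (1, y)) id"
    if "\<And>t y. \<lbrakk>t \<in> {0..1}; y \<in> W\<rbrakk> \<Longrightarrow> H (t, y) \<in> W" for W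
  proof -
    have "homotopic_with (\<lambda>h. h \<in> W \<rightarrow> W) Y Y id (\<lambda>y. H (1, y))"
      unfolding homotopic_with_def using contH H0 that by (intro exI [of _ H]) auto
    then show ?thesis
      by (simp add: homotopic_with_sym)
  qed
  show ?thesis
  proof (rule homotopy_equivalence_relative_homology_group_isomorphism [where g = "\<lambda>y. H (1, y)"])
    show "homotopic_with (\<lambda>h. h \<in> Z \<rightarrow> Z) Y Y ((\<lambda>y. H (1, y)) \<circ> id) id"
      using hom [of Z] HZ by simp
    show "homotopic_with (\<lambda>h. h \<in> ?Z' \<rightarrow> ?Z') Y Y (id \<circ> (\<lambda>y. H (1, y))) id"
      using hom [of ?Z'] HZ' by simp
    show "id \<in> Z \<rightarrow> ?Z'"
      using core_subset Z_subset by auto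
  qed (use cont1 H1 in auto)
qed

text \<open>Excision needs an open set between \<open>Z\<close> and the complement of the core. The
  complement of the image of the closed half-radius disc serves: that image is compact, hence
  closed, and it misses \<open>Z\<close>.\<close>

lemma iso_excise:
  "hom_induced p (subtopology Y (topspace Y - Z)) (topspace Y - core - Z) Y (topspace Y - core) id
    \<in> iso (relative_homology_group p (subtopology Y (topspace Y - Z)) (topspace Y - core - Z))
          (relative_homology_group p Y (topspace Y - core))"
proof -
  let ?B = "{x \<in> topspace (unit_disc n). disc_norm n x \<in> {..1/2}}"
  have "closedin (unit_disc n) ?B"
    by (rule closedin_continuous_map_preimage [OF continuous_map_disc_norm]) auto
  then have "closedin Y (\<phi> ` ?B)"
    using continuous_imp_closed_map [OF cont compact_space_unit_disc Hausdorff]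
    by (auto simp: closed_map_def)
  then have "openin Y (topspace Y - \<phi> ` ?B)"
    by blast
  moreover have "topspace Y - \<phi> ` ?B \<subseteq> topspace Y - core"
    by (auto simp: core_def)
  moreover have "Z \<subseteq> topspace Y - \<phi> ` ?B"
  proof -
    have "?B \<inter> disc_boundary n = {}"
      by (auto simp: in_disc_boundary_iff)
    then show ?thesis
      using Z_subset in_Z_iff by blast
  qed
  ultimately have "Z \<subseteq> Y interior_of (topspace Y - core)"
    by (meson interior_of_maximal order_trans)
  then have "Y closure_of Z \<subseteq> Y interior_of (topspace Y - core)"
    by (simp add: closed closure_of_closedin)
  from homology_excision_axiom [OF this, of "topspace Y" p] show ?thesis
    by simp
qed

text \<open>The preimage of the complement of \<open>Z\<close> is exactly the open disc, so
  restricting the closed map \<phi> over that complement gives a closed continuous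
  bijection.\<close>

lemma homeomorphic_map_interior:
  "homeomorphic_map (subtopology (unit_disc n) (disc_interior n)) (subtopology Y (topspace Y - Z)) \<phi>"
proof (rule bijective_closed_imp_homeomorphic_map)
  have int: "disc_interior n \<subseteq> topspace (unit_disc n)"
    by (simp add: topspace_unit_disc_Un)
  show "continuous_map (subtopology (unit_disc n) (disc_interior n)) (subtopology Y (topspace Y - Z)) \<phi>"
    using cont interior
    by (auto simp: continuous_map_in_subtopology continuous_map_from_subtopology)
  show "closed_map (subtopology (unit_disc n) (disc_interior n)) (subtopology Y (topspace Y - Z)) \<phi>"
  proof (rule closed_map_restriction)
    show "closed_map (unit_disc n) Y \<phi>"
      by (rule continuous_imp_closed_map [OF cont compact_space_unit_disc Hausdorff])
    have "\<phi> x \<in> topspace Y" if "x \<in> topspace (unit_disc n)" for x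
      using cont that by (auto simp: continuous_map_def)
    then show "{x \<in> topspace (unit_disc n). \<phi> x \<in> topspace Y - Z} = disc_interior n"
      using in_Z_iff disc_interior_Int_boundary [of n] by (auto simp: topspace_unit_disc_Un)
  qed
  show "\<phi> ` topspace (subtopology (unit_disc n) (disc_interior n)) = topspace (subtopology Y (topspace Y - Z))"
    using interior int by (auto simp: Int_absorb1)
  show "inj_on \<phi> (topspace (subtopology (unit_disc n) (disc_interior n)))"
    using inj int by (auto simp: Int_absorb1)
qed

end

text \<open>The disc is a cell attached to its own boundary. Enlargement and excision are thereby
  available on both sides of the comparison.\<close>

lemma disc_attachment_disc: "disc_attachment (unit_disc n) (disc_boundary n) n id"
proof
  show "id ` disc_interior n = topspace (unit_disc n) - disc_boundary n"
    using disc_interior_Int_boundary [of n] by (auto simp: topspace_unit_disc_Un)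
qed (auto simp: Hausdorff_space_unit_disc closedin_disc_boundary)

context disc_attachment
begin

text \<open>Both pairs are enlarged to the complements of the cores and then excised down to the
  open cells, where \<phi> is a homeomorphism. In the resulting commutative diagram all other arrows
  are isomorphisms; cancelling excision on the right and enlargement on the left carries the
  property to \<phi> on the original pairs.\<close>

theorem relative_homology_iso:
  "hom_induced p (unit_disc n) (disc_boundary n) Y Z \<phi>
    \<in> iso (relative_homology_group p (unit_disc n) (disc_boundary n)) (relative_homology_group p Y Z)"
proof -
  interpret D: disc_attachment "unit_disc n" "disc_boundary n" n id
    by (rule disc_attachment_disc)
  let ?D = "unit_disc n" and ?S = "disc_boundary n" 
  let ?D' = "topspace ?D - D.core" and ?Y' = "topspace Y - core"
  let ?U = "subtopology ?D (topspace ?D - ?S)" and ?V = "subtopology Y (topspace Y - Z)"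
  have int: "topspace ?D - ?S = disc_interior n"
    using D.interior by simp
  have \<phi>Y: "\<phi> x \<in> topspace Y" if "x \<in> topspace ?D" for x
    using cont that by (auto simp: continuous_map_def)
  have Dcore: "D.core = {x \<in> topspace ?D. disc_norm n x < 1/2}"
    by (auto simp: D.core_def)
  have \<phi>D': "\<phi> \<in> ?D' \<rightarrow> ?Y'"
    using in_core_iff \<phi>Y by (auto simp: Dcore)
  have \<phi>U: "\<phi> ` (?D' - ?S) = ?Y' - Z"
  proof
    show "\<phi> ` (?D' - ?S) \<subseteq> ?Y' - Z"
      using \<phi>D' in_Z_iff by auto
    show "?Y' - Z \<subseteq> \<phi> ` (?D' - ?S)"
    proof
      fix y
      assume y: "y \<in> ?Y' - Z"
      then obtain x where x: "x \<in> topspace ?D - ?S" "y = \<phi> x"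
        using interior int by blast
      then show "y \<in> \<phi> ` (?D' - ?S)"
        using y in_core_iff by (auto simp: Dcore)
    qed
  qed
  have hU: "homeomorphic_map ?U ?V \<phi>"
    using homeomorphic_map_interior by (simp only: int)
  have "hom_induced p ?U (?D' - ?S) ?V (?Y' - Z) \<phi>
      \<in> iso (relative_homology_group p ?U (?D' - ?S)) (relative_homology_group p ?V (?Y' - Z))"
    by (rule homeomorphic_map_relative_homology_iso [OF hU _ \<phi>U]) auto
  from iso_set_trans [OF this iso_excise]
  have "hom_induced p ?V (?Y' - Z) Y ?Y' id \<circ> hom_induced p ?U (?D' - ?S) ?V (?Y' - Z) \<phi>
      \<in> iso (relative_homology_group p ?U (?D' - ?S)) (relative_homology_group p Y ?Y')" .
  also have "hom_induced p ?V (?Y' - Z) Y ?Y' id \<circ> hom_induced p ?U (?D' - ?S) ?V (?Y' - Z) \<phi>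
      = hom_induced p ?U (?D' - ?S) Y ?Y' (id \<circ> \<phi>)"
    using \<phi>U by (intro hom_induced_compose [symmetric] homeomorphic_imp_continuous_map [OF hU]) auto
  also have "\<dots> = hom_induced p ?U (?D' - ?S) Y ?Y' (\<phi> \<circ> id)"
    by simp
  also have "\<dots> = hom_induced p ?D ?D' Y ?Y' \<phi> \<circ> hom_induced p ?U (?D' - ?S) ?D ?D' id"
    using cont \<phi>D' by (intro hom_induced_compose) auto
  finally have "hom_induced p ?D ?D' Y ?Y' \<phi>
      \<in> iso (relative_homology_group p ?D ?D') (relative_homology_group p Y ?Y')"
    using D.iso_excise hom_induced_hom by (rule iso_right_factor)
  from iso_set_trans [OF D.iso_enlarge this]
  have "hom_induced p ?D ?D' Y ?Y' \<phi> \<circ> hom_induced p ?D ?S ?D ?D' id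
      \<in> iso (relative_homology_group p ?D ?S) (relative_homology_group p Y ?Y')" .
  also have "hom_induced p ?D ?D' Y ?Y' \<phi> \<circ> hom_induced p ?D ?S ?D ?D' id
      = hom_induced p ?D ?S Y ?Y' (\<phi> \<circ> id)"
    using cont \<phi>D' D.core_subset D.Z_subset by (intro hom_induced_compose [symmetric]) auto
  also have "\<dots> = hom_induced p ?D ?S Y ?Y' (id \<circ> \<phi>)"
    by simp
  also have "\<dots> = hom_induced p Y Z Y ?Y' id \<circ> hom_induced p ?D ?S Y Z \<phi>"
    using cont boundary core_subset Z_subset by (intro hom_induced_compose) auto
  finally show ?thesis
    using iso_enlarge hom_induced_hom by (rule iso_left_factor)
qed

end

section \<open>Orientations of discs\<close>

lemma (in comm_group) hom_finprod_comm_group: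
  assumes "comm_group H" "h \<in> hom G H" "f \<in> A \<rightarrow> carrier G"
  shows "h (finprod G f A) = finprod H (\<lambda>x. h (f x)) A"
proof -
  interpret H: comm_group H by fact
  interpret group_hom G H h
    by (simp add: group_hom_def group_hom_axioms_def assms)
  show ?thesis
    using assms(3)
  proof (induction A rule: infinite_finite_induct)
    case (insert a A)
    then have f: "f \<in> A \<rightarrow> carrier G" "f a \<in> carrier G"
      by auto
    then have "(\<lambda>x. h (f x)) \<in> A \<rightarrow> carrier H" "h (f a) \<in> carrier H"
      by (auto intro!: hom_closed)
    with insert f show ?case
      by simp
  qed auto
qed

lemma (in comm_group) finprod_int_pow:
  assumes "f \<in> A \<rightarrow> carrier G"
  shows "finprod G (\<lambda>x. f x [^] (k::int)) A = finprod G f A [^] k"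
  using assms
proof (induction A rule: infinite_finite_induct)
  case (insert a A)
  then show ?case
    by (simp add: Pi_iff int_pow_distrib)
qed auto

text \<open>The product of two integer matrices in multiplicative notation. It expands the boundary
  of a boundary in cell classes, and with a singleton \<open>B\<close> it collects powers of one
  element.\<close>

lemma (in comm_group) finprod_int_pow_sum:
  assumes "finite B" "c \<in> B \<rightarrow> carrier G"
  shows "(\<Otimes>f\<in>A. (\<Otimes>g\<in>B. c g [^] (b f g :: int)) [^] (a f :: int)) = (\<Otimes>g\<in>B. c g [^] (\<Sum>f\<in>A. a f * b f g))"
proof (induction A rule: infinite_finite_induct)
  case (insert x A)
  have c: "c g \<in> carrier G" if "g \<in> B" for g
    using that assms by auto
  have "(\<Otimes>g\<in>B. c g [^] b x g) [^] a x = (\<Otimes>g\<in>B. c g [^] (a x * b x g))"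
    using c by (subst finprod_int_pow [symmetric]) (auto simp: int_pow_pow mult.commute intro!: finprod_cong')
  moreover have "(\<lambda>f. (\<Otimes>g\<in>B. c g [^] b f g) [^] a f) \<in> A \<rightarrow> carrier G"
    "(\<Otimes>g\<in>B. c g [^] b x g) [^] a x \<in> carrier G"
    using c by (auto intro!: int_pow_closed finprod_closed)
  ultimately have "(\<Otimes>f\<in>insert x A. (\<Otimes>g\<in>B. c g [^] b f g) [^] a f)
      = (\<Otimes>g\<in>B. c g [^] (a x * b x g) \<otimes> c g [^] (\<Sum>f\<in>A. a f * b f g))"
    using insert c by (subst finprod_multf) auto
  also have "\<dots> = (\<Otimes>g\<in>B. c g [^] (\<Sum>f\<in>insert x A. a f * b f g))"
    using insert c by (intro finprod_cong') (auto simp: int_pow_mult)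
  finally show ?case .
qed auto

lemma contractible_space_unit_disc: "contractible_space (unit_disc n)"
proof -
  let ?X = "prod_topology (top_of_set {0..1::real}) (unit_disc n)"
  let ?h = "\<lambda>(t, x). \<lambda>i. (1 - t) * x i :: real"
  have t: "continuous_map ?X euclideanreal (\<lambda>z. 1 - fst z)"
    by (intro continuous_map_diff continuous_map_canonical_const)
       (metis continuous_map_fst continuous_map_into_fulltopology)
  have x: "continuous_map ?X euclideanreal (\<lambda>z. snd z i)" for i
    using continuous_map_compose [OF continuous_map_snd continuous_map_unit_disc_component]
    by (simp add: o_def)
  have "continuous_map ?X (powertop_real UNIV) ?h"
    by (simp add: continuous_map_componentwise_UNIV case_prod_unfold continuous_map_real_mult [OF t x])
  moreover have "?h (t, x) \<in> topspace (unit_disc n)"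
    if "t \<in> {0..1}" "x \<in> topspace (unit_disc n)" for t x
    using that by (auto simp: in_unit_disc_iff disc_norm_scale intro: mult_le_one)
  ultimately have "continuous_map ?X (unit_disc n) ?h"
    unfolding unit_disc_eq
    by (auto simp: continuous_map_in_subtopology topspace_unit_disc euclidean_product_topology case_prod_unfold)
  then have "homotopic_with (\<lambda>x. True) (unit_disc n) (unit_disc n) id (\<lambda>x i. 0)"
    unfolding homotopic_with_def by (intro exI [of _ ?h]) auto
  then show ?thesis
    by (auto simp: contractible_space_def)
qed

text \<open>For \<open>n = 0\<close> the pair is a point with empty boundary, whose homology in
  degree 0 is the coefficient group. For \<open>n = Suc m\<close> the boundary is the m-sphere, and
  since the disc is contractible the relative group is the reduced homology of that sphere one
  degree lower.\<close>

lemma isomorphic_group_disc_boundary: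
  "relative_homology_group (int n) (unit_disc n) (disc_boundary n) \<cong> integer_group"
proof (cases n)
  case 0
  have "topspace (unit_disc 0) = {\<lambda>_. 0}" "disc_boundary 0 = {}"
    by (auto simp: topspace_unit_disc disc_boundary_def)
  with 0 show ?thesis
    by (simp add: homology_coefficients)
next
  case (Suc m)
  have eq: "subtopology (unit_disc n) (disc_boundary n) = nsphere m"
  proof -
    have "disc_boundary n = {x. (\<Sum>i\<le>m. (x i)\<^sup>2) = 1 \<and> (\<forall>i>m. x i = 0)}"
      by (auto simp: disc_boundary_def topspace_unit_disc Suc Suc_le_eq lessThan_Suc_atMost)
    moreover have "disc_boundary n \<subseteq> topspace (unit_disc n)"
      by (auto simp: disc_boundary_def)
    ultimately show ?thesis
      unfolding unit_disc_eq nsphere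
      by (simp add: subtopology_subtopology euclidean_product_topology Int_absorb1)
  qed
  have "topspace (nsphere m) \<noteq> {}"
    using in_topspace_nsphere by blast
  then have "topspace (unit_disc n) \<inter> disc_boundary n \<noteq> {}"
    by (metis eq topspace_subtopology)
  from isomorphic_group_relative_homology_of_contractible [OF contractible_space_unit_disc this, of "int n"]
  have "relative_homology_group (int n) (unit_disc n) (disc_boundary n)
      \<cong> reduced_homology_group (int m) (nsphere m)"
    unfolding eq by (simp add: Suc)
  with reduced_homology_group_nsphere(1) show ?thesis
    by (blast intro: iso_trans)
qed

text \<open>The \<open>SOME\<close> in the definition is justified by transporting 1 along an
  isomorphism with the integers. Any generator of an infinite group has infinite order, which gives
  the last claim for the generator actually chosen.\<close>

lemma disc_orientation:
  fixes n :: nat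
  defines "G \<equiv> relative_homology_group (int n) (unit_disc n) (disc_boundary n)"
  shows disc_orientation_carrier: "disc_orientation n \<in> carrier G"
    and disc_orientation_generates: "x \<in> carrier G \<Longrightarrow> \<exists>k::int. x = disc_orientation n [^]\<^bsub>G\<^esub> k"
    and disc_orientation_pow_eq_one: "disc_orientation n [^]\<^bsub>G\<^esub> (k::int) = \<one>\<^bsub>G\<^esub> \<longleftrightarrow> k = 0"
proof -
  interpret G: group G
    by (simp add: G_def)
  have "integer_group \<cong> G"
    using isomorphic_group_disc_boundary [of n] unfolding G_def
    by (simp add: group.iso_sym)
  then obtain h where h: "h \<in> iso integer_group G"
    by (auto simp: is_iso_def)
  then have hom: "h \<in> hom integer_group G" and bij: "bij_betw h UNIV (carrier G)"
    by (auto simp: iso_def)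
  interpret h: group_hom integer_group G h
    by (simp add: group_hom_def group_hom_axioms_def hom)
  have pow: "h k = h 1 [^]\<^bsub>G\<^esub> k" for k :: int
    using h.hom_int_pow [of 1 k] by simp
  have "carrier (subgroup_generated G {h 1}) = carrier G"
  proof -
    have "range h = range (\<lambda>k::int. h 1 [^]\<^bsub>G\<^esub> k)"
      using pow by (rule image_cong [OF refl])
    then show ?thesis
      using bij h.hom_closed [of 1]
      by (simp only: G.carrier_subgroup_generated_by_singleton bij_betw_def carrier_integer_group UNIV_I)
  qed
  then have "\<exists>g. g \<in> carrier G \<and> carrier (subgroup_generated G {g}) = carrier G"
    using h.hom_closed [of 1] by (intro exI [of _ "h 1"]) simp
  from someI_ex [OF this]
  have o: "disc_orientation n \<in> carrier G" "carrier (subgroup_generated G {disc_orientation n}) = carrier G"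
    unfolding disc_orientation_def G_def [symmetric] Let_def by auto
  show "disc_orientation n \<in> carrier G"
    by (rule o)
  show "\<exists>k::int. x = disc_orientation n [^]\<^bsub>G\<^esub> k" if "x \<in> carrier G"
    using o that by (auto simp: G.carrier_subgroup_generated_by_singleton)
  have "infinite (carrier G)"
    using bij bij_betw_finite infinite_UNIV_int by metis
  then have "\<nexists>i::int. i \<noteq> 0 \<and> disc_orientation n [^]\<^bsub>G\<^esub> i = \<one>\<^bsub>G\<^esub>"
    using G.finite_cyclic_subgroup_int [OF o(1)] unfolding o(2) by simp
  then show "disc_orientation n [^]\<^bsub>G\<^esub> k = \<one>\<^bsub>G\<^esub> \<longleftrightarrow> k = 0"
    by (metis int_pow_0)
qed

context disc_attachment
begin

definition oriented_class :: "'a chain set" where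
  "oriented_class =
     hom_induced (int n) (unit_disc n) (disc_boundary n) Y Z \<phi> (disc_orientation n)"

lemma oriented_class_carrier: "oriented_class \<in> carrier (relative_homology_group (int n) Y Z)"
  by (simp add: oriented_class_def hom_induced_carrier)

lemma hom_induced_pow:
  "hom_induced (int n) (unit_disc n) (disc_boundary n) Y Z \<phi>
     (disc_orientation n [^]\<^bsub>relative_homology_group (int n) (unit_disc n) (disc_boundary n)\<^esub> k)
   = oriented_class [^]\<^bsub>relative_homology_group (int n) Y Z\<^esub> (k::int)"
  unfolding oriented_class_def
  by (rule group_hom.hom_int_pow)
     (simp_all add: group_hom_def group_hom_axioms_def hom_induced_hom disc_orientation_carrier)

lemma oriented_class_generates:
  assumes "x \<in> carrier (relative_homology_group (int n) Y Z)"
  shows "\<exists>k::int. x = oriented_class [^]\<^bsub>relative_homology_group (int n) Y Z\<^esub> k"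
proof -
  obtain y where y: "y \<in> carrier (relative_homology_group (int n) (unit_disc n) (disc_boundary n))"
    "x = hom_induced (int n) (unit_disc n) (disc_boundary n) Y Z \<phi> y"
    using relative_homology_iso [of "int n"] assms by (auto simp: iso_iff)
  then show ?thesis
    using disc_orientation_generates [OF y(1)] hom_induced_pow by metis
qed

lemma oriented_class_pow_eq_one:
  "oriented_class [^]\<^bsub>relative_homology_group (int n) Y Z\<^esub> (k::int)
     = \<one>\<^bsub>relative_homology_group (int n) Y Z\<^esub> \<longleftrightarrow> k = 0"
proof -
  let ?G = "relative_homology_group (int n) (unit_disc n) (disc_boundary n)"
  interpret group_hom ?G "relative_homology_group (int n) Y Z"
    "hom_induced (int n) (unit_disc n) (disc_boundary n) Y Z \<phi>"
    by (simp add: group_hom_def group_hom_axioms_def hom_induced_hom)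
  have inj: "inj_on (hom_induced (int n) (unit_disc n) (disc_boundary n) Y Z \<phi>) (carrier ?G)"
    using relative_homology_iso [of "int n"] by (simp only: iso_def bij_betw_def mem_Collect_eq)
  have "disc_orientation n [^]\<^bsub>?G\<^esub> k \<in> carrier ?G"
    by (simp add: disc_orientation_carrier)
  then show ?thesis
    using inj_on_eq_iff [OF inj, of "disc_orientation n [^]\<^bsub>?G\<^esub> k" "\<one>\<^bsub>?G\<^esub>"]
    by (simp add: hom_induced_pow disc_orientation_pow_eq_one del: one_relative_homology_group)
qed

end

section \<open>Cellular homology\<close>

declare one_relative_homology_group [simp del]

locale finite_cw =
  fixes X :: "('a, 'c) cw_complex"
  assumes finite_cw_complex: "finite_cw_complex X"
begin

abbreviation W where "W \<equiv> cw_space X"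

definition realization :: "'c set \<Rightarrow> 'a set" where
  "realization T = (\<Union>e\<in>T. open_cell X e)"

lemma finite_cells: "finite (cells X)"
  and Hausdorff: "Hausdorff_space W"
  and space_eq: "topspace W = realization (cells X)"
  using finite_cw_complex by (auto simp: finite_cw_complex_def realization_def)

lemma cell_facts:
  assumes "e \<in> cells X" "cdim X e \<ge> 0"
  shows continuous_char_map: "continuous_map (unit_disc (nat (cdim X e))) W (char_map X e)"
    and inj_char_map: "inj_on (char_map X e) (disc_interior (nat (cdim X e)))"
    and char_map_boundary: "char_map X e ` disc_boundary (nat (cdim X e)) \<subseteq> skeleton_set X (cdim X e - 1)"
  using finite_cw_complex assms by (auto simp: finite_cw_complex_def)

lemma open_cell_disjoint:
  "\<lbrakk>e \<in> cells X; f \<in> cells X; e \<noteq> f\<rbrakk> \<Longrightarrow> open_cell X e \<inter> open_cell X f = {}"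
  using finite_cw_complex by (auto simp: finite_cw_complex_def pairwise_def disjnt_def)

lemma finite_cells_of [simp]: "finite (cells_of X n)"
  using finite_cells by (simp add: cells_of_def)

lemma skeleton_set_eq: "skeleton_set X n = realization {e \<in> cells X. cdim X e \<le> n}"
  by (simp add: skeleton_set_def realization_def)

lemma skeleton_set_mono: "m \<le> n \<Longrightarrow> skeleton_set X m \<subseteq> skeleton_set X n"
  by (auto simp: skeleton_set_def)

lemma skeleton_set_subset: "skeleton_set X n \<subseteq> topspace W"
  by (auto simp: skeleton_set_eq space_eq realization_def)

lemma skeleton_set_neg: "n < 0 \<Longrightarrow> skeleton_set X n = {}"
  by (auto simp: skeleton_set_def open_cell_def)

lemma closed_cell_eq:
  assumes "e \<in> cells X"
  shows "closed_cell X e = open_cell X e \<union>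
    (if cdim X e < 0 then {} else char_map X e ` disc_boundary (nat (cdim X e)))"
  by (auto simp: closed_cell_def open_cell_def topspace_unit_disc_Un)

lemma open_subset_closed_cell: "e \<in> cells X \<Longrightarrow> open_cell X e \<subseteq> closed_cell X e"
  by (simp add: closed_cell_eq)

lemma closed_cell_subset:
  assumes "e \<in> cells X"
  shows "closed_cell X e \<subseteq> open_cell X e \<union> skeleton_set X (cdim X e - 1)"
  using assms char_map_boundary [of e] by (cases "cdim X e < 0") (auto simp: closed_cell_eq)

lemma closedin_closed_cell:
  assumes "e \<in> cells X"
  shows "closedin W (closed_cell X e)"
proof (cases "cdim X e < 0")
  case False
  then have "compactin W (closed_cell X e)"
    using assms image_compactin [OF _ continuous_char_map] compact_space_unit_disc
    by (auto simp: closed_cell_def compact_space_def)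
  then show ?thesis
    using Hausdorff compactin_imp_closedin by blast
qed (simp add: closed_cell_def)

section \<open>Attaching the cells of one dimension one at a time\<close>

definition partial_skeleton :: "nat \<Rightarrow> 'c set \<Rightarrow> 'a set" where
  "partial_skeleton n F = skeleton_set X (int n - 1) \<union> realization F"

lemma partial_skeleton_empty: "partial_skeleton n {} = skeleton_set X (int n - 1)"
  by (simp add: partial_skeleton_def realization_def)

lemma partial_skeleton_all: "partial_skeleton n (cells_of X (int n)) = skeleton_set X (int n)"
proof -
  have "{e \<in> cells X. cdim X e \<le> int n} = {e \<in> cells X. cdim X e \<le> int n - 1} \<union> cells_of X (int n)"
    by (auto simp: cells_of_def)
  then show ?thesis
    by (simp add: partial_skeleton_def skeleton_set_eq realization_def)
qed

lemma partial_skeleton_mono: "F \<subseteq> G \<Longrightarrow> partial_skeleton n F \<subseteq> partial_skeleton n G"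
  by (auto simp: partial_skeleton_def realization_def)

lemma partial_skeleton_subset: "F \<subseteq> cells_of X (int n) \<Longrightarrow> partial_skeleton n F \<subseteq> topspace W"
  using partial_skeleton_mono [of F "cells_of X (int n)" n] skeleton_set_subset
  by (auto simp: partial_skeleton_all)

text \<open>Closed cells are compact and hence closed, and the boundary of each cell involved lies
  in the (n-1)-skeleton; so the set is a finite union of closed cells.\<close>

lemma closedin_partial_skeleton:
  assumes "F \<subseteq> cells_of X (int n)"
  shows "closedin W (partial_skeleton n F)"
proof -
  let ?T = "{e \<in> cells X. cdim X e \<le> int n - 1} \<union> F"
  have T: "?T \<subseteq> cells X"
    using assms by (auto simp: cells_of_def)
  have "partial_skeleton n F = (\<Union>e\<in>?T. closed_cell X e)"
  proof
    show "partial_skeleton n F \<subseteq> (\<Union>e\<in>?T. closed_cell X e)"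
      using open_subset_closed_cell T
      by (fastforce simp: partial_skeleton_def skeleton_set_eq realization_def)
    have "closed_cell X e \<subseteq> partial_skeleton n F" if "e \<in> ?T" for e
    proof -
      have "cdim X e \<le> int n"
        using that assms by (auto simp: cells_of_def)
      then have "skeleton_set X (cdim X e - 1) \<subseteq> partial_skeleton n F"
        using skeleton_set_mono [of "cdim X e - 1" "int n - 1"] by (auto simp: partial_skeleton_def)
      moreover have "open_cell X e \<subseteq> partial_skeleton n F"
        using that by (auto simp: partial_skeleton_def skeleton_set_eq realization_def)
      ultimately show ?thesis
        using closed_cell_subset [of e] that T by blast
    qed
    then show "(\<Union>e\<in>?T. closed_cell X e) \<subseteq> partial_skeleton n F"
      by blast
  qed
  moreover have "finite ?T"
    using T finite_cells finite_subset by blast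
  ultimately show ?thesis
    using closedin_closed_cell T by (simp only:) (rule closedin_Union; auto)
qed

text \<open>Any n-cell may be taken as the last one attached. Generation uses this along an
  induction over \<open>F\<close>, independence uses it with \<open>F\<close> consisting of all
  other n-cells. Disjointness of open cells makes the new cell the exact complement of the old
  stage.\<close>

lemma attachment:
  assumes F: "insert e F \<subseteq> cells_of X (int n)" and e: "e \<notin> F"
  shows "disc_attachment (subtopology W (partial_skeleton n (insert e F))) (partial_skeleton n F) n (char_map X e)"
proof -
  let ?P = "partial_skeleton n (insert e F)"
  have ce: "e \<in> cells X" "cdim X e = int n"
    using F by (auto simp: cells_of_def)
  then have open_e: "open_cell X e = char_map X e ` disc_interior n"
    by (simp add: open_cell_def)
  have bnd: "char_map X e ` disc_boundary n \<subseteq> partial_skeleton n F"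
    using char_map_boundary [of e] ce by (auto simp: partial_skeleton_def)
  have P: "?P = partial_skeleton n F \<union> open_cell X e"
    by (auto simp: partial_skeleton_def realization_def)
  have disj: "open_cell X e \<inter> partial_skeleton n F = {}"
  proof -
    have "open_cell X e \<inter> open_cell X f = {}"
      if "f \<in> F \<or> f \<in> cells X \<and> cdim X f \<le> int n - 1" for f
      using that F e ce by (intro open_cell_disjoint) (auto simp: cells_of_def)
    then show ?thesis
      by (auto simp: partial_skeleton_def realization_def skeleton_set_eq)
  qed
  have PW: "topspace (subtopology W ?P) = ?P"
    using partial_skeleton_subset [OF F] by auto
  show ?thesis
  proof
    show "Hausdorff_space (subtopology W ?P)"
      by (simp add: Hausdorff Hausdorff_space_subtopology)
    show "closedin (subtopology W ?P) (partial_skeleton n F)"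
      using F by (intro closedin_subset_topspace closedin_partial_skeleton partial_skeleton_mono) auto
    show "continuous_map (unit_disc n) (subtopology W ?P) (char_map X e)"
      using continuous_char_map [of e] ce bnd by (auto simp: continuous_map_in_subtopology topspace_unit_disc_Un P open_e)
    show "inj_on (char_map X e) (disc_interior n)"
      using inj_char_map [of e] ce by simp
    show "char_map X e \<in> disc_boundary n \<rightarrow> partial_skeleton n F"
      using bnd by auto
    show "char_map X e ` disc_interior n = topspace (subtopology W ?P) - partial_skeleton n F"
      unfolding PW using disj by (auto simp: P open_e)
  qed
qed

text \<open>The class of the cell relative to the (n-1)-skeleton at the stage \<open>F\<close>; it
  is meaningful for \<open>e\<close> in \<open>F\<close>, and for the full set of n-cells it is
  \<open>cell_class\<close>.\<close>

definition partial_class :: "nat \<Rightarrow> 'c set \<Rightarrow> 'c \<Rightarrow> 'a chain set" where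
  "partial_class n F e = hom_induced (int n) (unit_disc n) (disc_boundary n)
     (subtopology W (partial_skeleton n F)) (partial_skeleton n {}) (char_map X e) (disc_orientation n)"

lemma partial_class_carrier:
  "partial_class n F e \<in> carrier (relative_homology_group (int n)
     (subtopology W (partial_skeleton n F)) (partial_skeleton n {}))"
  by (simp add: partial_class_def hom_induced_carrier)

lemma char_map_continuous_partial:
  assumes "e \<in> F" "F \<subseteq> cells_of X (int n)"
  shows "continuous_map (unit_disc n) (subtopology W (partial_skeleton n F)) (char_map X e)"
    and "char_map X e \<in> disc_boundary n \<rightarrow> partial_skeleton n G"
proof -
  interpret disc_attachment "subtopology W (partial_skeleton n (insert e (F - {e})))"
      "partial_skeleton n (F - {e})" n "char_map X e"
    using assms by (intro attachment) auto
  show "continuous_map (unit_disc n) (subtopology W (partial_skeleton n F)) (char_map X e)"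
    using cont assms by (simp add: insert_absorb)
  show "char_map X e \<in> disc_boundary n \<rightarrow> partial_skeleton n G"
  proof -
    have "e \<in> cells X" "cdim X e = int n"
      using assms by (auto simp: cells_of_def)
    then show ?thesis
      using char_map_boundary [of e] by (auto simp: partial_skeleton_def)
  qed
qed

text \<open>Functoriality in both places where stages change: enlarging the space from
  \<open>F\<close> to \<open>F'\<close>, and enlarging the subspace from the (n-1)-skeleton to the
  stage \<open>G\<close>.\<close>

lemma hom_induced_partial_class:
  assumes "e \<in> F" "F \<subseteq> F'" "F' \<subseteq> cells_of X (int n)"
  shows "hom_induced (int n) (subtopology W (partial_skeleton n F)) (partial_skeleton n {})
      (subtopology W (partial_skeleton n F')) (partial_skeleton n G) id (partial_class n F e)
    = hom_induced (int n) (unit_disc n) (disc_boundary n)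
      (subtopology W (partial_skeleton n F')) (partial_skeleton n G) (char_map X e) (disc_orientation n)"
proof -
  have F: "F \<subseteq> cells_of X (int n)"
    using assms by blast
  have "continuous_map (subtopology W (partial_skeleton n F)) (subtopology W (partial_skeleton n F')) id"
    using partial_skeleton_mono [OF assms(2), of n] partial_skeleton_subset [OF F]
    by (auto simp: continuous_map_in_subtopology)
  then show ?thesis
    unfolding partial_class_def
    using char_map_continuous_partial [OF assms(1) F] partial_skeleton_mono [of "{}" G n]
    by (subst hom_induced_compose') auto
qed

text \<open>Induction along the exact sequence of the triple formed by the (n-1)-skeleton, the stage
  \<open>F\<close> and the stage with \<open>e\<close> added. The quotient term is generated by the
  class of \<open>e\<close>, the other term by induction.\<close>

lemma partial_classes_generate:
  assumes "finite F" "F \<subseteq> cells_of X (int n)"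
    and "x \<in> carrier (relative_homology_group (int n) (subtopology W (partial_skeleton n F)) (partial_skeleton n {}))"
  shows "\<exists>a. x = (\<Otimes>\<^bsub>relative_homology_group (int n) (subtopology W (partial_skeleton n F)) (partial_skeleton n {})\<^esub>
      e\<in>F. partial_class n F e [^]\<^bsub>relative_homology_group (int n) (subtopology W (partial_skeleton n F)) (partial_skeleton n {})\<^esub> (a e :: int))"
  using assms
proof (induction F arbitrary: x rule: finite_induct)
  case empty
  let ?Y = "subtopology W (partial_skeleton n {})"
  let ?G = "relative_homology_group (int n) ?Y (partial_skeleton n {})"
  interpret G: comm_group ?G
    by simp
  have "topspace ?Y = partial_skeleton n {}"
    using partial_skeleton_subset [of "{}" n] by auto
  then have "trivial_group ?G"
    using trivial_relative_homology_group_topspace [of "int n" ?Y] by simp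
  with empty show ?case
    by (simp add: trivial_group_def)
next
  case (insert e F)
  let ?Y = "subtopology W (partial_skeleton n (insert e F))"
  let ?P = "partial_skeleton n F" and ?A = "partial_skeleton n {}"
  let ?G = "relative_homology_group (int n) ?Y ?A"
  let ?H = "relative_homology_group (int n) ?Y ?P"
  let ?K = "relative_homology_group (int n) (subtopology W ?P) ?A"
  let ?q = "hom_induced (int n) ?Y ?A ?Y ?P id"
  let ?i = "hom_induced (int n) (subtopology W ?P) ?A ?Y ?A id"
  let ?c = "partial_class n (insert e F)"
  interpret attach: disc_attachment ?Y ?P n "char_map X e"
    using insert by (intro attachment) auto
  interpret G: comm_group ?G by simp
  interpret H: comm_group ?H by simp
  interpret K: comm_group ?K by simp
  interpret q: group_hom ?G ?H ?q
    by (simp add: group_hom_def group_hom_axioms_def hom_induced_hom)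
  have i: "?i \<in> hom ?K ?G"
    by (rule hom_induced_hom)
  have sub: "subtopology ?Y ?P = subtopology W ?P"
    by (simp add: subtopology_subtopology Int_absorb1 partial_skeleton_mono [OF subset_insertI])
  have c: "?c f \<in> carrier ?G" for f
    by (rule partial_class_carrier)
  obtain k :: int where k: "?q x = attach.oriented_class [^]\<^bsub>?H\<^esub> k"
    using attach.oriented_class_generates [of "?q x"] hom_induced_carrier by blast
  have qc: "?q (?c e) = attach.oriented_class"
    using insert.prems by (simp add: hom_induced_partial_class attach.oriented_class_def)
  \<comment> \<open>After \<open>k\<close> copies of the new class are removed, what is left dies
    relative to \<open>?P\<close>, so by exactness it comes from the previous stage.\<close>
  let ?y = "x \<otimes>\<^bsub>?G\<^esub> inv\<^bsub>?G\<^esub> (?c e [^]\<^bsub>?G\<^esub> k)"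
  have y: "?y \<in> carrier ?G"
    using insert.prems c by simp
  have "?q ?y = \<one>\<^bsub>?H\<^esub>"
    using insert.prems c qc k attach.oriented_class_carrier by (simp add: q.hom_int_pow)
  then have "?y \<in> kernel ?G ?H ?q"
    using y by (simp add: kernel_def)
  moreover have "?A \<subseteq> ?P"
    by (rule partial_skeleton_mono) auto
  ultimately obtain z where z: "z \<in> carrier ?K" "?y = ?i z"
    using homology_exactness_triple_3 [of ?A ?P "int n" ?Y] by (auto simp: sub)
  then obtain a where a: "z = (\<Otimes>\<^bsub>?K\<^esub>f\<in>F. partial_class n F f [^]\<^bsub>?K\<^esub> (a f :: int))"
    using insert by auto
  have "?i z = (\<Otimes>\<^bsub>?G\<^esub>f\<in>F. ?i (partial_class n F f [^]\<^bsub>?K\<^esub> (a f :: int)))"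
    unfolding a by (rule K.hom_finprod_comm_group [OF G.comm_group_axioms i]) (auto simp: partial_class_carrier)
  also have "\<dots> = (\<Otimes>\<^bsub>?G\<^esub>f\<in>F. ?c f [^]\<^bsub>?G\<^esub> a f)"
  proof (rule G.finprod_cong')
    fix f
    assume "f \<in> F"
    then have "?i (partial_class n F f) = ?c f"
      using insert.prems insert.hyps
      by (subst hom_induced_partial_class) (auto simp: partial_class_def)
    then show "?i (partial_class n F f [^]\<^bsub>?K\<^esub> a f) = ?c f [^]\<^bsub>?G\<^esub> a f"
      using hom_int_pow [OF i, of "partial_class n F f"] by (simp add: partial_class_carrier)
  qed (use c in auto)
  finally have y_eq: "?y = (\<Otimes>\<^bsub>?G\<^esub>f\<in>F. ?c f [^]\<^bsub>?G\<^esub> a f)"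
    using z by simp
  let ?a = "a(e := k)"
  have "x = ?c e [^]\<^bsub>?G\<^esub> k \<otimes>\<^bsub>?G\<^esub> ?y"
  proof -
    have "?c e [^]\<^bsub>?G\<^esub> k \<otimes>\<^bsub>?G\<^esub> ?y = x \<otimes>\<^bsub>?G\<^esub> (?c e [^]\<^bsub>?G\<^esub> k \<otimes>\<^bsub>?G\<^esub> inv\<^bsub>?G\<^esub> (?c e [^]\<^bsub>?G\<^esub> k))"
      using c insert.prems by (intro G.m_lcomm) auto
    then show ?thesis
      using c insert.prems by simp
  qed
  also have "\<dots> = ?c e [^]\<^bsub>?G\<^esub> ?a e \<otimes>\<^bsub>?G\<^esub> (\<Otimes>\<^bsub>?G\<^esub>f\<in>F. ?c f [^]\<^bsub>?G\<^esub> ?a f)"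
  proof -
    have "(\<Otimes>\<^bsub>?G\<^esub>f\<in>F. ?c f [^]\<^bsub>?G\<^esub> a f) = (\<Otimes>\<^bsub>?G\<^esub>f\<in>F. ?c f [^]\<^bsub>?G\<^esub> ?a f)"
    proof (rule G.finprod_cong')
      fix f
      assume "f \<in> F"
      with insert.hyps have "f \<noteq> e"
        by blast
      then show "?c f [^]\<^bsub>?G\<^esub> a f = ?c f [^]\<^bsub>?G\<^esub> ?a f"
        by simp
    qed (use c in auto)
    then show ?thesis
      unfolding y_eq by simp
  qed
  also have "\<dots> = (\<Otimes>\<^bsub>?G\<^esub>f\<in>insert e F. ?c f [^]\<^bsub>?G\<^esub> ?a f)"
    using c insert.hyps by (intro G.finprod_insert [symmetric]) auto
  finally show ?case
    by blast
qed

lemma skeletal_homology_eq: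
  "skeletal_homology X (int n) = relative_homology_group (int n)
     (subtopology W (partial_skeleton n (cells_of X (int n)))) (partial_skeleton n {})"
  by (simp add: skeletal_homology_def partial_skeleton_all partial_skeleton_empty)

lemma cell_class_eq:
  "e \<in> cells_of X (int n) \<Longrightarrow> cell_class X e = partial_class n (cells_of X (int n)) e"
  by (simp add: cell_class_def partial_class_def partial_skeleton_all partial_skeleton_empty)
     (simp add: cells_of_def)

lemma comm_group_skeletal_homology [simp]: "comm_group (skeletal_homology X n)"
  by (simp add: skeletal_homology_def)

lemma cell_class_carrier: "e \<in> cells_of X n \<Longrightarrow> cell_class X e \<in> carrier (skeletal_homology X n)"
  by (auto simp: cell_class_def skeletal_homology_def cells_of_def hom_induced_carrier)

lemma cell_classes_generate:
  assumes "n \<ge> 0" "x \<in> carrier (skeletal_homology X n)"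
  shows "\<exists>a. x = (\<Otimes>\<^bsub>skeletal_homology X n\<^esub>e\<in>cells_of X n. cell_class X e [^]\<^bsub>skeletal_homology X n\<^esub> (a e :: int))"
proof -
  obtain m where m: "n = int m"
    using assms(1) nonneg_int_cases by blast
  let ?G = "skeletal_homology X (int m)"
  interpret comm_group ?G by simp
  obtain a where "x = (\<Otimes>\<^bsub>?G\<^esub>e\<in>cells_of X (int m). partial_class m (cells_of X (int m)) e [^]\<^bsub>?G\<^esub> (a e :: int))"
    using partial_classes_generate [of "cells_of X (int m)" m x] assms(2) m
    by (auto simp flip: skeletal_homology_eq)
  also have "\<dots> = (\<Otimes>\<^bsub>?G\<^esub>e\<in>cells_of X (int m). cell_class X e [^]\<^bsub>?G\<^esub> a e)"
    using cell_class_carrier by (intro finprod_cong') (auto simp: cell_class_eq)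
  finally show ?thesis
    using m by blast
qed

text \<open>Each coefficient is read off separately, by passing to homology relative to the
  complement of the open cell \<open>e\<close> in the n-skeleton. There only the class of
  \<open>e\<close> survives, and it has infinite order.\<close>

lemma cell_classes_independent:
  assumes "n \<ge> 0"
    and one: "(\<Otimes>\<^bsub>skeletal_homology X n\<^esub>e\<in>cells_of X n. cell_class X e [^]\<^bsub>skeletal_homology X n\<^esub> (a e :: int))
      = \<one>\<^bsub>skeletal_homology X n\<^esub>"
    and e: "e \<in> cells_of X n"
  shows "a e = 0"
proof -
  obtain m where m: "n = int m"
    using assms(1) nonneg_int_cases by blast
  let ?C = "cells_of X (int m)"
  have eC: "e \<in> ?C" "insert e (?C - {e}) = ?C"
    using e m by auto
  let ?Y = "subtopology W (partial_skeleton m ?C)"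
  let ?A = "partial_skeleton m {}" and ?P = "partial_skeleton m (?C - {e})"
  let ?G = "skeletal_homology X (int m)"
  let ?H = "relative_homology_group (int m) ?Y ?P"
  let ?q = "hom_induced (int m) ?Y ?A ?Y ?P id"
  interpret G: comm_group ?G by simp
  interpret H: comm_group ?H by simp
  have q: "?q \<in> hom ?G ?H"
    by (simp add: skeletal_homology_eq hom_induced_hom)
  interpret q: group_hom ?G ?H ?q
    by (simp add: group_hom_def group_hom_axioms_def q)
  interpret attach: disc_attachment ?Y ?P m "char_map X e"
    using attachment [of e "?C - {e}" m] eC by simp
  have c: "cell_class X f \<in> carrier ?G" if "f \<in> ?C" for f
    using cell_class_carrier that by blast
  have qf: "?q (cell_class X f) = hom_induced (int m) (unit_disc m) (disc_boundary m) ?Y ?P (char_map X f) (disc_orientation m)"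
    if "f \<in> ?C" for f
    using that by (simp add: cell_class_eq hom_induced_partial_class)
  have qe: "?q (cell_class X e) = attach.oriented_class"
    using qf eC by (simp add: attach.oriented_class_def)
  \<comment> \<open>The characteristic map of another cell \<open>f\<close> has its image in
    \<open>?P\<close>, so the induced map factors through the homology of \<open>?P\<close> relative
    to itself, which is trivial.\<close>
  have q1: "?q (cell_class X f) = \<one>\<^bsub>?H\<^esub>" if f: "f \<in> ?C" "f \<noteq> e" for f
  proof -
    let ?D = "unit_disc m"
    have P: "topspace (subtopology W ?P) = ?P"
      using partial_skeleton_subset [of "?C - {e}" m] by auto
    have contP: "continuous_map ?D (subtopology W ?P) (char_map X f)"
      using f by (intro char_map_continuous_partial) auto
    have "hom_induced (int m) ?D (disc_boundary m) ?Y ?P (id \<circ> char_map X f)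
        = hom_induced (int m) (subtopology W ?P) ?P ?Y ?P id
          \<circ> hom_induced (int m) ?D (disc_boundary m) (subtopology W ?P) ?P (char_map X f)"
      using char_map_continuous_partial(2) [of f ?C m "?C - {e}"] f contP
        partial_skeleton_mono [of "?C - {e}" ?C m]
      by (intro hom_induced_compose) (auto simp: continuous_map_in_subtopology)
    moreover have "trivial_group (relative_homology_group (int m) (subtopology W ?P) ?P)"
      using trivial_relative_homology_group_topspace [of "int m" "subtopology W ?P"] P by simp
    ultimately show ?thesis
      using hom_induced_carrier [of "int m" ?D "disc_boundary m" "subtopology W ?P" ?P "char_map X f" "disc_orientation m"]
        hom_one [OF hom_induced_hom [of "int m" "subtopology W ?P" ?P ?Y ?P id]]
      by (simp add: qf f trivial_group_def)
  qed
  have "\<one>\<^bsub>?H\<^esub> = ?q (\<Otimes>\<^bsub>?G\<^esub>f\<in>?C. cell_class X f [^]\<^bsub>?G\<^esub> a f)"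
    using one m by simp
  also have "\<dots> = (\<Otimes>\<^bsub>?H\<^esub>f\<in>?C. ?q (cell_class X f [^]\<^bsub>?G\<^esub> a f))"
    using c by (intro G.hom_finprod_comm_group q) auto
  also have "\<dots> = (\<Otimes>\<^bsub>?H\<^esub>f\<in>?C. if e = f then attach.oriented_class [^]\<^bsub>?H\<^esub> a f else \<one>\<^bsub>?H\<^esub>)"
  proof (rule H.finprod_cong')
    fix f
    assume f: "f \<in> ?C"
    have "?q (cell_class X f [^]\<^bsub>?G\<^esub> a f) = ?q (cell_class X f) [^]\<^bsub>?H\<^esub> a f"
      by (rule q.hom_int_pow [OF c [OF f]])
    then show "?q (cell_class X f [^]\<^bsub>?G\<^esub> a f) = (if e = f then attach.oriented_class [^]\<^bsub>?H\<^esub> a f else \<one>\<^bsub>?H\<^esub>)"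
      using q1 [OF f] qe by (cases "f = e") simp_all
  qed (use attach.oriented_class_carrier in auto)
  also have "\<dots> = attach.oriented_class [^]\<^bsub>?H\<^esub> a e"
    using eC attach.oriented_class_carrier by (intro H.finprod_singleton) auto
  finally show ?thesis
    using attach.oriented_class_pow_eq_one [of "a e"] by simp
qed

end

context finite_cw
begin

lemma cell_classes_unique:
  assumes n: "n \<ge> 0" and e: "e \<in> cells_of X n"
    and eq: "(\<Otimes>\<^bsub>skeletal_homology X n\<^esub>e\<in>cells_of X n. cell_class X e [^]\<^bsub>skeletal_homology X n\<^esub> (a e :: int))
      = (\<Otimes>\<^bsub>skeletal_homology X n\<^esub>e\<in>cells_of X n. cell_class X e [^]\<^bsub>skeletal_homology X n\<^esub> (b e :: int))"
  shows "a e = b e"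
proof -
  let ?G = "skeletal_homology X n" and ?C = "cells_of X n"
  interpret comm_group ?G by simp
  have c: "cell_class X f [^]\<^bsub>?G\<^esub> (k::int) \<in> carrier ?G" if "f \<in> ?C" for f k
    using cell_class_carrier that by blast
  have "(\<Otimes>\<^bsub>?G\<^esub>e\<in>?C. cell_class X e [^]\<^bsub>?G\<^esub> (a e - b e)) \<otimes>\<^bsub>?G\<^esub> (\<Otimes>\<^bsub>?G\<^esub>e\<in>?C. cell_class X e [^]\<^bsub>?G\<^esub> b e)
      = (\<Otimes>\<^bsub>?G\<^esub>e\<in>?C. cell_class X e [^]\<^bsub>?G\<^esub> (a e - b e) \<otimes>\<^bsub>?G\<^esub> cell_class X e [^]\<^bsub>?G\<^esub> b e)"
    using c by (intro finprod_multf [symmetric]) auto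
  also have "\<dots> = (\<Otimes>\<^bsub>?G\<^esub>e\<in>?C. cell_class X e [^]\<^bsub>?G\<^esub> a e)"
    using c cell_class_carrier by (intro finprod_cong') (auto simp flip: int_pow_mult)
  finally have "(\<Otimes>\<^bsub>?G\<^esub>e\<in>?C. cell_class X e [^]\<^bsub>?G\<^esub> (a e - b e)) \<otimes>\<^bsub>?G\<^esub> (\<Otimes>\<^bsub>?G\<^esub>e\<in>?C. cell_class X e [^]\<^bsub>?G\<^esub> b e)
      = \<one>\<^bsub>?G\<^esub> \<otimes>\<^bsub>?G\<^esub> (\<Otimes>\<^bsub>?G\<^esub>e\<in>?C. cell_class X e [^]\<^bsub>?G\<^esub> b e)"
    using eq c by simp
  then have "(\<Otimes>\<^bsub>?G\<^esub>e\<in>?C. cell_class X e [^]\<^bsub>?G\<^esub> (a e - b e)) = \<one>\<^bsub>?G\<^esub>"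
    using c by (subst (asm) right_cancel) auto
  then show ?thesis
    using cell_classes_independent [OF n _ e, of "\<lambda>e. a e - b e"] by simp
qed

section \<open>The cellular boundary map and the incidence numbers\<close>

definition cell_boundary :: "int \<Rightarrow> 'a chain set \<Rightarrow> 'a chain set" where
  "cell_boundary n = hom_relboundary n (subtopology W (skeleton_set X n))
     (skeleton_set X (n - 1)) (skeleton_set X (n - 2))"

lemma subtopology_skeleton:
  "m \<le> n \<Longrightarrow> subtopology (subtopology W (skeleton_set X n)) (skeleton_set X m) = subtopology W (skeleton_set X m)"
  using skeleton_set_mono [of m n] by (simp add: subtopology_subtopology Int_absorb1)

lemma cell_boundary_hom:
  "cell_boundary n \<in> hom (skeletal_homology X n) (skeletal_homology X (n - 1))"
  using group_homomorphism_hom_relboundary [of n "subtopology W (skeleton_set X n)"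
      "skeleton_set X (n - 1)" "skeleton_set X (n - 2)"]
  by (simp add: cell_boundary_def skeletal_homology_def subtopology_skeleton)

lemma cell_boundary_closed: "cell_boundary n x \<in> carrier (skeletal_homology X (n - 1))"
  using hom_relboundary [of n "subtopology W (skeleton_set X n)"
      "skeleton_set X (n - 1)" "skeleton_set X (n - 2)" x]
  by (simp add: cell_boundary_def skeletal_homology_def subtopology_skeleton)

text \<open>The composite contains two consecutive maps of the exact sequence of the pair formed by
  the skeleta of dimensions n-1 and n-2: from absolute to relative homology, and then the connecting
  map.\<close>

lemma cell_boundary_boundary:
  assumes "x \<in> carrier (skeletal_homology X n)"
  shows "cell_boundary (n - 1) (cell_boundary n x) = \<one>\<^bsub>skeletal_homology X (n - 2)\<^esub>"
proof -
  let ?Y = "\<lambda>n. subtopology W (skeleton_set X n)"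
  let ?h = "hom_boundary n (?Y n) (skeleton_set X (n - 1)) x"
  have "hom_boundary (n - 1) (?Y (n - 1)) (skeleton_set X (n - 2))
      (hom_induced (n - 1) (?Y (n - 1)) {} (?Y (n - 1)) (skeleton_set X (n - 2)) id ?h)
      = \<one>\<^bsub>homology_group (n - 1 - 1) (subtopology (?Y (n - 1)) (skeleton_set X (n - 2)))\<^esub>"
  proof -
    have "?h \<in> carrier (homology_group (n - 1) (?Y (n - 1)))"
      using hom_boundary_carrier [of n "?Y n" "skeleton_set X (n - 1)" x] by (simp add: subtopology_skeleton)
    then have "hom_induced (n - 1) (?Y (n - 1)) {} (?Y (n - 1)) (skeleton_set X (n - 2)) id ?h
        \<in> kernel (relative_homology_group (n - 1) (?Y (n - 1)) (skeleton_set X (n - 2)))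
           (homology_group (n - 1 - 1) (subtopology (?Y (n - 1)) (skeleton_set X (n - 2))))
           (hom_boundary (n - 1) (?Y (n - 1)) (skeleton_set X (n - 2)))"
      using homology_exactness_axiom_1 [of "n - 1" "?Y (n - 1)" "skeleton_set X (n - 2)"] by auto
    then show ?thesis
      by (simp add: kernel_def)
  qed
  moreover have "hom_induced (n - 2) (?Y (n - 2)) {} (?Y (n - 2)) (skeleton_set X (n - 3)) id
      \<one>\<^bsub>homology_group (n - 2) (?Y (n - 2))\<^esub> = \<one>\<^bsub>skeletal_homology X (n - 2)\<^esub>"
    using hom_one [OF hom_induced_hom [of "n - 2" "?Y (n - 2)" "{}" "?Y (n - 2)" "skeleton_set X (n - 3)" id]]
    by (simp add: skeletal_homology_def)
  ultimately show ?thesis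
    by (simp add: cell_boundary_def hom_relboundary_def subtopology_skeleton)
qed

text \<open>The \<open>THE\<close> in the definition denotes something: generation gives the
  coefficients, independence makes them unique on the (n-1)-cells, and the requirement to vanish
  elsewhere fixes the remaining values.\<close>

lemma incidence_spec:
  assumes e: "e \<in> cells_of X n" and n: "n \<ge> 1"
  shows "(\<forall>f. f \<notin> cells_of X (n - 1) \<longrightarrow> incidence X e f = 0) \<and>
    cell_boundary n (cell_class X e) = (\<Otimes>\<^bsub>skeletal_homology X (n - 1)\<^esub>f\<in>cells_of X (n - 1).
      cell_class X f [^]\<^bsub>skeletal_homology X (n - 1)\<^esub> incidence X e f)"
proof -
  let ?G = "skeletal_homology X (n - 1)" and ?C = "cells_of X (n - 1)"
  let ?P = "\<lambda>a. (\<forall>f. f \<notin> ?C \<longrightarrow> a f = (0::int)) \<and>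
    cell_boundary n (cell_class X e) = (\<Otimes>\<^bsub>?G\<^esub>f\<in>?C. cell_class X f [^]\<^bsub>?G\<^esub> a f)"
  interpret comm_group ?G by simp
  have dim: "cdim X e = n"
    using e by (simp add: cells_of_def)
  obtain a where a: "cell_boundary n (cell_class X e) = (\<Otimes>\<^bsub>?G\<^esub>f\<in>?C. cell_class X f [^]\<^bsub>?G\<^esub> (a f :: int))"
    using cell_classes_generate [OF _ cell_boundary_closed, of n "cell_class X e"] n by auto
  let ?a = "\<lambda>f. if f \<in> ?C then a f else 0"
  have "\<exists>!a. ?P a"
  proof (rule ex1I [of _ ?a])
    have "(\<Otimes>\<^bsub>?G\<^esub>f\<in>?C. cell_class X f [^]\<^bsub>?G\<^esub> a f) = (\<Otimes>\<^bsub>?G\<^esub>f\<in>?C. cell_class X f [^]\<^bsub>?G\<^esub> ?a f)"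
      using cell_class_carrier by (intro finprod_cong') auto
    with a show "?P ?a"
      by simp
    fix b
    assume b: "?P b"
    show "b = ?a"
    proof
      fix f
      show "b f = ?a f"
      proof (cases "f \<in> ?C")
        case True
        then have "b f = a f"
          using cell_classes_unique [of "n - 1" f b a] n a b by simp
        with True show ?thesis by simp
      next
        case False
        with b show ?thesis by simp
      qed
    qed
  qed
  from theI' [OF this] show ?thesis
    using n by (simp add: incidence_def dim cell_boundary_def)
qed

lemma incidence_dim_0:
  "e \<in> cells_of X 0 \<Longrightarrow> incidence X e f = (if f \<in> cells_of X (-1) then 1 else 0)"
  by (simp add: incidence_def cells_of_def)

lemma incidence_eq_0:
  assumes "e \<in> cells X" "f \<notin> cells_of X (cdim X e - 1)"
  shows "incidence X e f = 0"
proof -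
  consider "cdim X e \<ge> 1" | "cdim X e = 0" | "cdim X e < 0" by linarith
  then show ?thesis
  proof cases
    case 1
    then show ?thesis
      using incidence_spec [of e "cdim X e"] assms by (simp add: cells_of_def)
  qed (use assms in \<open>simp_all add: incidence_def\<close>)
qed

text \<open>In degree 1 the vanishing comes from mapping the pair of skeleta to a point.\<close>

lemma sum_incidence_edge:
  assumes e: "e \<in> cells_of X 1"
  shows "(\<Sum>f\<in>cells_of X 0. incidence X e f) = 0"
proof -
  let ?pt = "discrete_topology {()}"
  let ?Y = "\<lambda>n. subtopology W (skeleton_set X n)"
  let ?G = "skeletal_homology X 0" and ?H = "homology_group 0 ?pt"
  let ?\<epsilon> = "hom_induced 0 (?Y 0) {} ?pt {} (\<lambda>_. ())"
  interpret G: comm_group ?G by simp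
  interpret H: comm_group ?H by (rule abelian_homology_group)
  have G: "?G = homology_group 0 (?Y 0)"
    by (simp add: skeletal_homology_def skeleton_set_neg)
  have \<epsilon>: "?\<epsilon> \<in> hom ?G ?H"
    unfolding G by (rule hom_induced_hom)
  have c: "cell_class X f \<in> carrier ?G" if "f \<in> cells_of X 0" for f
    using cell_class_carrier that by blast
  \<comment> \<open>A point arises from attaching a 0-disc to the empty set. Hence its class has
    infinite order, which will turn a trivial power into a vanishing exponent.\<close>
  interpret pt: disc_attachment ?pt "{}" 0 "\<lambda>_. ()"
  proof
    show "inj_on (\<lambda>_. ()) (disc_interior 0)"
      by (rule inj_onI) (simp add: in_disc_interior_iff fun_eq_iff)
  qed (auto simp: in_disc_interior_iff in_disc_boundary_iff disc_norm_def)
  have \<epsilon>c: "?\<epsilon> (cell_class X f) = pt.oriented_class" if f: "f \<in> cells_of X 0" for f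
  proof -
    have "continuous_map (unit_disc 0) (?Y 0) (char_map X f)"
      using char_map_continuous_partial(1) [of f "cells_of X 0" 0] partial_skeleton_all [of 0] f by simp
    moreover have "cdim X f = 0" "disc_boundary 0 = {}"
      using f by (auto simp: cells_of_def in_disc_boundary_iff disc_norm_def)
    ultimately show ?thesis
      unfolding cell_class_def pt.oriented_class_def
      by (simp add: skeleton_set_neg hom_induced_compose' o_def)
  qed
  have "cell_boundary 1 = hom_boundary 1 (?Y 1) (skeleton_set X 0)"
    by (simp add: cell_boundary_def skeleton_set_neg hom_relboundary_empty)
  \<comment> \<open>Naturality of the connecting map for the pair of skeleta mapped to the pair of a
    point with itself: on the other route the class of the edge passes through a trivial
    group.\<close>
  moreover have "hom_boundary 1 ?pt {()} \<circ> hom_induced 1 (?Y 1) (skeleton_set X 0) ?pt {()} (\<lambda>_. ())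
      = hom_induced (1 - 1) (subtopology (?Y 1) (skeleton_set X 0)) {} (subtopology ?pt {()}) {} (\<lambda>_. ())
        \<circ> hom_boundary 1 (?Y 1) (skeleton_set X 0)"
    by (rule naturality_hom_induced) auto
  moreover have "subtopology ?pt {()} = ?pt"
    by (metis subtopology_topspace topspace_discrete_topology)
  ultimately have "?\<epsilon> (cell_boundary 1 (cell_class X e)) =
      hom_boundary 1 ?pt {()} (hom_induced 1 (?Y 1) (skeleton_set X 0) ?pt {()} (\<lambda>_. ()) (cell_class X e))"
    by (simp add: subtopology_skeleton fun_eq_iff)
  also have "\<dots> = hom_boundary 1 ?pt {()} \<one>\<^bsub>relative_homology_group 1 ?pt {()}\<^esub>"
    using trivial_relative_homology_group_topspace [of 1 ?pt]
      hom_induced_carrier [of 1 "?Y 1" "skeleton_set X 0" ?pt "{()}" "\<lambda>_. ()" "cell_class X e"]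
    by (simp add: trivial_group_def)
  also have "\<dots> = \<one>\<^bsub>?H\<^esub>"
    using hom_one [OF hom_boundary_hom [of 1 ?pt "{()}"]] \<open>subtopology ?pt {()} = ?pt\<close> by simp
  finally have "\<one>\<^bsub>?H\<^esub> = ?\<epsilon> (\<Otimes>\<^bsub>?G\<^esub>f\<in>cells_of X 0. cell_class X f [^]\<^bsub>?G\<^esub> incidence X e f)"
    using incidence_spec [OF e] by simp
  also have "\<dots> = (\<Otimes>\<^bsub>?H\<^esub>f\<in>cells_of X 0. ?\<epsilon> (cell_class X f [^]\<^bsub>?G\<^esub> incidence X e f))"
    using c by (intro G.hom_finprod_comm_group [OF H.comm_group_axioms \<epsilon>]) auto
  also have "\<dots> = (\<Otimes>\<^bsub>?H\<^esub>f\<in>cells_of X 0. pt.oriented_class [^]\<^bsub>?H\<^esub> incidence X e f)"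
  proof (rule H.finprod_cong')
    fix f
    assume f: "f \<in> cells_of X 0"
    show "?\<epsilon> (cell_class X f [^]\<^bsub>?G\<^esub> incidence X e f) = pt.oriented_class [^]\<^bsub>?H\<^esub> incidence X e f"
      using hom_int_pow [OF \<epsilon> c [OF f]] \<epsilon>c [OF f] by simp
  qed (use pt.oriented_class_carrier in auto)
  also have "\<dots> = pt.oriented_class [^]\<^bsub>?H\<^esub> (\<Sum>f\<in>cells_of X 0. incidence X e f)"
    using H.finprod_int_pow_sum [where B = "{()}" and c = "\<lambda>_. pt.oriented_class"
        and A = "cells_of X 0" and a = "incidence X e" and b = "\<lambda>_ _. 1"]
      pt.oriented_class_carrier by simp
  finally show ?thesis
    using pt.oriented_class_pow_eq_one [of "\<Sum>f\<in>cells_of X 0. incidence X e f"] by simp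
qed

lemma sum_incidence_cells_of:
  assumes "e \<in> cells X"
  shows "(\<Sum>f\<in>cells X. incidence X e f * h f) = (\<Sum>f\<in>cells_of X (cdim X e - 1). incidence X e f * h f)"
  using assms finite_cells incidence_eq_0
  by (intro sum.mono_neutral_right) (auto simp: cells_of_def)

text \<open>From dimension 2 on, these sums are the coefficients of the boundary of the boundary in
  the basis of cell classes. In dimension 1 the second factor is the constant 1 of the augmentation,
  and in dimension at most 0 it vanishes by definition.\<close>

theorem incidence_incidence:
  assumes "e \<in> cells X"
  shows "(\<Sum>f\<in>cells X. incidence X e f * incidence X f g) = 0"
proof -
  define n where "n = cdim X e"
  have e: "e \<in> cells_of X n"
    using assms by (simp add: n_def cells_of_def)
  let ?C = "cells_of X (n - 1)"
  have support: "incidence X f g = 0" if "f \<in> ?C" "g \<notin> cells_of X (n - 2)" for f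
    using that incidence_eq_0 [of f g] by (simp add: cells_of_def)
  have sum: "(\<Sum>f\<in>cells X. incidence X e f * incidence X f g) = (\<Sum>f\<in>?C. incidence X e f * incidence X f g)"
    using sum_incidence_cells_of [OF assms] by (simp add: n_def)
  consider "n \<le> 0" | "n = 1" | "n \<ge> 2" by linarith
  then have "(\<Sum>f\<in>?C. incidence X e f * incidence X f g) = 0"
  proof cases
    case 1
    then have "incidence X f g = 0" if "f \<in> ?C" for f
      using that by (auto simp: cells_of_def incidence_def)
    then show ?thesis by simp
  next
    case 2
    then show ?thesis
      using sum_incidence_edge [of e] e
      by (simp add: incidence_dim_0 flip: sum_distrib_right)
  next
    case 3
    show ?thesis
    proof (cases "g \<in> cells_of X (n - 2)")
      case True
      let ?G1 = "skeletal_homology X (n - 1)" and ?G2 = "skeletal_homology X (n - 2)"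
      interpret G1: comm_group ?G1 by simp
      interpret G2: comm_group ?G2 by simp
      let ?d = "cell_boundary (n - 1)"
      have d: "?d \<in> hom ?G1 ?G2"
        using cell_boundary_hom [of "n - 1"] by simp
      have c1: "cell_class X f \<in> carrier ?G1" if "f \<in> ?C" for f
        using cell_class_carrier that by blast
      have c2: "cell_class X f \<in> carrier ?G2" if "f \<in> cells_of X (n - 2)" for f
        using cell_class_carrier that by blast
      have "\<one>\<^bsub>?G2\<^esub> = ?d (cell_boundary n (cell_class X e))"
        using cell_boundary_boundary cell_class_carrier [OF e] by simp
      also have "\<dots> = ?d (\<Otimes>\<^bsub>?G1\<^esub>f\<in>?C. cell_class X f [^]\<^bsub>?G1\<^esub> incidence X e f)"
        using incidence_spec [OF e] 3 by simp
      also have "\<dots> = (\<Otimes>\<^bsub>?G2\<^esub>f\<in>?C. ?d (cell_class X f [^]\<^bsub>?G1\<^esub> incidence X e f))"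
        using c1 by (intro G1.hom_finprod_comm_group [OF G2.comm_group_axioms d]) auto
      also have "\<dots> = (\<Otimes>\<^bsub>?G2\<^esub>f\<in>?C. (\<Otimes>\<^bsub>?G2\<^esub>g\<in>cells_of X (n - 2). cell_class X g [^]\<^bsub>?G2\<^esub> incidence X f g)
          [^]\<^bsub>?G2\<^esub> incidence X e f)"
      proof (rule G2.finprod_cong')
        fix f
        assume f: "f \<in> ?C"
        have "?d (cell_class X f [^]\<^bsub>?G1\<^esub> incidence X e f) = ?d (cell_class X f) [^]\<^bsub>?G2\<^esub> incidence X e f"
          using hom_int_pow [OF d c1 [OF f]] by simp
        also have "?d (cell_class X f) = (\<Otimes>\<^bsub>?G2\<^esub>g\<in>cells_of X (n - 2). cell_class X g [^]\<^bsub>?G2\<^esub> incidence X f g)"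
          using incidence_spec [OF f] 3 by simp
        finally show "?d (cell_class X f [^]\<^bsub>?G1\<^esub> incidence X e f) =
            (\<Otimes>\<^bsub>?G2\<^esub>g\<in>cells_of X (n - 2). cell_class X g [^]\<^bsub>?G2\<^esub> incidence X f g) [^]\<^bsub>?G2\<^esub> incidence X e f" .
      qed (use c2 in \<open>auto intro!: G2.int_pow_closed G2.finprod_closed\<close>)
      also have "\<dots> = (\<Otimes>\<^bsub>?G2\<^esub>g\<in>cells_of X (n - 2).
          cell_class X g [^]\<^bsub>?G2\<^esub> (\<Sum>f\<in>?C. incidence X e f * incidence X f g))"
        using c2 by (intro G2.finprod_int_pow_sum) auto
      finally show ?thesis
        using cell_classes_independent [OF _ _ True, of "\<lambda>g. \<Sum>f\<in>?C. incidence X e f * incidence X f g"] 3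
        by simp
    next
      case False
      with support show ?thesis by simp
    qed
  qed
  with sum show ?thesis by simp
qed

end

section \<open>Integer determinants and lattice indices\<close>

text \<open>Determinants of functions on pairs of indices. Row and column selections become
  compositions, without the carrier conditions of the matrix type; entries outside the range are
  ignored.\<close>

definition fdet :: "nat \<Rightarrow> (nat \<Rightarrow> nat \<Rightarrow> 'a) \<Rightarrow> 'a :: comm_ring_1" where
  "fdet m A = Determinant.det (Matrix.mat m m (\<lambda>(i, j). A i j))"

lemma fdet_expand:
  "fdet m A = (\<Sum>p | p permutes {0..<m}. signof p * (\<Prod>i\<in>{0..<m}. A i (p i)))"
proof -
  have "(\<Prod>i\<in>{0..<m}. Matrix.mat m m (\<lambda>(i, j). A i j) $$ (i, p i)) = (\<Prod>i\<in>{0..<m}. A i (p i))"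
    if "p permutes {0..<m}" for p
    using permutes_in_image [OF that] by (intro prod.cong) auto
  then show ?thesis
    by (simp add: fdet_def Determinant.det_def)
qed

lemma fdet_cong: "(\<And>i j. \<lbrakk>i < m; j < m\<rbrakk> \<Longrightarrow> A i j = B i j) \<Longrightarrow> fdet m A = fdet m B"
  unfolding fdet_def by (intro arg_cong [where f = Determinant.det] eq_matI) auto

lemma fdet_transpose: "fdet m (\<lambda>i j. A j i) = fdet m A"
proof -
  have "Matrix.mat m m (\<lambda>(i, j). A j i) = transpose_mat (Matrix.mat m m (\<lambda>(i, j). A i j))"
    by (rule eq_matI) auto
  then show ?thesis
    by (simp add: fdet_def det_transpose [of _ m])
qed

lemma fdet_permute_rows:
  assumes "p permutes {0..<m}"
  shows "fdet m (\<lambda>i j. A (p i) j) = signof p * fdet m A"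
proof -
  have "Matrix.mat m m (\<lambda>(i, j). A (p i) j) =
      Matrix.mat m m (\<lambda>(i, j). Matrix.mat m m (\<lambda>(i, j). A i j) $$ (p i, j))"
    using permutes_in_image [OF assms] by (intro eq_matI) auto
  then show ?thesis
    using det_permute_rows [OF mat_carrier assms, of "\<lambda>(i, j). A i j"] by (simp add: fdet_def)
qed

lemma fdet_eq_0_if_rows_eq:
  assumes "i < m" "j < m" "i \<noteq> j" "\<And>k. A i k = A j k"
  shows "fdet m A = 0"
  unfolding fdet_def using assms
  by (intro det_identical_rows [OF mat_carrier, of i j]) (auto simp: Matrix.row_def)

lemma fdet_swap_columns:
  assumes "k < m" "l < m" "k \<noteq> l"
  shows "fdet m (\<lambda>i j. A i (Transposition.transpose k l j)) = - fdet m A"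
proof -
  have "Matrix.mat m m (\<lambda>(i, j). A i (Transposition.transpose k l j)) = swapcols k l (Matrix.mat m m (\<lambda>(i, j). A i j))"
    using assms by (intro eq_matI) (auto simp: Transposition.transpose_def)
  then show ?thesis
    using det_swapcols [OF assms mat_carrier] by (simp add: fdet_def)
qed

lemma fdet_add_column:
  assumes "k < m" "l < m" "k \<noteq> l"
  shows "fdet m (\<lambda>i j. if j = k then A i k + a * A i l else A i j) = fdet m A"
proof -
  have "Matrix.mat m m (\<lambda>(i, j). if j = k then A i k + a * A i l else A i j)
      = addcol a k l (Matrix.mat m m (\<lambda>(i, j). A i j))"
    using assms by (intro eq_matI) (auto simp: add.commute)
  then show ?thesis
    using det_addcol [OF assms(2,3) mat_carrier] by (simp add: fdet_def)
qed

lemma fdet_first_row: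
  fixes A :: "nat \<Rightarrow> nat \<Rightarrow> 'a :: idom"
  assumes "\<And>j. 0 < j \<Longrightarrow> j < Suc n \<Longrightarrow> A 0 j = 0"
  shows "fdet (Suc n) A = A 0 0 * fdet n (\<lambda>i j. A (Suc i) (Suc j))"
proof -
  let ?a = "Matrix.mat 1 1 (\<lambda>_. A 0 0)"
  let ?B = "Matrix.mat n n (\<lambda>(i, j). A (Suc i) (Suc j))"
  have eq: "Matrix.mat (Suc n) (Suc n) (\<lambda>(i, j). A i j) =
      four_block_mat ?a (0\<^sub>m 1 n) (Matrix.mat n 1 (\<lambda>(i, j). A (Suc i) 0)) ?B"
    using assms by (intro eq_matI) (auto simp: four_block_mat_def Let_def)
  have "fdet (Suc n) A = Determinant.det ?a * Determinant.det ?B"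
    unfolding fdet_def eq by (rule det_four_block_mat_upper_right_zero) auto
  also have "Determinant.det ?a = A 0 0"
    by (simp add: det_single)
  finally show ?thesis
    by (simp add: fdet_def)
qed

text \<open>\<open>en S\<close> enumerates the index set \<open>S\<close> of a maximal minor.\<close>

theorem Cauchy_Binet:
  fixes a b :: "'i \<Rightarrow> nat \<Rightarrow> 'r :: comm_ring_1"
  assumes R: "finite R"
    and en: "\<And>S. \<lbrakk>S \<subseteq> R; card S = m\<rbrakk> \<Longrightarrow> bij_betw (en S) {0..<m} S"
  shows "fdet m (\<lambda>i j. \<Sum>f\<in>R. a f i * b f j) =
    (\<Sum>S | S \<subseteq> R \<and> card S = m. fdet m (\<lambda>i j. a (en S i) j) * fdet m (\<lambda>i j. b (en S i) j))"
proof -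
  let ?I = "{0..<m}"
  let ?P = "{p. p permutes ?I}"
  let ?F = "PiE ?I (\<lambda>_. R)"
  let ?t = "\<lambda>F. (\<Prod>i\<in>?I. a (F i) i) * fdet m (\<lambda>i j. b (F i) j)"
  let ?S = "{S. S \<subseteq> R \<and> card S = m}"
  have finF: "finite ?F"
    using R by (intro finite_PiE) auto
  have "fdet m (\<lambda>i j. \<Sum>f\<in>R. a f i * b f j)
      = (\<Sum>p\<in>?P. signof p * (\<Prod>i\<in>?I. \<Sum>f\<in>R. a f i * b f (p i)))"
    by (simp add: fdet_expand)
  \<comment> \<open>Multiplying out the product of sums means choosing an index \<open>F i\<close>
    in \<open>R\<close> for every position \<open>i\<close>.\<close>
  also have "\<dots> = (\<Sum>p\<in>?P. signof p * (\<Sum>F\<in>?F. \<Prod>i\<in>?I. a (F i) i * b (F i) (p i)))"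
    using R by (subst prod_sum_PiE) auto
  also have "\<dots> = (\<Sum>p\<in>?P. \<Sum>F\<in>?F. (\<Prod>i\<in>?I. a (F i) i) * (signof p * (\<Prod>i\<in>?I. b (F i) (p i))))"
    by (simp add: sum_distrib_left prod.distrib mult_ac)
  also have "\<dots> = (\<Sum>F\<in>?F. ?t F)"
    by (subst sum.swap) (simp add: fdet_expand sum_distrib_left)
  \<comment> \<open>A choice with a repetition gives a determinant with two equal rows.\<close>
  also have "\<dots> = (\<Sum>F | F \<in> ?F \<and> inj_on F ?I. ?t F)"
  proof (rule sum.mono_neutral_right)
    show "\<forall>F\<in>?F - {F \<in> ?F. inj_on F ?I}. ?t F = 0"
    proof
      fix F
      assume "F \<in> ?F - {F \<in> ?F. inj_on F ?I}"
      then obtain i j where "i < m" "j < m" "i \<noteq> j" "F i = F j"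
        by (auto simp: inj_on_def)
      then have "fdet m (\<lambda>i j. b (F i) j) = 0"
        by (intro fdet_eq_0_if_rows_eq [of i m j]) auto
      then show "?t F = 0"
        by simp
    qed
  qed (use finF in auto)
  also have "\<dots> = (\<Sum>S\<in>?S. \<Sum>F | F \<in> {F \<in> ?F. inj_on F ?I} \<and> F ` ?I = S. ?t F)"
  proof (rule sum.group [symmetric])
    show "(\<lambda>F. F ` ?I) ` {F \<in> ?F. inj_on F ?I} \<subseteq> ?S"
      by (auto simp: card_image)
  qed (use finF R in auto)
  also have "\<dots> = (\<Sum>S\<in>?S. fdet m (\<lambda>i j. a (en S i) j) * fdet m (\<lambda>i j. b (en S i) j))"
  proof (rule sum.cong [OF refl])
    fix S
    assume "S \<in> ?S"
    then have S: "S \<subseteq> R" "card S = m" and bij: "bij_betw (en S) ?I S"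
      using en by auto
    have inS: "en S i \<in> S" if "i < m" for i
      using bij that by (auto simp: bij_betw_def)
    have inj: "inj_on (en S) ?I"
      using bij by (auto simp: bij_betw_def)
    \<comment> \<open>The injective choices with image \<open>S\<close> are the permutations
      composed with the enumeration of \<open>S\<close>. The restriction makes them extensional, as
      membership in \<open>?F\<close> demands, and in the other direction the identity outside
      \<open>?I\<close> completes the function to a permutation.\<close>
    have "(\<Sum>F | F \<in> {F \<in> ?F. inj_on F ?I} \<and> F ` ?I = S. ?t F)
        = (\<Sum>p\<in>?P. ?t (restrict (en S \<circ> p) ?I))"
    proof (rule sum.reindex_bij_witness
        [where j = "\<lambda>F i. if i < m then inv_into ?I (en S) (F i) else i" and i = "\<lambda>p. restrict (en S \<circ> p) ?I"])
      fix F
      assume "F \<in> {F. F \<in> {F \<in> ?F. inj_on F ?I} \<and> F ` ?I = S}"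
      then have F: "F \<in> ?F" "inj_on F ?I" "F ` ?I = S"
        by auto
      let ?p = "\<lambda>i. if i < m then inv_into ?I (en S) (F i) else i"
      have FS: "F i \<in> en S ` ?I" if "i < m" for i
        using F(3) bij that by (auto simp: bij_betw_def)
      show eq: "restrict (en S \<circ> ?p) ?I = F"
        using F(1) FS by (auto simp: fun_eq_iff restrict_def PiE_def extensional_def f_inv_into_f)
      have "?p permutes ?I"
      proof (rule bij_imp_permutes)
        have "bij_betw (inv_into ?I (en S) \<circ> F) ?I ?I"
          using bij_betw_trans [OF inj_on_imp_bij_betw [OF F(2)]] bij_betw_inv_into [OF bij] F(3) by auto
        then show "bij_betw ?p ?I ?I"
          by (rule bij_betw_cong [THEN iffD1, rotated]) auto
      qed auto
      then show "?p \<in> ?P"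
        by simp
      show "?t (restrict (en S \<circ> ?p) ?I) = ?t F"
        by (simp only: eq)
    next
      fix p
      assume "p \<in> ?P"
      then have p: "p permutes ?I"
        by simp
      then have pI: "p i < m \<longleftrightarrow> i < m" for i
        using permutes_in_image [OF p, of i] by simp
      show "(\<lambda>i. if i < m then inv_into ?I (en S) (restrict (en S \<circ> p) ?I i) else i) = p"
        using permutes_not_in [OF p] inj pI by (auto simp: fun_eq_iff)
      have "inj_on (en S \<circ> p) ?I" "(en S \<circ> p) ` ?I = S"
        using bij_betw_trans [OF permutes_imp_bij [OF p] bij] by (auto simp: bij_betw_def)
      then have "inj_on (restrict (en S \<circ> p) ?I) ?I" "restrict (en S \<circ> p) ?I ` ?I = S"
        by (simp_all add: inj_on_restrict_eq)
      then show "restrict (en S \<circ> p) ?I \<in> {F. F \<in> {F \<in> ?F. inj_on F ?I} \<and> F ` ?I = S}"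
        using S by (auto simp del: restrict_apply)
    qed
    also have "\<dots> = (\<Sum>p\<in>?P. (\<Prod>i\<in>?I. a (en S (p i)) i) * (signof p * fdet m (\<lambda>i j. b (en S i) j)))"
    proof (rule sum.cong [OF refl])
      fix p
      assume "p \<in> ?P"
      then have "fdet m (\<lambda>i j. b (en S (p i)) j) = signof p * fdet m (\<lambda>i j. b (en S i) j)"
        using fdet_permute_rows [of p m "\<lambda>i j. b (en S i) j"] by simp
      moreover have "fdet m (\<lambda>i j. b (restrict (en S \<circ> p) ?I i) j) = fdet m (\<lambda>i j. b (en S (p i)) j)"
        by (rule fdet_cong) simp
      ultimately show "?t (restrict (en S \<circ> p) ?I)
          = (\<Prod>i\<in>?I. a (en S (p i)) i) * (signof p * fdet m (\<lambda>i j. b (en S i) j))"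
        by simp
    qed
    \<comment> \<open>The signs and the entries of \<open>a\<close> reassemble into the determinant
      of the transposed minor.\<close>
    also have "\<dots> = fdet m (\<lambda>i j. a (en S j) i) * fdet m (\<lambda>i j. b (en S i) j)"
      by (simp add: fdet_expand [of m "\<lambda>i j. a (en S j) i"] sum_distrib_left mult_ac)
    also have "fdet m (\<lambda>i j. a (en S j) i) = fdet m (\<lambda>i j. a (en S i) j)"
      by (rule fdet_transpose)
    finally show "(\<Sum>F | F \<in> {F \<in> ?F. inj_on F ?I} \<and> F ` ?I = S. ?t F)
        = fdet m (\<lambda>i j. a (en S i) j) * fdet m (\<lambda>i j. b (en S i) j)" .
  qed
  finally show ?thesis .
qed

text \<open>Representatives of the cosets of the lattice spanned by the columns of \<open>A\<close>,
  so that \<open>card T\<close> is the index of that lattice. Vectors are functions on all naturals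
  of which only the first \<open>n\<close> values count; nevertheless congruent members of
  \<open>T\<close> must be equal as functions, since otherwise the cardinality would not be the
  index.\<close>

definition transversal :: "nat \<Rightarrow> (nat \<Rightarrow> nat \<Rightarrow> int) \<Rightarrow> (nat \<Rightarrow> int) set \<Rightarrow> bool" where
  "transversal n A T \<longleftrightarrow> finite T \<and>
     (\<forall>x. \<exists>t\<in>T. \<exists>v. \<forall>i<n. x i = t i + (\<Sum>j<n. A i j * v j)) \<and>
     (\<forall>t\<in>T. \<forall>t'\<in>T. \<forall>v. (\<forall>i<n. t i = t' i + (\<Sum>j<n. A i j * v j)) \<longrightarrow> t = t')"

text \<open>Only the column lattice matters, not the matrix. This makes the notion invariant under
  the column operations that follow.\<close>

lemma transversal_cong_image:
  assumes "transversal n A T"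
    and "\<And>v. \<exists>w. \<forall>i<n. (\<Sum>j<n. A i j * v j) = (\<Sum>j<n. B i j * w j)"
    and "\<And>v. \<exists>w. \<forall>i<n. (\<Sum>j<n. B i j * v j) = (\<Sum>j<n. A i j * w j)"
  shows "transversal n B T"
  unfolding transversal_def
proof (intro conjI allI ballI impI)
  show "finite T"
    using assms by (simp add: transversal_def)
  fix x
  obtain t v where "t \<in> T" "\<forall>i<n. x i = t i + (\<Sum>j<n. A i j * v j)"
    using assms(1) unfolding transversal_def by meson
  then show "\<exists>t\<in>T. \<exists>v. \<forall>i<n. x i = t i + (\<Sum>j<n. B i j * v j)"
    using assms(2) [of v] by metis
next
  fix t t' v
  assume "t \<in> T" "t' \<in> T" and eq: "\<forall>i<n. t i = t' i + (\<Sum>j<n. B i j * v j)"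
  then show "t = t'"
    using assms(1) assms(3) [of v] unfolding transversal_def by metis
qed

lemma transversal_swap_columns:
  assumes "k < n" "l < n" "transversal n (\<lambda>i j. A i (Transposition.transpose k l j)) T"
  shows "transversal n A T"
proof (rule transversal_cong_image [OF assms(3)])
  let ?s = "Transposition.transpose k l"
  have "?s permutes {..<n}"
    using assms by (intro permutes_swap_id) auto
  then have *: "(\<Sum>j<n. g (?s j)) = (\<Sum>j<n. g j)" for g :: "nat \<Rightarrow> int"
    using sum.permute [of ?s "{..<n}" g] by (simp add: o_def)
  show "\<exists>w. \<forall>i<n. (\<Sum>j<n. A i (?s j) * v j) = (\<Sum>j<n. A i j * w j)" for v
    using * [of "\<lambda>j. A _ j * v (?s j)"] by (intro exI [of _ "\<lambda>j. v (?s j)"]) simp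
  show "\<exists>w. \<forall>i<n. (\<Sum>j<n. A i j * v j) = (\<Sum>j<n. A i (?s j) * w j)" for v
    using * [of "\<lambda>j. A _ j * v j"] by (intro exI [of _ "\<lambda>j. v (?s j)"]) simp
qed

lemma transversal_add_column:
  assumes kl: "k < n" "l < n" "k \<noteq> l"
    and "transversal n (\<lambda>i j. if j = k then A i k + a * A i l else A i j) T"
  shows "transversal n A T"
proof (rule transversal_cong_image [OF assms(4)])
  let ?B = "\<lambda>i j. if j = k then A i k + a * A i l else A i j"
  have *: "(\<Sum>j<n. ?B i j * v j) = (\<Sum>j<n. A i j * v j) + a * A i l * v k" for i v
  proof -
    have "(\<Sum>j<n. ?B i j * v j) = (\<Sum>j<n. A i j * v j + (if j = k then a * A i l * v k else 0))"
      by (rule sum.cong) (auto simp: algebra_simps)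
    then show ?thesis
      using kl by (simp add: sum.distrib)
  qed
  have **: "(\<Sum>j<n. A i j * (v j + (if j = l then c else 0))) = (\<Sum>j<n. A i j * v j) + A i l * c" for i v c
    using kl by (simp add: distrib_left sum.distrib if_distrib [where f = "\<lambda>x. _ * x"] cong: if_cong)
  show "\<exists>w. \<forall>i<n. (\<Sum>j<n. ?B i j * v j) = (\<Sum>j<n. A i j * w j)" for v
    \<comment> \<open>The multiple of column \<open>l\<close> inside the changed column
      \<open>k\<close> is absorbed by the coefficient of column \<open>l\<close>.\<close>
    unfolding * by (intro exI [of _ "\<lambda>j. v j + (if j = l then a * v k else 0)"]) (simp add: **)
  show "\<exists>w. \<forall>i<n. (\<Sum>j<n. A i j * v j) = (\<Sum>j<n. ?B i j * w j)" for v
    unfolding * using kl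
    by (intro exI [of _ "\<lambda>j. v j + (if j = l then - a * v k else 0)"]) (simp only: **, simp)
qed

text \<open>The lattice is block triangular. A representative consists of a residue modulo the
  corner entry, put by \<open>case_nat\<close> in front of a representative for the lower
  block.\<close>

lemma transversal_first_row:
  assumes zero: "\<And>j. 0 < j \<Longrightarrow> j < Suc n \<Longrightarrow> A 0 j = 0" and a: "A 0 0 \<noteq> 0"
    and T: "transversal n (\<lambda>i j. A (Suc i) (Suc j)) T"
  shows "\<exists>T'. transversal (Suc n) A T' \<and> card T' = nat \<bar>A 0 0\<bar> * card T"
proof -
  let ?g = "\<lambda>(r :: int, t :: nat \<Rightarrow> int). case_nat r t"
  let ?T = "?g ` ({0..<\<bar>A 0 0\<bar>} \<times> T)"
  have inj: "inj_on ?g ({0..<\<bar>A 0 0\<bar>} \<times> T)"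
  proof (rule inj_onI, clarify)
    fix r r' :: int and t t' :: "nat \<Rightarrow> int"
    assume eq: "case_nat r t = case_nat r' t'"
    show "r = r' \<and> t = t'"
      using fun_cong [OF eq, of 0] fun_cong [OF eq, of "Suc _"] by auto
  qed
  have row0: "(\<Sum>j<Suc n. A 0 j * v j) = A 0 0 * v 0" for v
  proof -
    have "(\<Sum>j<n. A 0 (Suc j) * v (Suc j)) = 0"
      using zero by (intro sum.neutral) auto
    then show ?thesis
      by (simp add: sum.lessThan_Suc_shift del: sum.lessThan_Suc)
  qed
  have rowS: "(\<Sum>j<Suc n. A (Suc i) j * v j) = A (Suc i) 0 * v 0 + (\<Sum>j<n. A (Suc i) (Suc j) * v (Suc j))" for i v
    by (simp add: sum.lessThan_Suc_shift del: sum.lessThan_Suc)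
  have "transversal (Suc n) A ?T"
    unfolding transversal_def
  proof (intro conjI allI ballI impI)
    show "finite ?T"
      using T by (simp add: transversal_def)
  next
    fix x :: "nat \<Rightarrow> int"
    define r where "r = x 0 mod \<bar>A 0 0\<bar>"
    have r: "r \<in> {0..<\<bar>A 0 0\<bar>}"
      using a by (simp add: r_def)
    have "A 0 0 dvd x 0 - r"
      unfolding r_def by (metis abs_dvd_iff dvd_minus_mod)
    then obtain q where q: "x 0 - r = A 0 0 * q"
      by auto
    \<comment> \<open>The first row forces the coefficient \<open>q\<close> of column 0; its
      contribution to the lower rows is subtracted before \<open>T\<close> is consulted.\<close>
    obtain t v where t: "t \<in> T" "\<forall>i<n. x (Suc i) - A (Suc i) 0 * q = t i + (\<Sum>j<n. A (Suc i) (Suc j) * v j)"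
      using T [unfolded transversal_def, THEN conjunct2, THEN conjunct1,
          THEN spec [of _ "\<lambda>i. x (Suc i) - A (Suc i) 0 * q"]] by blast
    have "x i = case_nat r t i + (\<Sum>j<Suc n. A i j * case_nat q v j)" if i: "i < Suc n" for i
    proof (cases i)
      case 0
      then show ?thesis
        using q by (simp add: row0 del: sum.lessThan_Suc)
    next
      case (Suc k)
      then have "x (Suc k) - A (Suc k) 0 * q = t k + (\<Sum>j<n. A (Suc k) (Suc j) * v j)"
        using t(2) i by simp
      with Suc show ?thesis
        by (simp add: rowS del: sum.lessThan_Suc)
    qed
    moreover have "case_nat r t \<in> ?T"
      using r t by force
    ultimately show "\<exists>t\<in>?T. \<exists>v. \<forall>i<Suc n. x i = t i + (\<Sum>j<Suc n. A i j * v j)"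
      by blast
  next
    fix u u' v
    assume "u \<in> ?T" "u' \<in> ?T" and eq: "\<forall>i<Suc n. u i = u' i + (\<Sum>j<Suc n. A i j * v j)"
    then obtain r t r' t' where u: "u = case_nat r t" "u' = case_nat r' t'"
      and r: "r \<in> {0..<\<bar>A 0 0\<bar>}" "r' \<in> {0..<\<bar>A 0 0\<bar>}" and t: "t \<in> T" "t' \<in> T"
      by auto
    have "r = r' + A 0 0 * v 0"
      using eq [rule_format, of 0] by (simp add: u row0 del: sum.lessThan_Suc)
    then have "r mod \<bar>A 0 0\<bar> = r' mod \<bar>A 0 0\<bar>"
      by (simp add: mod_eq_dvd_iff)
    then have rr: "r = r'"
      using r by simp
    with \<open>r = r' + A 0 0 * v 0\<close> a have v0: "v 0 = 0"
      by simp
    have "\<forall>i<n. t i = t' i + (\<Sum>j<n. A (Suc i) (Suc j) * v (Suc j))"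
    proof (intro allI impI)
      fix i
      assume "i < n"
      then have "u (Suc i) = u' (Suc i) + (\<Sum>j<Suc n. A (Suc i) j * v j)"
        by (intro eq [rule_format]) simp
      then show "t i = t' i + (\<Sum>j<n. A (Suc i) (Suc j) * v (Suc j))"
        unfolding u rowS v0 by simp
    qed
    then have "t = t'"
      using T [unfolded transversal_def, THEN conjunct2, THEN conjunct2, rule_format, OF t, of "\<lambda>j. v (Suc j)"]
      by blast
    with rr show "u = u'"
      by (simp add: u)
  qed
  moreover have "card ?T = nat \<bar>A 0 0\<bar> * card T"
    using inj by (simp add: card_image card_cartesian_product)
  ultimately show ?thesis
    by blast
qed

text \<open>Column operations reduce the first row to a single entry.\<close>

theorem transversal_exists:
  assumes "fdet n A \<noteq> 0"
  shows "\<exists>T. transversal n A T \<and> card T = nat \<bar>fdet n A\<bar>"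
  using assms
proof (induction n arbitrary: A)
  case 0
  have "transversal 0 A {\<lambda>_. 0}"
    by (simp add: transversal_def)
  moreover have "fdet 0 A = 1"
    by (simp add: fdet_expand)
  ultimately show ?case
    by (intro exI [of _ "{\<lambda>_. 0}"]) simp
next
  case (Suc n)
  from Suc.prems show ?case
  \<comment> \<open>The inner induction is the subtractive form of Euclid's algorithm on the first
    row, measured by the sum of absolute values.\<close>
  proof (induction "\<Sum>j<Suc n. nat \<bar>A 0 j\<bar>" arbitrary: A rule: less_induct)
    case less
    consider (two) k l where "k < Suc n" "l < Suc n" "k \<noteq> l" "A 0 l \<noteq> 0" "\<bar>A 0 l\<bar> \<le> \<bar>A 0 k\<bar>"
      | (one) k where "k < Suc n" "\<And>j. j < Suc n \<Longrightarrow> j \<noteq> k \<Longrightarrow> A 0 j = 0"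
    proof (cases "\<exists>k l. k < Suc n \<and> l < Suc n \<and> k \<noteq> l \<and> A 0 l \<noteq> 0 \<and> A 0 k \<noteq> 0")
      case True
      then obtain k l where kl: "k < Suc n" "l < Suc n" "k \<noteq> l" "A 0 l \<noteq> 0" "A 0 k \<noteq> 0"
        by blast
      show ?thesis
      proof (cases "\<bar>A 0 l\<bar> \<le> \<bar>A 0 k\<bar>")
        case True
        with kl show ?thesis
          by (intro two [of k l])
      next
        case False
        with kl show ?thesis
          by (intro two [of l k]) auto
      qed
    next
      case False
      show ?thesis
      proof (cases "\<exists>k<Suc n. A 0 k \<noteq> 0")
        case True
        with False one show ?thesis by blast
      next
        case False
        \<comment> \<open>A vanishing row is also put under this case; the nonzero determinant
          excludes it once the determinant has been expanded.\<close>
        with one [of 0] show ?thesis by blast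
      qed
    qed
    then show ?case
    proof cases
      case two
      \<comment> \<open>With this sign the larger entry loses the absolute value of the smaller one:
        the new entry has absolute value
        \<open>\<bar>A 0 k\<bar> - \<bar>A 0 l\<bar>\<close>.\<close>
      define a where "a = - (sgn (A 0 k) * sgn (A 0 l))"
      let ?B = "\<lambda>i j. if j = k then A i k + a * A i l else A i j"
      have "\<bar>A 0 k + a * A 0 l\<bar> < \<bar>A 0 k\<bar>"
        using two by (auto simp: a_def sgn_if)
      then have lt: "nat \<bar>?B 0 k\<bar> < nat \<bar>A 0 k\<bar>"
        by simp
      have "(\<Sum>j<Suc n. nat \<bar>?B 0 j\<bar>) < (\<Sum>j<Suc n. nat \<bar>A 0 j\<bar>)"
        using lt two(1) by (intro sum_strict_mono_ex1) auto
      moreover have "fdet (Suc n) ?B = fdet (Suc n) A"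
        using two by (intro fdet_add_column) auto
      ultimately obtain T where "transversal (Suc n) ?B T" "card T = nat \<bar>fdet (Suc n) A\<bar>"
        using less.hyps [of ?B] less.prems by auto
      then show ?thesis
        using transversal_add_column [of k "Suc n" l A a T] two by blast
    next
      case one
      let ?B = "\<lambda>i j. A i (Transposition.transpose 0 k j)"
      have B: "?B 0 j = 0" if "0 < j" "j < Suc n" for j
        using one that by (auto simp: Transposition.transpose_def)
      have abs: "\<bar>fdet (Suc n) ?B\<bar> = \<bar>fdet (Suc n) A\<bar>"
      proof (cases "k = 0")
        case False
        then show ?thesis
          using fdet_swap_columns [of 0 "Suc n" k A] one(1) by simp
      qed simp
      have det: "fdet (Suc n) ?B = ?B 0 0 * fdet n (\<lambda>i j. ?B (Suc i) (Suc j))"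
        by (rule fdet_first_row) (rule B)
      then have nz: "?B 0 0 \<noteq> 0" "fdet n (\<lambda>i j. ?B (Suc i) (Suc j)) \<noteq> 0"
        using abs less.prems by auto
      obtain T where "transversal n (\<lambda>i j. ?B (Suc i) (Suc j)) T"
          "card T = nat \<bar>fdet n (\<lambda>i j. ?B (Suc i) (Suc j))\<bar>"
        using Suc.IH [OF nz(2)] by blast
      then obtain T' where T': "transversal (Suc n) ?B T'"
          "card T' = nat \<bar>?B 0 0\<bar> * nat \<bar>fdet n (\<lambda>i j. ?B (Suc i) (Suc j))\<bar>"
        using transversal_first_row [of n ?B T] B nz(1) by auto
      have "nat \<bar>?B 0 0\<bar> * nat \<bar>fdet n (\<lambda>i j. ?B (Suc i) (Suc j))\<bar> = nat \<bar>fdet (Suc n) ?B\<bar>"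
        unfolding det abs_mult by (simp add: nat_mult_distrib)
      with T' abs have "transversal (Suc n) ?B T'" "card T' = nat \<bar>fdet (Suc n) A\<bar>"
        by auto
      then show ?thesis
        using transversal_swap_columns [of 0 "Suc n" k A T'] one(1) by auto
    qed
  qed
qed

subsection \<open>Rational and integral relations\<close>

lemma common_denominator:
  fixes q :: "'a \<Rightarrow> rat"
  assumes "finite B"
  shows "\<exists>N z. N > (0::int) \<and> (\<forall>x\<in>B. of_int N * q x = of_int (z x))"
  using assms
proof (induction B rule: finite_induct)
  case empty
  show ?case by (intro exI [of _ 1]) simp
next
  case (insert a B)
  then obtain N z where N: "N > 0" "\<And>x. x \<in> B \<Longrightarrow> of_int N * q x = of_int (z x)"
    by auto
  obtain k l where kl: "quotient_of (q a) = (k, l)"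
    by (meson surj_pair)
  then have l: "l > 0" "q a = of_int k / of_int l"
    using quotient_of_denom_pos quotient_of_div by blast+
  let ?z = "\<lambda>x. if x = a then N * k else l * z x"
  have "of_int (N * l) * q x = of_int (?z x)" if "x \<in> insert a B" for x
  proof (cases "x = a")
    case True
    then show ?thesis
      using l by simp
  next
    case False
    with that have "of_int N * q x = of_int (z x)"
      using N by auto
    then have "of_int l * (of_int N * q x) = of_int l * of_int (z x)"
      by simp
    with False show ?thesis
      by (simp add: mult_ac)
  qed
  moreover have "N * l > 0"
    using N l by simp
  ultimately show ?case
    by (intro exI [of _ "N * l"] exI [of _ ?z] conjI ballI)
qed

text \<open>A \<open>\<rat>\<close>-linear functional on \<open>\<real>\<close> turns a real relation between integer vectors into a rational one.\<close>

lemma integral_relation: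
  fixes r :: "'a \<Rightarrow> real" and Q :: "'a \<Rightarrow> 'b \<Rightarrow> int"
  assumes B: "finite B" and x0: "x0 \<in> B" "r x0 \<noteq> 0"
    and rel: "\<And>g. (\<Sum>x\<in>B. r x * of_int (Q x g)) = 0"
  shows "\<exists>z. z x0 \<noteq> (0::int) \<and> (\<forall>g. (\<Sum>x\<in>B. z x * Q x g) = 0)"
proof -
  interpret R: vector_space "\<lambda>(q::rat) (x::real). of_rat q * x"
    by unfold_locales (simp_all add: distrib_left distrib_right of_rat_add of_rat_mult mult.assoc)
  interpret Q: vector_space "\<lambda>(q::rat) (x::rat). q * x"
    by unfold_locales (simp_all add: distrib_left distrib_right mult.assoc)
  interpret RQ: vector_space_pair "\<lambda>(q::rat) (x::real). of_rat q * x" "\<lambda>(q::rat) (x::rat). q * x" ..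
  \<comment> \<open>The functional is prescribed at \<open>r x0\<close> alone, with value 1, so that
    the coefficient at \<open>x0\<close> stays nonzero in the rational relation.\<close>
  have "R.independent {r x0}"
    using x0 by (simp add: R.dependent_single)
  then obtain h where lin: "Vector_Spaces.linear (\<lambda>(q::rat) (x::real). of_rat q * x) (\<lambda>(q::rat) (x::rat). q * x) h"
    and h1: "h (r x0) = 1"
    using RQ.linear_independent_extend [of "{r x0}" "\<lambda>_. 1"] by auto
  interpret h: Vector_Spaces.linear "\<lambda>(q::rat) (x::real). of_rat q * x" "\<lambda>(q::rat) (x::rat). q * x" h
    by (rule lin)
  have hi: "h (y * of_int k) = h y * of_int k" for y k
    using h.scale [of "of_int k" y] unfolding of_rat_of_int_eq by (simp only: mult.commute)
  have relh: "(\<Sum>x\<in>B. h (r x) * of_int (Q x g)) = 0" for g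
  proof -
    have "(\<Sum>x\<in>B. h (r x) * of_int (Q x g)) = h (\<Sum>x\<in>B. r x * of_int (Q x g))"
      by (simp add: h.sum hi)
    then show ?thesis
      by (simp add: rel h.zero)
  qed
  obtain N z where N: "N > (0::int)" "\<And>x. x \<in> B \<Longrightarrow> of_int N * h (r x) = of_int (z x)"
    using common_denominator [OF B, of "\<lambda>x. h (r x)"] by auto
  have "z x0 \<noteq> 0"
    using N(2) [OF x0(1)] N(1) h1 by auto
  moreover have "(\<Sum>x\<in>B. z x * Q x g) = 0" for g
  proof -
    have "(of_int (\<Sum>x\<in>B. z x * Q x g) :: rat) = (\<Sum>x\<in>B. of_int N * h (r x) * of_int (Q x g))"
      using N(2) by simp
    also have "\<dots> = of_int N * (\<Sum>x\<in>B. h (r x) * of_int (Q x g))"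
      by (simp add: sum_distrib_left mult_ac)
    finally show ?thesis
      using relh by (simp only: mult_zero_right of_int_eq_0_iff)
  qed
  ultimately show ?thesis
    by blast
qed

lemma sum_fun_apply: "(\<Sum>x\<in>A. f x) y = (\<Sum>x\<in>A. f x y)"
  by (induction A rule: infinite_finite_induct) auto

text \<open>Independence of the image set does not see repeated vectors. Together with injectivity
  it becomes independence of the indexed family, which is the form in which relations between cells
  occur.\<close>

lemma independent_family_iff:
  fixes v :: "'a \<Rightarrow> 'c \<Rightarrow> real"
  assumes B: "finite B"
  shows "inj_on v B \<and> real_fun.independent (v ` B) \<longleftrightarrow>
    (\<forall>r. (\<forall>g. (\<Sum>x\<in>B. r x * v x g) = 0) \<longrightarrow> (\<forall>x\<in>B. r x = 0))" (is "?L \<longleftrightarrow> ?R")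
proof
  assume L: ?L
  show ?R
  proof (intro allI impI ballI)
    fix r x
    assume r: "\<forall>g. (\<Sum>x\<in>B. r x * v x g) = 0" and x: "x \<in> B"
    let ?u = "\<lambda>w. r (inv_into B v w)"
    have "(\<Sum>w\<in>v ` B. real_scale (?u w) w) = (\<Sum>x\<in>B. real_scale (r x) (v x))"
      using L by (subst sum.reindex) auto
    also have "\<dots> = 0"
      using r by (simp add: fun_eq_iff real_scale_def sum_fun_apply)
    finally have "?u (v x) = 0"
      using L B x by (intro real_fun.independentD [of "v ` B" "v ` B" ?u "v x"]) auto
    then show "r x = 0"
      using L x by simp
  qed
next
  assume R: ?R
  have inj: "inj_on v B"
  proof (rule inj_onI, rule ccontr)
    fix x y
    assume xy: "x \<in> B" "y \<in> B" "v x = v y" "x \<noteq> y"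
    let ?r = "\<lambda>z. (if z = x then 1 else 0) - (if z = y then 1 else 0 :: real)"
    have "(\<Sum>z\<in>B. ?r z * v z g) = 0" for g
    proof -
      have "(\<Sum>z\<in>B. ?r z * v z g) = (\<Sum>z\<in>B. (if z = x then v x g else 0) - (if z = y then v y g else 0))"
        by (intro sum.cong) auto
      then show ?thesis
        using B xy by (simp add: sum_subtractf)
    qed
    then have "?r x = 0"
      by (intro R [rule_format, of ?r, OF _ xy(1)])
    with xy show False
      by simp
  qed
  moreover have "real_fun.independent (v ` B)"
  proof
    assume "real_fun.dependent (v ` B)"
    then obtain u x where x: "x \<in> B" "u (v x) \<noteq> 0" and u: "(\<Sum>w\<in>v ` B. real_scale (u w) w) = 0"
      using B real_fun.dependent_finite [of "v ` B"] by auto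
    have "(\<Sum>x\<in>B. real_scale (u (v x)) (v x)) = 0"
      using u inj by (simp add: sum.reindex)
    then have "(\<Sum>x\<in>B. u (v x) * v x g) = 0" for g
      by (metis (mono_tags, lifting) real_scale_def sum.cong sum_fun_apply zero_fun_apply)
    then have "u (v x) = 0"
      by (intro R [rule_format, of "\<lambda>x. u (v x)", OF _ x(1)])
    with x(2) show False
      by simp
  qed
  ultimately show ?L
    by blast
qed

section \<open>Kernels, adjugates and enumerated index sets\<close>

lemma fdet_eq_0_iff:
  fixes A :: "nat \<Rightarrow> nat \<Rightarrow> 'a :: idom"
  shows "fdet n A = 0 \<longleftrightarrow> (\<exists>v. (\<exists>j<n. v j \<noteq> 0) \<and> (\<forall>i<n. (\<Sum>j<n. A i j * v j) = 0))" (is "_ \<longleftrightarrow> ?R")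
proof -
  let ?A = "Matrix.mat n n (\<lambda>(i, j). A i j)"
  have entry: "vec_index (?A *\<^sub>v v) i = (\<Sum>j<n. A i j * vec_index v j)" if "i < n" "v \<in> carrier_vec n" for i v
    using that by (auto simp: Matrix.scalar_prod_def atLeast0LessThan intro!: sum.cong)
  show ?thesis
  proof
    assume "fdet n A = 0"
    then obtain v where v: "v \<in> carrier_vec n" "v \<noteq> 0\<^sub>v n" "?A *\<^sub>v v = 0\<^sub>v n"
      unfolding fdet_def by (subst (asm) det_0_iff_vec_prod_zero [of _ n]) auto
    have "\<exists>j<n. vec_index v j \<noteq> 0"
      using v by (auto simp: Matrix.vec_eq_iff)
    moreover have "(\<Sum>j<n. A i j * vec_index v j) = 0" if "i < n" for i
      using entry [OF that v(1)] v(3) that by simp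
    ultimately show ?R
      by blast
  next
    assume ?R
    then obtain v where v: "\<exists>j<n. v j \<noteq> 0" "\<And>i. i < n \<Longrightarrow> (\<Sum>j<n. A i j * v j) = 0"
      by blast
    let ?v = "Matrix.vec n v"
    have "?v \<noteq> 0\<^sub>v n"
      using v(1) by (auto simp: Matrix.vec_eq_iff)
    moreover have "?A *\<^sub>v ?v = 0\<^sub>v n"
    proof (rule eq_vecI)
      fix i
      assume "i < dim_vec (0\<^sub>v n :: 'a Matrix.vec)"
      then show "vec_index (?A *\<^sub>v ?v) i = vec_index (0\<^sub>v n) i"
        using entry [of i ?v] v(2) [of i] by simp
    qed simp
    ultimately show "fdet n A = 0"
      unfolding fdet_def by (subst det_0_iff_vec_prod_zero [of _ n]) (auto intro!: exI [of _ ?v])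
  qed
qed

text \<open>\<open>c\<close> is a column of the adjugate. It replaces a column of the inverse
  matrix, which need not be integral, at the price of the factor \<open>fdet n A\<close>.\<close>

lemma fdet_adjugate:
  fixes A :: "nat \<Rightarrow> nat \<Rightarrow> 'a :: comm_ring_1"
  assumes "i0 < n"
  shows "\<exists>c. \<forall>i<n. (\<Sum>j<n. A i j * c j) = (if i = i0 then fdet n A else 0)"
proof -
  let ?A = "Matrix.mat n n (\<lambda>(i, j). A i j)"
  have adj: "adj_mat ?A \<in> carrier_mat n n" "?A * adj_mat ?A = Determinant.det ?A \<cdot>\<^sub>m 1\<^sub>m n"
    by (rule adj_mat [of _ n]; simp)+
  have "(\<Sum>j<n. A i j * adj_mat ?A $$ (j, i0)) = (if i = i0 then fdet n A else 0)" if "i < n" for i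
  proof -
    have "(\<Sum>j<n. A i j * adj_mat ?A $$ (j, i0)) = (?A * adj_mat ?A) $$ (i, i0)"
      using that assms adj(1) by (auto simp: Matrix.scalar_prod_def atLeast0LessThan intro!: sum.cong)
    also have "\<dots> = (Determinant.det ?A \<cdot>\<^sub>m 1\<^sub>m n) $$ (i, i0)"
      by (simp only: adj(2))
    finally show ?thesis
      using that assms by (simp add: fdet_def)
  qed
  then show ?thesis
    by (intro exI [of _ "\<lambda>j. adj_mat ?A $$ (j, i0)"] allI impI)
qed

lemma sum_enumeration:
  fixes m :: nat
  assumes "bij_betw e {0..<m} C"
  shows "(\<Sum>x\<in>C. g x) = (\<Sum>i<m. g (e i))"
  using sum.reindex_bij_betw [OF assms, of g] by (simp add: atLeast0LessThan)

lemma enumeration_inv: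
  fixes m :: nat
  assumes "bij_betw e {0..<m} C"
  shows "i < m \<Longrightarrow> inv_into {0..<m} e (e i) = i"
    and "x \<in> C \<Longrightarrow> e (inv_into {0..<m} e x) = x"
    and "x \<in> C \<Longrightarrow> inv_into {0..<m} e x < m"
    and "i < m \<Longrightarrow> e i \<in> C"
proof -
  show "i < m \<Longrightarrow> inv_into {0..<m} e (e i) = i"
    by (rule bij_betw_inv_into_left [OF assms]) simp
  show "x \<in> C \<Longrightarrow> e (inv_into {0..<m} e x) = x"
    by (rule bij_betw_inv_into_right [OF assms])
  show "inv_into {0..<m} e x < m" if "x \<in> C"
    using bij_betw_apply [OF bij_betw_inv_into [OF assms] that] by simp
  show "i < m \<Longrightarrow> e i \<in> C"
    by (rule bij_betw_apply [OF assms]) simp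
qed

text \<open>A homogeneous system with fewer equations than unknowns. It is padded with zero rows to
  a square one, whose determinant vanishes.\<close>

lemma kernel_exists:
  fixes M :: "'c \<Rightarrow> 'd \<Rightarrow> int"
  assumes C: "finite C" and S: "finite S" and less: "card S < card C"
  shows "\<exists>c. (\<exists>x\<in>C. c x \<noteq> 0) \<and> (\<forall>f\<in>S. (\<Sum>x\<in>C. c x * M x f) = 0)"
proof -
  let ?m = "card C" and ?s = "card S"
  obtain eC where eC: "bij_betw eC {0..<?m} C"
    using ex_bij_betw_nat_finite [OF C] by blast
  obtain eS where eS: "bij_betw eS {0..<?s} S"
    using ex_bij_betw_nat_finite [OF S] by blast
  let ?A = "\<lambda>i j. if i < ?s then M (eC j) (eS i) else 0"
  \<comment> \<open>Row \<open>?s\<close> is the first padding row, so the corresponding unit vector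
    lies in the kernel of the transpose.\<close>
  have "fdet ?m (\<lambda>i j. ?A j i) = 0"
    unfolding fdet_eq_0_iff
    by (rule exI [of _ "\<lambda>j. if j = ?s then 1 else 0"]) (use less in \<open>auto simp: if_distrib [where f = "\<lambda>x. _ * x"] cong: if_cong\<close>)
  then have "fdet ?m ?A = 0"
    using fdet_transpose [of ?m "\<lambda>i j. ?A i j"] by simp
  then obtain v where v: "\<exists>j<?m. v j \<noteq> 0" "\<And>i. i < ?m \<Longrightarrow> (\<Sum>j<?m. ?A i j * v j) = 0"
    unfolding fdet_eq_0_iff by blast
  let ?c = "\<lambda>x. v (inv_into {0..<?m} eC x)"
  have "\<exists>x\<in>C. ?c x \<noteq> 0"
    using v(1) enumeration_inv(1,4) [OF eC] by metis
  moreover have "(\<Sum>x\<in>C. ?c x * M x f) = 0" if f: "f \<in> S" for f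
  proof -
    let ?i = "inv_into {0..<?s} eS f"
    have i: "?i < ?s" "eS ?i = f"
      using enumeration_inv [OF eS] f by auto
    have "(\<Sum>x\<in>C. ?c x * M x f) = (\<Sum>j<?m. ?A ?i j * v j)"
      unfolding sum_enumeration [OF eC] using i enumeration_inv(1) [OF eC] by (intro sum.cong) auto
    also have "\<dots> = 0"
      by (rule v(2)) (use i(1) less in linarith)
    finally show ?thesis .
  qed
  ultimately show ?thesis
    by (intro exI [of _ ?c] conjI ballI)
qed

section \<open>Minors of an exact pair of boundary matrices\<close>

text \<open>\<open>M\<close> and \<open>Q\<close> abstract the boundary matrices in degrees \<open>d + 1\<close> and \<open>d\<close> of an acyclization.\<close>

locale exact_boundary_pair =
  fixes C R :: "'c set" and M Q :: "'c \<Rightarrow> 'c \<Rightarrow> int"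
  assumes finite_C: "finite C" and finite_R: "finite R"
    and injective: "\<And>c x. \<lbrakk>\<forall>f\<in>R. (\<Sum>e\<in>C. c e * M e f) = 0; x \<in> C\<rbrakk> \<Longrightarrow> c x = 0"
    and complex: "\<And>e g. e \<in> C \<Longrightarrow> (\<Sum>f\<in>R. M e f * Q f g) = 0"
    and exact: "\<And>z. \<forall>g. (\<Sum>f\<in>R. z f * Q f g) = 0 \<Longrightarrow> \<exists>c. \<forall>f\<in>R. z f = (\<Sum>e\<in>C. c e * M e f)"
begin

lemma boundary_of_combination:
  "(\<Sum>f\<in>R. (\<Sum>e\<in>C. c e * M e f) * Q f g) = 0"
proof -
  have "(\<Sum>f\<in>R. (\<Sum>e\<in>C. c e * M e f) * Q f g) = (\<Sum>f\<in>R. \<Sum>e\<in>C. c e * (M e f * Q f g))"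
    by (simp add: sum_distrib_right mult.assoc)
  also have "\<dots> = (\<Sum>e\<in>C. \<Sum>f\<in>R. c e * (M e f * Q f g))"
    by (rule sum.swap)
  also have "\<dots> = (\<Sum>e\<in>C. c e * (\<Sum>f\<in>R. M e f * Q f g))"
    by (simp add: sum_distrib_left)
  finally show ?thesis
    by (simp add: complex)
qed

text \<open>A cycle supported on \<open>B\<close>, extended by zero, is a cycle on \<open>R\<close>
  and therefore a boundary. Independence uses this for \<open>R - S\<close>, spanning for
  \<open>R - S\<close> with one more cell.\<close>

lemma exact_extension:
  assumes "B \<subseteq> R" "\<And>g. (\<Sum>f\<in>B. z f * Q f g) = 0"
  obtains c where "\<And>f. f \<in> B \<Longrightarrow> (\<Sum>e\<in>C. c e * M e f) = z f"
    "\<And>f. f \<in> R - B \<Longrightarrow> (\<Sum>e\<in>C. c e * M e f) = 0"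
proof -
  have "(\<Sum>f\<in>R. (if f \<in> B then z f else 0) * Q f g) = (\<Sum>f\<in>B. z f * Q f g)" for g
    using assms(1) finite_R by (intro sum.mono_neutral_cong_right) auto
  then obtain c where c: "\<forall>f\<in>R. (if f \<in> B then z f else 0) = (\<Sum>e\<in>C. c e * M e f)"
    using exact [of "\<lambda>f. if f \<in> B then z f else 0"] assms(2) by auto
  show thesis
  proof
    show "(\<Sum>e\<in>C. c e * M e f) = z f" if "f \<in> B" for f
      using bspec [OF c, of f] that assms(1) by auto
    show "(\<Sum>e\<in>C. c e * M e f) = 0" if "f \<in> R - B" for f
      using bspec [OF c, of f] that by auto
  qed
qed

abbreviation column :: "'c \<Rightarrow> 'c \<Rightarrow> real" where
  "column f \<equiv> \<lambda>g. of_int (Q f g)"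

text \<open>By exactness the integral relations among the columns outside \<open>S\<close> are the
  boundaries that vanish on \<open>S\<close>. As the top boundary map is injective, there is no
  nontrivial relation exactly when no nonzero \<open>c\<close> has such a boundary.\<close>

lemma independent_iff:
  assumes S: "S \<subseteq> R"
  shows "inj_on column (R - S) \<and> real_fun.independent (column ` (R - S)) \<longleftrightarrow>
    (\<forall>c. (\<forall>f\<in>S. (\<Sum>e\<in>C. c e * M e f) = 0) \<longrightarrow> (\<forall>x\<in>C. c x = 0))"
proof -
  have finB: "finite (R - S)"
    using finite_R by simp
  show ?thesis
    unfolding independent_family_iff [OF finB]
  proof (intro iffI allI impI)
    fix c
    assume L: "\<forall>r. (\<forall>g. (\<Sum>x\<in>R - S. r x * column x g) = 0) \<longrightarrow> (\<forall>x\<in>R - S. r x = 0)"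
      and c: "\<forall>f\<in>S. (\<Sum>e\<in>C. c e * M e f) = 0"
    let ?z = "\<lambda>f. \<Sum>e\<in>C. c e * M e f"
    have "(\<Sum>f\<in>R - S. ?z f * Q f g) = (\<Sum>f\<in>R. ?z f * Q f g)" for g
      using c finite_R by (intro sum.mono_neutral_left) auto
    then have "(\<Sum>f\<in>R - S. ?z f * Q f g) = 0" for g
      by (simp only: boundary_of_combination)
    then have "(\<Sum>f\<in>R - S. of_int (?z f) * column f g) = 0" for g
      unfolding of_int_mult [symmetric] of_int_sum [symmetric] by (simp only: of_int_0)
    then have "of_int (?z f) = (0::real)" if "f \<in> R - S" for f
      by (intro L [rule_format, of "\<lambda>f. of_int (?z f)", OF _ that])
    then have "?z f = 0" if "f \<in> R - S" for f
      using that by (simp only: of_int_eq_0_iff)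
    with c have "\<forall>f\<in>R. ?z f = 0"
      by blast
    then show "\<forall>x\<in>C. c x = 0"
      using injective by blast
  next
    fix r
    assume Rt: "\<forall>c. (\<forall>f\<in>S. (\<Sum>e\<in>C. c e * M e f) = 0) \<longrightarrow> (\<forall>x\<in>C. c x = 0)"
      and r: "\<forall>g. (\<Sum>x\<in>R - S. r x * column x g) = 0"
    show "\<forall>x\<in>R - S. r x = 0"
    proof (rule ccontr)
      assume "\<not> (\<forall>x\<in>R - S. r x = 0)"
      then obtain f0 where f0: "f0 \<in> R - S" "r f0 \<noteq> 0"
        by blast
      \<comment> \<open>Exactness is available only for integers, so the real relation is replaced
        by an integral one that still involves \<open>f0\<close>.\<close>
      obtain z where z: "z f0 \<noteq> (0::int)" "\<And>g. (\<Sum>x\<in>R - S. z x * Q x g) = 0"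
        using integral_relation [of "R - S" f0 r Q] finB f0 r by auto
      obtain c where c: "\<And>f. f \<in> R - S \<Longrightarrow> (\<Sum>e\<in>C. c e * M e f) = z f"
        "\<And>f. f \<in> R - (R - S) \<Longrightarrow> (\<Sum>e\<in>C. c e * M e f) = 0"
        using exact_extension [OF _ z(2)] by blast
      have "\<forall>f\<in>S. (\<Sum>e\<in>C. c e * M e f) = 0"
        using c(2) S by blast
      then have "\<forall>x\<in>C. c x = 0"
        using Rt by blast
      then have "(\<Sum>e\<in>C. c e * M e f0) = 0"
        by simp
      with c(1) [OF f0(1)] z(1) show False
        by simp
    qed
  qed
qed

text \<open>The column of \<open>f0\<close> is spanned by the columns outside \<open>S\<close>
  exactly when some relation supported on those cells and \<open>f0\<close> has a nonzero
  coefficient at \<open>f0\<close>. Such a relation is a boundary which on \<open>S\<close> is a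
  multiple of \<open>f0\<close>; for all \<open>f0\<close> together this says that the rows in
  \<open>S\<close> give a map onto, over the rationals.\<close>

lemma spanning_iff:
  assumes S: "S \<subseteq> R"
  shows "real_fun.span (column ` (R - S)) = real_fun.span (column ` R) \<longleftrightarrow>
    (\<forall>f0\<in>S. \<exists>c k. k \<noteq> 0 \<and> (\<forall>f\<in>S. (\<Sum>e\<in>C. c e * M e f) = (if f = f0 then k else 0)))"
    (is "?L \<longleftrightarrow> ?J")
proof
  assume L: ?L
  show ?J
  proof
    fix f0
    assume f0: "f0 \<in> S"
    let ?B = "insert f0 (R - S)"
    have finB: "finite ?B"
      using finite_R by simp
    have "column f0 \<in> real_fun.span (column ` (R - S))"
      unfolding L using f0 S by (intro real_fun.span_base) auto
    then obtain r where r: "r f0 = -1" "\<And>g. (\<Sum>x\<in>?B. r x * column x g) = 0"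
    proof -
      obtain B' u where B': "finite B'" "B' \<subseteq> column ` (R - S)" "column f0 = (\<Sum>w\<in>B'. real_scale (u w) w)"
        using \<open>column f0 \<in> real_fun.span (column ` (R - S))\<close> unfolding real_fun.span_explicit by blast
      \<comment> \<open>Membership in the span gives a combination indexed by vectors;
        \<open>A\<close> selects one cell for each vector that occurs.\<close>
      obtain A where A: "A \<subseteq> R - S" "inj_on column A" "B' = column ` A"
        using B'(2) subset_image_inj [of B' column "R - S"] by auto
      define r where "r x = (if x = f0 then -1 else if x \<in> A then u (column x) else 0)" for x
      have "(\<Sum>x\<in>?B. r x * column x g) = 0" for g
      proof -
        have "f0 \<notin> R - S"
          using f0 by simp
        then have "(\<Sum>x\<in>?B. r x * column x g) = - column f0 g + (\<Sum>x\<in>R - S. r x * column x g)"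
          using finite_R by (simp add: r_def)
        also have "(\<Sum>x\<in>R - S. r x * column x g) = (\<Sum>x\<in>A. u (column x) * column x g)"
          using A(1) f0 finite_R by (intro sum.mono_neutral_cong_right) (auto simp: r_def)
        also have "\<dots> = (\<Sum>w\<in>B'. u w * w g)"
          using A(2,3) by (simp add: sum.reindex)
        also have "\<dots> = column f0 g"
          using fun_cong [OF B'(3), of g] by (simp add: sum_fun_apply real_scale_def)
        finally show ?thesis
          by simp
      qed
      then show thesis
        by (intro that [of r]) (simp_all add: r_def)
    qed
    obtain z where z: "z f0 \<noteq> (0::int)" "\<And>g. (\<Sum>x\<in>?B. z x * Q x g) = 0"
      using integral_relation [OF finB, of f0 r Q] r by auto
    obtain c where c: "\<And>f. f \<in> ?B \<Longrightarrow> (\<Sum>e\<in>C. c e * M e f) = z f"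
        "\<And>f. f \<in> R - ?B \<Longrightarrow> (\<Sum>e\<in>C. c e * M e f) = 0"
      using exact_extension [OF _ z(2)] S f0 by blast
    have "(\<Sum>e\<in>C. c e * M e f) = (if f = f0 then z f0 else 0)" if "f \<in> S" for f
      using c(1) [of f] c(2) [of f] that S by auto
    with z(1) show "\<exists>c k. k \<noteq> 0 \<and> (\<forall>f\<in>S. (\<Sum>e\<in>C. c e * M e f) = (if f = f0 then k else 0))"
      by (intro exI [of _ c] exI [of _ "z f0"] conjI ballI)
  qed
next
  assume J: ?J
  have "column f0 \<in> real_fun.span (column ` (R - S))" if f0R: "f0 \<in> R" for f0
  proof (cases "f0 \<in> S")
    case False
    with f0R show ?thesis
      by (intro real_fun.span_base) auto
  next
    case True
    then obtain c k where k: "k \<noteq> 0" and c: "\<And>f. f \<in> S \<Longrightarrow> (\<Sum>e\<in>C. c e * M e f) = (if f = f0 then k else 0)"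
      using J by meson
    let ?z = "\<lambda>f. \<Sum>e\<in>C. c e * M e f"
    \<comment> \<open>On \<open>S\<close> the boundary \<open>?z\<close> is \<open>k\<close> at
      \<open>f0\<close> and 0 elsewhere, so the relation it satisfies can be solved for the column
      of \<open>f0\<close>.\<close>
    have "column f0 = (\<Sum>f\<in>R - S. real_scale (- of_int (?z f) / of_int k) (column f))"
    proof
      fix g
      have "0 = (\<Sum>f\<in>R. ?z f * Q f g)"
        by (simp only: boundary_of_combination)
      also have "\<dots> = (\<Sum>f\<in>S. ?z f * Q f g) + (\<Sum>f\<in>R - S. ?z f * Q f g)"
        using S finite_R by (simp add: sum.subset_diff add.commute)
      also have "(\<Sum>f\<in>S. ?z f * Q f g) = (\<Sum>f\<in>S. if f = f0 then k * Q f0 g else 0)"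
        by (rule sum.cong) (auto simp: c)
      also have "\<dots> = k * Q f0 g"
        using True finite_subset [OF S finite_R] by simp
      finally have "k * Q f0 g = - (\<Sum>f\<in>R - S. ?z f * Q f g)"
        by simp
      then have "of_int (k * Q f0 g) = (of_int (- (\<Sum>f\<in>R - S. ?z f * Q f g)) :: real)"
        by (simp only:)
      then have *: "of_int k * column f0 g = - (\<Sum>f\<in>R - S. of_int (?z f) * column f g)"
        by (simp only: of_int_mult of_int_minus of_int_sum)
      have "column f0 g = - (\<Sum>f\<in>R - S. of_int (?z f) * column f g) / of_int k"
        unfolding * [symmetric] using k by simp
      also have "\<dots> = (\<Sum>f\<in>R - S. (- of_int (?z f) / of_int k) * column f g)"
      proof -
        have "- (\<Sum>f\<in>R - S. a f * column f g) / l = (\<Sum>f\<in>R - S. (- a f / l) * column f g)"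
          for a :: "'c \<Rightarrow> real" and l
          by (simp add: sum_divide_distrib sum_negf)
        then show ?thesis .
      qed
      also have "\<dots> = (\<Sum>f\<in>R - S. real_scale (- of_int (?z f) / of_int k) (column f)) g"
        by (simp only: sum_fun_apply real_scale_def)
      finally show "column f0 g = (\<Sum>f\<in>R - S. real_scale (- of_int (?z f) / of_int k) (column f)) g" .
    qed
    also have "\<dots> \<in> real_fun.span (column ` (R - S))"
      by (intro real_fun.span_sum real_fun.span_scale real_fun.span_base) auto
    finally show ?thesis .
  qed
  then have "real_fun.span (column ` R) \<subseteq> real_fun.span (column ` (R - S))"
    by (intro real_fun.span_minimal) (auto simp: real_fun.subspace_span)
  moreover have "real_fun.span (column ` (R - S)) \<subseteq> real_fun.span (column ` R)"
    by (intro real_fun.span_mono) auto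
  ultimately show ?L
    by blast
qed

text \<open>Independence and spanning say that the rows in \<open>S\<close> define a map that is
  injective and, over the rationals, onto. This forces as many rows as columns, after which a
  nonzero determinant is equivalent to either property. The enumeration of \<open>S\<close> by
  \<open>m\<close> indices is assumed only under equality of cardinalities, since it cannot exist
  otherwise.\<close>

lemma basis_iff_minor:
  assumes S: "S \<subseteq> R" and eC: "bij_betw eC {0..<m} C"
    and eS: "card S = m \<Longrightarrow> bij_betw eS {0..<m} S"
  shows "inj_on column (R - S) \<and> real_fun.independent (column ` (R - S)) \<and>
      real_fun.span (column ` (R - S)) = real_fun.span (column ` R) \<longleftrightarrow>
    card S = m \<and> fdet m (\<lambda>i j. M (eC j) (eS i)) \<noteq> 0" (is "?L \<longleftrightarrow> ?R")
proof -
  have m: "card C = m"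
    using bij_betw_same_card [OF eC] by simp
  have finS: "finite S"
    using S finite_R finite_subset by blast
  let ?A = "\<lambda>i j. M (eC j) (eS i)"
  have L: "?L \<longleftrightarrow> (\<forall>c. (\<forall>f\<in>S. (\<Sum>e\<in>C. c e * M e f) = 0) \<longrightarrow> (\<forall>x\<in>C. c x = 0)) \<and>
      (\<forall>f0\<in>S. \<exists>c k. k \<noteq> 0 \<and> (\<forall>f\<in>S. (\<Sum>e\<in>C. c e * M e f) = (if f = f0 then k else 0)))"
      (is "_ \<longleftrightarrow> ?I \<and> ?J")
    using independent_iff [OF S] spanning_iff [OF S] by (simp only: conj_assoc [symmetric])
  have row: "(\<Sum>e\<in>C. c e * M e (eS i)) = (\<Sum>j<m. ?A i j * c (eC j))" for c i
    unfolding sum_enumeration [OF eC] by (simp add: mult.commute)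
  show ?thesis
  proof
    assume ?L
    then have IJ: "?I \<and> ?J"
      by (rule iffD1 [OF L])
    note I = conjunct1 [OF IJ] and J = conjunct2 [OF IJ]
    have "\<not> card S < card C"
    proof
      assume "card S < card C"
      then obtain c where "\<exists>x\<in>C. c x \<noteq> 0" "\<forall>f\<in>S. (\<Sum>x\<in>C. c x * M x f) = 0"
        using kernel_exists [OF finite_C finS, of M] by blast
      with I show False
        by blast
    qed
    \<comment> \<open>With more rows than columns, a nonzero \<open>w\<close> annihilates everything
      in the image. Pairing it with a solution for an \<open>f0\<close> where \<open>w f0\<close> is
      nonzero gives \<open>w f0 * k = 0\<close>, although neither factor vanishes.\<close>
    moreover have "\<not> card C < card S"
    proof
      assume "card C < card S"
      then obtain w where w: "\<exists>f\<in>S. w f \<noteq> 0" "\<forall>e\<in>C. (\<Sum>f\<in>S. w f * M e f) = 0"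
        using kernel_exists [OF finS finite_C, of "\<lambda>f e. M e f"] by blast
      then obtain f0 where f0: "f0 \<in> S" "w f0 \<noteq> 0"
        by blast
      then obtain c k where k: "k \<noteq> 0" and c: "\<And>f. f \<in> S \<Longrightarrow> (\<Sum>e\<in>C. c e * M e f) = (if f = f0 then k else 0)"
        using J by meson
      have "(\<Sum>f\<in>S. w f * (\<Sum>e\<in>C. c e * M e f)) = (\<Sum>f\<in>S. if f = f0 then w f0 * k else 0)"
        by (rule sum.cong) (auto simp: c)
      then have "w f0 * k = (\<Sum>f\<in>S. w f * (\<Sum>e\<in>C. c e * M e f))"
        using f0 finS by simp
      also have "\<dots> = (\<Sum>f\<in>S. \<Sum>e\<in>C. c e * (w f * M e f))"
        by (simp add: sum_distrib_left mult_ac)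
      also have "\<dots> = (\<Sum>e\<in>C. \<Sum>f\<in>S. c e * (w f * M e f))"
        by (rule sum.swap)
      also have "\<dots> = (\<Sum>e\<in>C. c e * (\<Sum>f\<in>S. w f * M e f))"
        by (simp add: sum_distrib_left)
      also have "\<dots> = 0"
        using w(2) by simp
      finally show False
        using f0 k by simp
    qed
    ultimately have card: "card S = m"
      using m by simp
    note eS = eS [OF card]
    have "fdet m ?A \<noteq> 0"
    proof
      assume "fdet m ?A = 0"
      then obtain v where v: "\<exists>j<m. v j \<noteq> 0" "\<And>i. i < m \<Longrightarrow> (\<Sum>j<m. ?A i j * v j) = 0"
        unfolding fdet_eq_0_iff by blast
      let ?c = "\<lambda>x. v (inv_into {0..<m} eC x)"
      have "(\<Sum>e\<in>C. ?c e * M e f) = 0" if "f \<in> S" for f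
      proof -
        let ?i = "inv_into {0..<m} eS f"
        have i: "?i < m" "eS ?i = f"
          using enumeration_inv [OF eS] that by auto
        have "(\<Sum>e\<in>C. ?c e * M e f) = (\<Sum>j<m. ?A ?i j * ?c (eC j))"
          using row [of ?c ?i] unfolding i(2) .
        also have "\<dots> = (\<Sum>j<m. ?A ?i j * v j)"
          using enumeration_inv(1) [OF eC] by (intro sum.cong) auto
        also have "\<dots> = 0"
          by (rule v(2) [OF i(1)])
        finally show ?thesis .
      qed
      then have "\<forall>x\<in>C. ?c x = 0"
        by (intro I [rule_format, of ?c, THEN ballI]) 
      then have "v j = 0" if "j < m" for j
        using enumeration_inv(1) [OF eC that] enumeration_inv(4) [OF eC that] by metis
      with v(1) show False
        by blast
    qed
    with card show ?R ..
  next
    assume R: ?R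
    then have nz: "fdet m ?A \<noteq> 0" and eS: "bij_betw eS {0..<m} S"
      using eS by auto
    have ?I
    proof (intro allI impI, rule ccontr)
      fix c
      assume c: "\<forall>f\<in>S. (\<Sum>e\<in>C. c e * M e f) = 0" and "\<not> (\<forall>x\<in>C. c x = 0)"
      then obtain x where x: "x \<in> C" "c x \<noteq> 0"
        by blast
      have "(\<Sum>j<m. ?A i j * c (eC j)) = 0" if "i < m" for i
        unfolding row [symmetric] using c enumeration_inv(4) [OF eS that] by blast
      moreover have "\<exists>j<m. c (eC j) \<noteq> 0"
        using enumeration_inv(2,3) [OF eC x(1)] x(2) by metis
      ultimately have "fdet m ?A = 0"
        unfolding fdet_eq_0_iff by (intro exI [of _ "\<lambda>j. c (eC j)"] conjI allI impI)
      with nz show False ..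
    qed
    moreover have ?J
    proof
      fix f0
      assume f0: "f0 \<in> S"
      let ?p = "inv_into {0..<m} eS f0"
      have i0: "?p < m" "eS ?p = f0"
        using enumeration_inv [OF eS] f0 by auto
      obtain v where v: "\<And>i. i < m \<Longrightarrow> (\<Sum>j<m. ?A i j * v j) = (if i = ?p then fdet m ?A else 0)"
        using fdet_adjugate [OF i0(1), of ?A] by blast
      let ?c = "\<lambda>x. v (inv_into {0..<m} eC x)"
      have "(\<Sum>e\<in>C. ?c e * M e f) = (if f = f0 then fdet m ?A else 0)" if "f \<in> S" for f
      proof -
        let ?i = "inv_into {0..<m} eS f"
        have i: "?i < m" "eS ?i = f"
          using enumeration_inv [OF eS] that by auto
        have "(\<Sum>e\<in>C. ?c e * M e f) = (\<Sum>j<m. ?A ?i j * ?c (eC j))"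
          using row [of ?c ?i] unfolding i(2) .
        also have "\<dots> = (\<Sum>j<m. ?A ?i j * v j)"
          using enumeration_inv(1) [OF eC] by (intro sum.cong) auto
        also have "\<dots> = (if ?i = ?p then fdet m ?A else 0)"
          by (rule v [OF i(1)])
        also have "?i = ?p \<longleftrightarrow> f = f0"
          using i(2) i0(2) by metis
        finally show ?thesis .
      qed
      with nz show "\<exists>c k. k \<noteq> 0 \<and> (\<forall>f\<in>S. (\<Sum>e\<in>C. c e * M e f) = (if f = f0 then k else 0))"
        by (intro exI [of _ ?c] exI [of _ "fdet m ?A"] conjI ballI)
    qed
    ultimately show ?L
      by (intro iffD2 [OF L] conjI)
  qed
qed

end

subsection \<open>Orders of quotients of free abelian groups\<close>

text \<open>The index set \<open>T\<close> is kept apart from the group: its members are integer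
  vectors, and \<open>h\<close> turns them into group elements.\<close>

lemma order_FactGroup_transversal:
  assumes "group G" "subgroup H G" "finite T" "\<And>t. t \<in> T \<Longrightarrow> h t \<in> carrier G"
    and ex: "\<And>x. x \<in> carrier G \<Longrightarrow> \<exists>t\<in>T. x \<in> H #>\<^bsub>G\<^esub> h t"
    and unique: "\<And>t t'. \<lbrakk>t \<in> T; t' \<in> T; h t \<in> H #>\<^bsub>G\<^esub> h t'\<rbrakk> \<Longrightarrow> t = t'"
  shows "finite (carrier (G Mod H))" and "order (G Mod H) = card T"
proof -
  interpret group G by fact
  have "carrier (G Mod H) = (\<lambda>t. H #>\<^bsub>G\<^esub> h t) ` T"
  proof
    show "carrier (G Mod H) \<subseteq> (\<lambda>t. H #>\<^bsub>G\<^esub> h t) ` T"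
    proof
      fix K
      assume "K \<in> carrier (G Mod H)"
      then obtain x where x: "x \<in> carrier G" "K = H #>\<^bsub>G\<^esub> x"
        by (auto simp: carrier_FactGroup)
      obtain t where t: "t \<in> T" "x \<in> H #>\<^bsub>G\<^esub> h t"
        using ex [OF x(1)] by blast
      then have "K = H #>\<^bsub>G\<^esub> h t"
        using repr_independence [OF t(2)] assms(2,4) x(2) by simp
      with t show "K \<in> (\<lambda>t. H #>\<^bsub>G\<^esub> h t) ` T"
        by blast
    qed
    show "(\<lambda>t. H #>\<^bsub>G\<^esub> h t) ` T \<subseteq> carrier (G Mod H)"
      using assms(4) by (auto simp: carrier_FactGroup)
  qed
  moreover have "inj_on (\<lambda>t. H #>\<^bsub>G\<^esub> h t) T"
  proof (rule inj_onI)
    fix t t'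
    assume t: "t \<in> T" "t' \<in> T" "H #>\<^bsub>G\<^esub> h t = H #>\<^bsub>G\<^esub> h t'"
    then have "h t \<in> H #>\<^bsub>G\<^esub> h t'"
      using rcos_self [OF assms(4) [OF t(1)] assms(2)] by simp
    with t unique show "t = t'"
      by blast
  qed
  ultimately show "finite (carrier (G Mod H))" "order (G Mod H) = card T"
    using assms(3) by (auto simp: Coset.order_def card_image)
qed

definition frag_sum :: "'c set \<Rightarrow> ('c \<Rightarrow> int) \<Rightarrow> 'c \<Rightarrow>\<^sub>0 int" where
  "frag_sum A t = (\<Sum>a\<in>A. frag_cmul (t a) (frag_of a))"

lemma lookup_sum_frag: "poly_mapping.lookup (\<Sum>a\<in>A. h a) x = (\<Sum>a\<in>A. poly_mapping.lookup (h a) x)"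
  by (induction A rule: infinite_finite_induct) (auto simp: lookup_add)

lemma lookup_frag_sum: "finite A \<Longrightarrow> poly_mapping.lookup (frag_sum A t) x = (if x \<in> A then t x else 0)"
  by (simp add: frag_sum_def lookup_sum_frag if_distrib [where f = "\<lambda>y. _ * y"] cong: if_cong)

lemma keys_frag_sum:
  assumes "finite A"
  shows "Poly_Mapping.keys (frag_sum A t) \<subseteq> A"
proof
  fix x
  assume "x \<in> Poly_Mapping.keys (frag_sum A t)"
  then have "poly_mapping.lookup (frag_sum A t) x \<noteq> 0"
    by (rule in_keys_iff [THEN iffD1])
  then show "x \<in> A"
    using lookup_frag_sum [OF assms, of t x] by argo
qed

text \<open>\<open>H\<close> leaves the coordinates outside \<open>S\<close> free and confines those
  in \<open>S\<close> to a lattice, so the quotient is that of the integer vectors on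
  \<open>S\<close> by the lattice. Relative homology is the case of \<open>S\<close> inside the set
  of d-cells; for relative cohomology and the cocritical group \<open>S\<close> and \<open>U\<close>
  are both the set of (d+1)-cells.\<close>

theorem order_free_Abelian_group_Mod:
  fixes U S :: "'c set" and D :: "'d set" and N :: "'d \<Rightarrow> 'c \<Rightarrow> int"
  assumes U: "finite U" and S: "S \<subseteq> U"
    and eD: "bij_betw eD {0..<m} D" and eS: "bij_betw eS {0..<m} S"
    and nz: "fdet m (\<lambda>i j. N (eD j) (eS i)) \<noteq> 0"
    and H: "\<And>x. x \<in> H \<longleftrightarrow> Poly_Mapping.keys x \<subseteq> U \<and>
      (\<exists>c. \<forall>f\<in>S. poly_mapping.lookup x f = (\<Sum>e\<in>D. c e * N e f))"
  shows "finite (carrier (free_Abelian_group U Mod H))"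
    and "order (free_Abelian_group U Mod H) = nat \<bar>fdet m (\<lambda>i j. N (eD j) (eS i))\<bar>"
proof -
  let ?G = "free_Abelian_group U"
  let ?A = "\<lambda>i j. N (eD j) (eS i)"
  obtain T where T: "transversal m ?A T" "card T = nat \<bar>fdet m ?A\<bar>"
    using transversal_exists [OF nz] by blast
  have HD: "\<exists>c. \<forall>f\<in>S. poly_mapping.lookup x f = (\<Sum>e\<in>D. c e * N e f)" if "x \<in> H" for x
    using that unfolding H by (rule conjunct2)
  have HK: "Poly_Mapping.keys x \<subseteq> U" if "x \<in> H" for x
    using that unfolding H by (rule conjunct1)
  have H_add: "x + y \<in> H" if x: "x \<in> H" and y: "y \<in> H" for x y
  proof -
    obtain c where c: "\<forall>f\<in>S. poly_mapping.lookup x f = (\<Sum>e\<in>D. c e * N e f)"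
      using HD [OF x] ..
    obtain c' where c': "\<forall>f\<in>S. poly_mapping.lookup y f = (\<Sum>e\<in>D. c' e * N e f)"
      using HD [OF y] ..
    from c c' have "\<forall>f\<in>S. poly_mapping.lookup (x + y) f = (\<Sum>e\<in>D. (c e + c' e) * N e f)"
      by (simp add: lookup_add distrib_right sum.distrib)
    moreover have "Poly_Mapping.keys (x + y) \<subseteq> U"
      using Poly_Mapping.keys_add [of x y] HK [OF x] HK [OF y] by blast
    ultimately show ?thesis
      unfolding H by (intro conjI exI [of _ "\<lambda>e. c e + c' e"])
  qed
  have H_minus: "- x \<in> H" if x: "x \<in> H" for x
  proof -
    obtain c where c: "\<forall>f\<in>S. poly_mapping.lookup x f = (\<Sum>e\<in>D. c e * N e f)"
      using HD [OF x] ..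
    then have "\<forall>f\<in>S. poly_mapping.lookup (- x) f = (\<Sum>e\<in>D. (- c e) * N e f)"
      by (simp add: sum_negf)
    moreover have "Poly_Mapping.keys (- x) \<subseteq> U"
      using HK [OF x] by simp
    ultimately show ?thesis
      unfolding H by (intro conjI exI [of _ "\<lambda>e. - c e"])
  qed
  have sub: "subgroup H ?G"
  proof (rule group.subgroupI [OF group_free_Abelian_group])
    show "H \<subseteq> carrier ?G"
      using HK by (intro subsetI) simp
    have "0 \<in> H"
      unfolding H by (intro conjI exI [of _ "\<lambda>_. 0"]) auto
    then show "H \<noteq> {}"
      by blast
    show "inv\<^bsub>?G\<^esub> x \<in> H" if "x \<in> H" for x
      using H_minus [OF that] HK [OF that] by simp
  qed (use H_add in auto)
  have coset: "x \<in> H #>\<^bsub>?G\<^esub> y \<longleftrightarrow> (\<exists>c. \<forall>f\<in>S. poly_mapping.lookup x f = poly_mapping.lookup y f + (\<Sum>e\<in>D. c e * N e f))"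
    if "x \<in> carrier ?G" "y \<in> carrier ?G" for x y
  proof -
    have "x \<in> H #>\<^bsub>?G\<^esub> y \<longleftrightarrow> x - y \<in> H"
      using that subgroup.rcos_module [OF sub group_free_Abelian_group that(2,1)] by simp
    moreover have "Poly_Mapping.keys (x - y) \<subseteq> U"
      using that keys_diff [of x y] by auto
    ultimately show ?thesis
      unfolding H by (simp add: lookup_minus algebra_simps)
  qed
  \<comment> \<open>Representatives are lifted with zero coordinates outside \<open>S\<close>, where
    \<open>H\<close> makes the choice immaterial.\<close>
  let ?h = "\<lambda>t. frag_sum S (\<lambda>f. t (inv_into {0..<m} eS f))"
  have finS: "finite S"
    using S U finite_subset by blast
  have h: "?h t \<in> carrier ?G" for t
    using keys_frag_sum [OF finS] S by fastforce
  have lookup_h: "poly_mapping.lookup (?h t) (eS i) = t i" if "i < m" for t i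
    using enumeration_inv(1,4) [OF eS that] by (simp add: lookup_frag_sum [OF finS])
  have coset': "x \<in> H #>\<^bsub>?G\<^esub> y \<longleftrightarrow>
      (\<exists>v. \<forall>i<m. poly_mapping.lookup x (eS i) = poly_mapping.lookup y (eS i) + (\<Sum>j<m. ?A i j * v j))"
    if "x \<in> carrier ?G" "y \<in> carrier ?G" for x y
  proof -
    have row: "(\<Sum>e\<in>D. c e * N e f) = (\<Sum>j<m. N (eD j) f * c (eD j))" for c f
      unfolding sum_enumeration [OF eD] by (simp add: mult.commute)
    show ?thesis
      unfolding coset [OF that]
    proof
      assume "\<exists>c. \<forall>f\<in>S. poly_mapping.lookup x f = poly_mapping.lookup y f + (\<Sum>e\<in>D. c e * N e f)"
      then obtain c where "\<forall>f\<in>S. poly_mapping.lookup x f = poly_mapping.lookup y f + (\<Sum>e\<in>D. c e * N e f)" ..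
      then have "poly_mapping.lookup x (eS i) = poly_mapping.lookup y (eS i) + (\<Sum>j<m. ?A i j * c (eD j))" if "i < m" for i
        using enumeration_inv(4) [OF eS that] unfolding row by blast
      then show "\<exists>v. \<forall>i<m. poly_mapping.lookup x (eS i) = poly_mapping.lookup y (eS i) + (\<Sum>j<m. ?A i j * v j)"
        by (intro exI [of _ "\<lambda>j. c (eD j)"] allI impI)
    next
      assume "\<exists>v. \<forall>i<m. poly_mapping.lookup x (eS i) = poly_mapping.lookup y (eS i) + (\<Sum>j<m. ?A i j * v j)"
      then obtain v where v: "\<And>i. i < m \<Longrightarrow>
          poly_mapping.lookup x (eS i) = poly_mapping.lookup y (eS i) + (\<Sum>j<m. ?A i j * v j)"
        by blast
      let ?c = "\<lambda>e. v (inv_into {0..<m} eD e)"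
      have "poly_mapping.lookup x f = poly_mapping.lookup y f + (\<Sum>e\<in>D. ?c e * N e f)" if "f \<in> S" for f
      proof -
        let ?i = "inv_into {0..<m} eS f"
        have i: "?i < m" "eS ?i = f"
          using enumeration_inv [OF eS] that by auto
        have "(\<Sum>j<m. ?A ?i j * v j) = (\<Sum>e\<in>D. ?c e * N e f)"
          unfolding row i(2) using enumeration_inv(1) [OF eD] by (intro sum.cong) auto
        then show ?thesis
          using v [OF i(1)] unfolding i(2) by simp
      qed
      then show "\<exists>c. \<forall>f\<in>S. poly_mapping.lookup x f = poly_mapping.lookup y f + (\<Sum>e\<in>D. c e * N e f)"
        by (intro exI [of _ ?c] ballI)
    qed
  qed
  note T' = T(1) [unfolded transversal_def]
  note finT = conjunct1 [OF T'] and exT = conjunct1 [OF conjunct2 [OF T'], THEN spec]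
  have uniqueT: "t = t'" if "t \<in> T" "t' \<in> T" "\<forall>i<m. t i = t' i + (\<Sum>j<m. ?A i j * v j)" for t t' v
    by (rule conjunct2 [OF conjunct2 [OF T'], THEN bspec, OF that(1), THEN bspec, OF that(2), THEN spec, THEN mp, OF that(3)])
  have ex: "\<exists>t\<in>T. x \<in> H #>\<^bsub>?G\<^esub> ?h t" if x: "x \<in> carrier ?G" for x
  proof -
    obtain t where t: "t \<in> T" "\<exists>v. \<forall>i<m. poly_mapping.lookup x (eS i) = t i + (\<Sum>j<m. ?A i j * v j)"
      using exT [of "\<lambda>i. poly_mapping.lookup x (eS i)"] ..
    obtain v where "\<forall>i<m. poly_mapping.lookup x (eS i) = t i + (\<Sum>j<m. ?A i j * v j)"
      using t(2) ..
    with t(1) show ?thesis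
      unfolding coset' [OF x h] using lookup_h by (intro bexI [of _ t] exI [of _ v]) auto
  qed
  have unique: "t = t'" if t: "t \<in> T" "t' \<in> T" and eq: "?h t \<in> H #>\<^bsub>?G\<^esub> ?h t'" for t t'
  proof -
    obtain v where "\<forall>i<m. poly_mapping.lookup (?h t) (eS i) = poly_mapping.lookup (?h t') (eS i) + (\<Sum>j<m. ?A i j * v j)"
      using eq unfolding coset' [OF h h] ..
    then have "\<forall>i<m. t i = t' i + (\<Sum>j<m. ?A i j * v j)"
      using lookup_h by simp
    with t show ?thesis
      by (intro uniqueT)
  qed
  show "finite (carrier (?G Mod H))" "order (?G Mod H) = nat \<bar>fdet m ?A\<bar>"
    using order_FactGroup_transversal [OF group_free_Abelian_group sub finT h ex unique] T(2) by simp_all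
qed

section \<open>Acyclizations\<close>

lemma lookup_frag_extend:
  assumes "finite A" "Poly_Mapping.keys b \<subseteq> A"
  shows "poly_mapping.lookup (frag_extend h b) x = (\<Sum>a\<in>A. poly_mapping.lookup b a * poly_mapping.lookup (h a) x)"
proof -
  have "poly_mapping.lookup (frag_extend h b) x
      = (\<Sum>a\<in>Poly_Mapping.keys b. poly_mapping.lookup b a * poly_mapping.lookup (h a) x)"
    by (simp add: frag_extend_def lookup_sum_frag)
  also have "\<dots> = (\<Sum>a\<in>A. poly_mapping.lookup b a * poly_mapping.lookup (h a) x)"
    using assms by (intro sum.mono_neutral_left) (auto simp: in_keys_iff)
  finally show ?thesis .
qed

lemma keys_subsetI: "(\<And>x. x \<notin> A \<Longrightarrow> poly_mapping.lookup b x = 0) \<Longrightarrow> Poly_Mapping.keys b \<subseteq> A"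
  by (metis in_keys_iff subsetI)

lemma lookup_eq_0_keys: "Poly_Mapping.keys b \<subseteq> A \<Longrightarrow> x \<notin> A \<Longrightarrow> poly_mapping.lookup b x = 0"
  by (metis in_keys_iff subsetD)

section \<open>Boundary and coboundary in coordinates\<close>

context finite_cw
begin

lemma lookup_bd:
  assumes "Poly_Mapping.keys b \<subseteq> cells_of X n"
  shows "poly_mapping.lookup (bd X b) f = (\<Sum>e\<in>cells_of X n. poly_mapping.lookup b e * incidence X e f)"
proof -
  have "poly_mapping.lookup (\<Sum>f\<in>cells X. frag_cmul (incidence X e f) (frag_of f)) f = incidence X e f"
    if "e \<in> cells_of X n" for e
  proof -
    have e: "e \<in> cells X"
      using that by (simp add: cells_of_def)
    have "f \<notin> cells X \<Longrightarrow> incidence X e f = 0"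
      using incidence_eq_0 [OF e, of f] by (auto simp: cells_of_def)
    then show ?thesis
      using lookup_frag_sum [OF finite_cells, of "incidence X e" f] by (auto simp: frag_sum_def)
  qed
  then show ?thesis
    unfolding bd_def lookup_frag_extend [OF finite_cells_of assms] by (intro sum.cong) auto
qed

lemma keys_bd:
  assumes "Poly_Mapping.keys b \<subseteq> cells_of X n"
  shows "Poly_Mapping.keys (bd X b) \<subseteq> cells_of X (n - 1)"
proof (rule keys_subsetI)
  fix f
  assume f: "f \<notin> cells_of X (n - 1)"
  have "incidence X e f = 0" if "e \<in> cells_of X n" for e
    using incidence_eq_0 [of e f] that f by (simp add: cells_of_def)
  then show "poly_mapping.lookup (bd X b) f = 0"
    unfolding lookup_bd [OF assms] by simp
qed

text \<open>The case distinction is there because the value of \<open>incidence\<close> at a label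
  that is not a cell is not controlled, whereas the transpose sums over cells only.\<close>

lemma lookup_bd_transpose:
  assumes "Poly_Mapping.keys c \<subseteq> cells_of X n"
  shows "poly_mapping.lookup (bd_transpose X c) e =
    (if e \<in> cells X then \<Sum>f\<in>cells_of X n. poly_mapping.lookup c f * incidence X e f else 0)"
  unfolding bd_transpose_def lookup_frag_extend [OF finite_cells_of assms]
  using lookup_frag_sum [OF finite_cells, of "\<lambda>e. incidence X e _" e, unfolded frag_sum_def] by simp

lemma keys_bd_transpose:
  assumes "Poly_Mapping.keys c \<subseteq> cells_of X n"
  shows "Poly_Mapping.keys (bd_transpose X c) \<subseteq> cells_of X (n + 1)"
proof (rule keys_subsetI)
  fix e
  assume e: "e \<notin> cells_of X (n + 1)"
  have "incidence X e f = 0" if "e \<in> cells X" "f \<in> cells_of X n" for f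
    using incidence_eq_0 [of e f] that e by (auto simp: cells_of_def)
  then show "poly_mapping.lookup (bd_transpose X c) e = 0"
    unfolding lookup_bd_transpose [OF assms] by simp
qed

text \<open>A closed cell adds to its open cell only points of skeleta of smaller dimension, and
  these contain no facet. Deleting facets therefore never removes part of a remaining closed
  cell.\<close>

lemma subcomplex_minus_facets:
  assumes S: "S \<subseteq> cells_of X (int d)" and dim: "\<And>e. e \<in> cells X \<Longrightarrow> cdim X e \<le> int d"
  shows "subcomplex X (cells X - S)"
  unfolding subcomplex_def
proof (intro conjI ballI)
  show "cells_of X (-1) \<subseteq> cells X - S"
    using S by (auto simp: cells_of_def)
  fix e
  assume e: "e \<in> cells X - S"
  have "skeleton_set X (cdim X e - 1) \<subseteq> (\<Union>f\<in>cells X - S. open_cell X f)"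
    using S dim [of e] e by (fastforce simp: skeleton_set_def cells_of_def)
  then show "closed_cell X e \<subseteq> (\<Union>f\<in>cells X - S. open_cell X f)"
    using closed_cell_subset [of e] e by blast
qed auto

end

text \<open>For the empty set of cells the correction term in \<open>rel_cell_boundaries\<close> has
  empty support, so a class in the trivial coset is literally a boundary.\<close>

lemma trivial_reduced_cellular_homology:
  assumes "trivial_group (reduced_cellular_homology i X)" and c: "c \<in> rel_cell_cycles X {} i"
  shows "\<exists>b. Poly_Mapping.keys b \<subseteq> cells_of X (i + 1) \<and> c = bd X b"
proof -
  let ?G = "subgroup_generated (cellular_chains X i) (rel_cell_cycles X {} i)"
  let ?H = "rel_cell_boundaries X {} i"
  have "c \<in> carrier ?G"
    using c by (auto simp: carrier_subgroup_generated rel_cell_cycles_def intro!: generate.incl)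
  then have "?H #>\<^bsub>?G\<^esub> c \<in> carrier (?G Mod ?H)"
    by (auto simp: carrier_FactGroup)
  then have "?H #>\<^bsub>?G\<^esub> c = ?H"
    using assms(1) by (auto simp: trivial_group_def rel_cellular_homology_def FactGroup_def)
  moreover have "0 \<in> ?H"
    unfolding rel_cell_boundaries_def
    by (rule CollectI, intro exI [of _ 0]) (simp add: bd_def cellular_chains_def)
  then have "c \<in> ?H #>\<^bsub>?G\<^esub> c"
    by (force simp: r_coset_def cellular_chains_def)
  ultimately have "c \<in> ?H"
    by simp
  then obtain b u where "c = bd X b + u" "Poly_Mapping.keys b \<subseteq> cells_of X (i + 1)" "Poly_Mapping.keys u \<subseteq> {}"
    by (auto simp: rel_cell_boundaries_def cellular_chains_def)
  then show ?thesis
    by auto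
qed

section \<open>Incidence numbers of complexes that agree in the sense of
  \<open>cw_eq\<close>\<close>

lemma cw_eq_skeleton:
  assumes "cw_eq (skeleton X n) Y"
  shows cw_eq_skeleton_cells: "cells Y = {e \<in> cells X. cdim X e \<le> n}"
    and cw_eq_skeleton_space: "cw_space Y = subtopology (cw_space X) (skeleton_set X n)"
    and cw_eq_skeleton_cdim: "e \<in> cells Y \<Longrightarrow> cdim Y e = cdim X e"
    and cw_eq_skeleton_char_map: "\<lbrakk>e \<in> cells Y; cdim X e \<ge> 0; x \<in> topspace (unit_disc (nat (cdim X e)))\<rbrakk>
      \<Longrightarrow> char_map Y e x = char_map X e x"
  using assms unfolding cw_eq_def skeleton_def by auto

context
  fixes X Y :: "('a, 'c) cw_complex" and n :: int
  assumes X: "finite_cw_complex X" and eq: "cw_eq (skeleton X n) Y"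
begin

interpretation finite_cw X
  by unfold_locales (rule X)

lemma cw_eq_cells_of: "i \<le> n \<Longrightarrow> cells_of Y i = cells_of X i"
  using cw_eq_skeleton_cells [OF eq] cw_eq_skeleton_cdim [OF eq] by (auto simp: cells_of_def)

lemma cw_eq_open_cell:
  assumes "e \<in> cells Y"
  shows "open_cell Y e = open_cell X e"
proof -
  have "char_map Y e ` disc_interior (nat (cdim X e)) = char_map X e ` disc_interior (nat (cdim X e))"
    if "cdim X e \<ge> 0"
    using cw_eq_skeleton_char_map [OF eq assms that]
    by (intro image_cong) (auto simp: topspace_unit_disc_Un)
  then show ?thesis
    using cw_eq_skeleton_cdim [OF eq assms] by (simp add: open_cell_def)
qed

lemma cw_eq_skeleton_set:
  assumes "i \<le> n"
  shows "skeleton_set Y i = skeleton_set X i"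
proof -
  have cY: "e \<in> cells Y \<longleftrightarrow> e \<in> cells X \<and> cdim X e \<le> n" for e
    by (simp add: cw_eq_skeleton_cells [OF eq])
  have "{e \<in> cells Y. cdim Y e \<le> i} = {e \<in> cells X. cdim X e \<le> i}"
  proof (rule Collect_cong)
    fix e
    show "e \<in> cells Y \<and> cdim Y e \<le> i \<longleftrightarrow> e \<in> cells X \<and> cdim X e \<le> i"
    proof (cases "e \<in> cells Y")
      case True
      with cY [of e] cw_eq_skeleton_cdim [OF eq True] show ?thesis
        by simp
    next
      case False
      with cY [of e] assms show ?thesis
        by auto
    qed
  qed
  moreover have "open_cell Y e = open_cell X e" if "e \<in> {e \<in> cells X. cdim X e \<le> i}" for e
    using that cY [of e] assms by (intro cw_eq_open_cell) auto
  ultimately show ?thesis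
    unfolding skeleton_set_def by (intro SUP_cong)
qed

lemma cw_eq_subtopology:
  "i \<le> n \<Longrightarrow> subtopology (cw_space Y) (skeleton_set Y i) = subtopology (cw_space X) (skeleton_set X i)"
  by (simp add: cw_eq_skeleton_set cw_eq_skeleton_space [OF eq] subtopology_skeleton)

lemma cw_eq_skeletal_homology: "i \<le> n \<Longrightarrow> skeletal_homology Y i = skeletal_homology X i"
  unfolding skeletal_homology_def by (simp add: cw_eq_subtopology) (simp add: cw_eq_skeleton_set)

text \<open>\<open>cw_eq\<close> controls characteristic maps on their discs only, and this suffices
  because induced maps in homology depend on nothing else.\<close>

lemma cw_eq_cell_class:
  assumes e: "e \<in> cells Y" "cdim X e \<ge> 0"
  shows "cell_class Y e = cell_class X e"
proof -
  have le: "cdim X e \<le> n"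
    using e cw_eq_skeleton_cells [OF eq] by auto
  have "hom_induced p (unit_disc (nat (cdim X e))) S Z T (char_map Y e) =
      hom_induced p (unit_disc (nat (cdim X e))) S Z T (char_map X e)" for p S Z T
    by (rule hom_induced_eq) (rule cw_eq_skeleton_char_map [OF eq e])
  moreover have "skeleton_set Y (cdim X e - 1) = skeleton_set X (cdim X e - 1)"
    using le by (intro cw_eq_skeleton_set) simp
  ultimately show ?thesis
    unfolding cell_class_def cw_eq_skeleton_cdim [OF eq e(1)] cw_eq_subtopology [OF le] by simp
qed

text \<open>In positive dimensions skeleta, cell classes and skeletal homology agree up to dimension
  \<open>n\<close>, so the two definite descriptions become the same. This lets forests of \<Sigma>
  be studied with the boundary matrices of \<Omega>.\<close>

lemma cw_eq_incidence:
  assumes e: "e \<in> cells Y"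
  shows "incidence Y e = incidence X e"
proof -
  let ?m = "cdim X e"
  have m: "?m \<le> n"
    using e cw_eq_skeleton_cells [OF eq] by auto
  note dim = cw_eq_skeleton_cdim [OF eq e]
  consider "?m \<ge> 1" | "?m = 0" | "?m < 0" by linarith
  then show ?thesis
  proof cases
    case 1
    let ?G = "skeletal_homology X (?m - 1)"
    interpret comm_group ?G by simp
    have prod: "(\<Otimes>\<^bsub>?G\<^esub>f\<in>cells_of X (?m - 1). cell_class Y f [^]\<^bsub>?G\<^esub> (a f :: int)) =
        (\<Otimes>\<^bsub>?G\<^esub>f\<in>cells_of X (?m - 1). cell_class X f [^]\<^bsub>?G\<^esub> a f)" for a
    proof (rule finprod_cong' [OF refl])
      fix f
      assume f: "f \<in> cells_of X (?m - 1)"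
      then have "f \<in> cells Y" "cdim X f \<ge> 0"
        using cw_eq_skeleton_cells [OF eq] m 1 by (auto simp: cells_of_def)
      then show "cell_class Y f [^]\<^bsub>?G\<^esub> a f = cell_class X f [^]\<^bsub>?G\<^esub> a f"
        using cw_eq_cell_class by simp
    qed (use cell_class_carrier in auto)
    have G: "skeletal_homology Y (?m - 1) = ?G"
      and C: "cells_of Y (?m - 1) = cells_of X (?m - 1)"
      and sk: "skeleton_set Y (?m - 1) = skeleton_set X (?m - 1)" "skeleton_set Y (?m - 2) = skeleton_set X (?m - 2)"
      and cl: "cell_class Y e = cell_class X e"
      using m 1 e by (simp_all add: cw_eq_skeletal_homology cw_eq_cells_of cw_eq_skeleton_set cw_eq_cell_class)
    note sub = cw_eq_subtopology [OF m]
    show ?thesis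
      unfolding incidence_def Let_def dim G C sub sk cl prod using 1 by simp
  next
    case 2
    then have "cells_of Y (-1) = cells_of X (-1)"
      using m by (intro cw_eq_cells_of) simp
    with 2 dim show ?thesis
      by (simp add: incidence_def fun_eq_iff)
  next
    case 3
    with dim show ?thesis
      by (simp add: incidence_def)
  qed
qed

end

section \<open>Forests and group orders in an acyclization\<close>

locale acyclic_extension =
  fixes d :: nat and \<Sigma> \<Omega> :: "('a, 'c) cw_complex"
  assumes finite_cw_\<Sigma>: "finite_cw_complex \<Sigma>" and acyclization: "acyclization d \<Sigma> \<Omega>"
begin

lemma finite_cw_\<Omega>: "finite_cw_complex \<Omega>"
  and cdim_le: "e \<in> cells \<Omega> \<Longrightarrow> cdim \<Omega> e \<le> int d + 1"
  and skeleton_eq: "cw_eq (skeleton \<Omega> (int d)) \<Sigma>"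
  and trivial_top: "trivial_group (reduced_cellular_homology (int d + 1) \<Omega>)"
  and trivial_next: "trivial_group (reduced_cellular_homology (int d) \<Omega>)"
  using acyclization by (simp_all add: acyclization_def)

sublocale finite_cw \<Omega>
  by unfold_locales (rule finite_cw_\<Omega>)

abbreviation C :: "'c set" where "C \<equiv> cells_of \<Omega> (int d + 1)"
abbreviation R :: "'c set" where "R \<equiv> cells_of \<Omega> (int d)"

lemma no_cells_above: "cells_of \<Omega> (int d + 1 + 1) = {}"
  using cdim_le by (fastforce simp: cells_of_def)

text \<open>Injectivity is the vanishing of homology in degree d+1, where the absence of (d+2)-cells
  leaves no boundaries; exactness is its vanishing in degree d. Both matrices are values of the same
  function \<open>incidence\<close>, taken on different pairs of dimensions.\<close>

sublocale exact_boundary_pair C R "incidence \<Omega>" "incidence \<Omega>"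
proof
  fix c x
  assume c: "\<forall>f\<in>R. (\<Sum>e\<in>C. c e * incidence \<Omega> e f) = 0" and x: "x \<in> C"
  let ?b = "frag_sum C c"
  have keys: "Poly_Mapping.keys ?b \<subseteq> C"
    by (rule keys_frag_sum) simp
  have "poly_mapping.lookup (bd \<Omega> ?b) f = 0" for f
  proof (cases "f \<in> R")
    case True
    with c show ?thesis
      unfolding lookup_bd [OF keys] by (simp add: lookup_frag_sum)
  next
    case False
    with keys_bd [OF keys] show ?thesis
      by (intro lookup_eq_0_keys) simp_all
  qed
  then have "bd \<Omega> ?b = 0"
    by (intro poly_mapping_eqI) simp
  with keys have "?b \<in> rel_cell_cycles \<Omega> {} (int d + 1)"
    by (simp add: rel_cell_cycles_def cellular_chains_def)
  then obtain b' where "Poly_Mapping.keys b' \<subseteq> {}" "?b = bd \<Omega> b'"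
    using trivial_reduced_cellular_homology [OF trivial_top] unfolding no_cells_above by blast
  then have "?b = 0"
    by (simp add: bd_def)
  then have "poly_mapping.lookup ?b x = 0"
    by simp
  with x show "c x = 0"
    by (simp add: lookup_frag_sum)
next
  fix e g
  assume "e \<in> C"
  then show "(\<Sum>f\<in>R. incidence \<Omega> e f * incidence \<Omega> f g) = 0"
    using incidence_incidence [of e g] sum_incidence_cells_of [of e "\<lambda>f. incidence \<Omega> f g"]
    by (simp add: cells_of_def)
next
  fix z
  assume z: "\<forall>g. (\<Sum>f\<in>R. z f * incidence \<Omega> f g) = 0"
  let ?b = "frag_sum R z"
  have keys: "Poly_Mapping.keys ?b \<subseteq> R"
    by (rule keys_frag_sum) simp
  have "bd \<Omega> ?b = 0"
    by (rule poly_mapping_eqI) (use z in \<open>simp add: lookup_bd [OF keys] lookup_frag_sum\<close>)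
  with keys have "?b \<in> rel_cell_cycles \<Omega> {} (int d)"
    by (simp add: rel_cell_cycles_def cellular_chains_def)
  then obtain b where b: "Poly_Mapping.keys b \<subseteq> C" "?b = bd \<Omega> b"
    using trivial_reduced_cellular_homology [OF trivial_next] by blast
  have "z f = (\<Sum>e\<in>C. poly_mapping.lookup b e * incidence \<Omega> e f)" if "f \<in> R" for f
    using lookup_bd [OF b(1), of f] that by (simp add: lookup_frag_sum flip: b(2))
  then show "\<exists>c. \<forall>f\<in>R. z f = (\<Sum>e\<in>C. c e * incidence \<Omega> e f)"
    by (intro exI [of _ "poly_mapping.lookup b"] ballI)
qed simp_all

lemma cells_\<Sigma>: "cells \<Sigma> = {e \<in> cells \<Omega>. cdim \<Omega> e \<le> int d}"
  by (rule cw_eq_skeleton_cells [OF skeleton_eq])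

lemma R_subset: "R \<subseteq> cells \<Sigma>"
  by (auto simp: cells_\<Sigma> cells_of_def)

definition basis_complement :: "'c set \<Rightarrow> bool" where
  "basis_complement S \<longleftrightarrow> S \<subseteq> R \<and> inj_on column (R - S) \<and> real_fun.independent (column ` (R - S)) \<and>
     real_fun.span (column ` (R - S)) = real_fun.span (column ` R)"

text \<open>A forest contains every cell below dimension d, so it is determined by the set
  \<open>S\<close> of facets that it omits. Conversely, omitting facets always leaves a subcomplex,
  and only the basis condition restricts \<open>S\<close>.\<close>

lemma cellular_spanning_forest_iff:
  "cellular_spanning_forest d \<Sigma> T \<longleftrightarrow> (\<exists>S. basis_complement S \<and> T = cells \<Sigma> - S)"
proof -
  have facets: "cells_of \<Sigma> (int d) = R"
    by (rule cw_eq_cells_of [OF finite_cw_\<Omega> skeleton_eq]) simp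
  have dim: "cdim \<Sigma> e = cdim \<Omega> e" if "e \<in> cells \<Sigma>" for e
    by (rule cw_eq_skeleton_cdim [OF skeleton_eq that])
  have col: "bd_column \<Sigma> e = column e" if "e \<in> R" for e
    using cw_eq_incidence [OF finite_cw_\<Omega> skeleton_eq, of e] that R_subset by (auto simp: bd_column_def)
  have basis: "(inj_on (bd_column \<Sigma>) B \<and> real_fun.independent (bd_column \<Sigma> ` B) \<and>
       real_fun.span (bd_column \<Sigma> ` B) = real_fun.span (bd_column \<Sigma> ` R)) \<longleftrightarrow>
      (inj_on column B \<and> real_fun.independent (column ` B) \<and>
       real_fun.span (column ` B) = real_fun.span (column ` R))" if "B \<subseteq> R" for B
  proof -
    have "bd_column \<Sigma> ` B = column ` B" "bd_column \<Sigma> ` R = column ` R"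
      using col that by (auto intro!: image_cong)
    moreover have "inj_on (bd_column \<Sigma>) B \<longleftrightarrow> inj_on column B"
      using col that by (intro inj_on_cong) auto
    ultimately show ?thesis
      by (simp only:)
  qed
  show ?thesis
  proof
    assume T: "cellular_spanning_forest d \<Sigma> T"
    then have sub: "T \<subseteq> cells \<Sigma>"
      and low: "{e \<in> T. cdim \<Sigma> e \<le> int d - 1} = {e \<in> cells \<Sigma>. cdim \<Sigma> e \<le> int d - 1}"
      by (auto simp: cellular_spanning_forest_def subcomplex_def)
    have RT: "R - (R - T) = R \<inter> T"
      by auto
    have "basis_complement (R - T)"
      using T basis [of "R \<inter> T"] unfolding basis_complement_def RT cellular_spanning_forest_def facets
      by blast
    moreover have "T = cells \<Sigma> - (R - T)"
    proof
      show "T \<subseteq> cells \<Sigma> - (R - T)"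
        using sub by blast
      show "cells \<Sigma> - (R - T) \<subseteq> T"
      proof
        fix e
        assume e: "e \<in> cells \<Sigma> - (R - T)"
        show "e \<in> T"
        proof (rule ccontr)
          assume "e \<notin> T"
          with e have "e \<notin> R" "e \<in> cells \<Sigma>"
            by auto
          then have "cdim \<Sigma> e \<le> int d - 1"
            using dim [of e] by (auto simp: cells_\<Sigma> cells_of_def)
          with \<open>e \<in> cells \<Sigma>\<close> low \<open>e \<notin> T\<close> show False
            by blast
        qed
      qed
    qed
    ultimately show "\<exists>S. basis_complement S \<and> T = cells \<Sigma> - S"
      by blast
  next
    assume "\<exists>S. basis_complement S \<and> T = cells \<Sigma> - S"
    then obtain S where S: "basis_complement S" and T: "T = cells \<Sigma> - S"
      by blast
    then have SR: "S \<subseteq> R"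
      by (simp add: basis_complement_def)
    interpret \<Sigma>: finite_cw \<Sigma>
      by unfold_locales (rule finite_cw_\<Sigma>)
    have "subcomplex \<Sigma> T"
      unfolding T using SR dim by (intro \<Sigma>.subcomplex_minus_facets [of _ d]) (auto simp: facets cells_\<Sigma>)
    moreover have "{e \<in> T. cdim \<Sigma> e \<le> int d - 1} = {e \<in> cells \<Sigma>. cdim \<Sigma> e \<le> int d - 1}"
      using SR dim unfolding T by (auto simp: cells_of_def)
    moreover have "R \<inter> T = R - S"
      using R_subset unfolding T by auto
    ultimately show "cellular_spanning_forest d \<Sigma> T"
      using S basis [of "R - S"] unfolding cellular_spanning_forest_def facets basis_complement_def
      by auto
  qed
qed

definition facet_enum :: "nat \<Rightarrow> 'c" where
  "facet_enum = (SOME e. bij_betw e {0..<card C} C)"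

definition row_enum :: "'c set \<Rightarrow> nat \<Rightarrow> 'c" where
  "row_enum S = (SOME e. bij_betw e {0..<card S} S)"

lemma bij_facet_enum: "bij_betw facet_enum {0..<card C} C"
  unfolding facet_enum_def using ex_bij_betw_nat_finite [OF finite_C] by (rule someI_ex)

lemma bij_row_enum:
  assumes "S \<subseteq> R"
  shows "bij_betw (row_enum S) {0..<card S} S"
proof -
  have "finite S"
    using assms finite_R finite_subset by blast
  from ex_bij_betw_nat_finite [OF this] show ?thesis
    unfolding row_enum_def by (rule someI_ex)
qed

text \<open>Rows are the d-cells in \<open>S\<close>, columns the (d+1)-cells. The sign depends on
  the chosen enumerations; only the absolute value, the square and the vanishing of the minor enter
  the argument.\<close>

definition minor :: "'c set \<Rightarrow> int" where
  "minor S = fdet (card C) (\<lambda>i j. incidence \<Omega> (facet_enum j) (row_enum S i))"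

lemma basis_complement_iff:
  "basis_complement S \<longleftrightarrow> S \<subseteq> R \<and> card S = card C \<and> minor S \<noteq> 0"
proof (cases "S \<subseteq> R")
  case True
  have "card S = card C \<Longrightarrow> bij_betw (row_enum S) {0..<card C} S"
    using bij_row_enum [OF True] by simp
  from basis_iff_minor [OF True bij_facet_enum this] True show ?thesis
    by (simp add: basis_complement_def minor_def)
qed (simp add: basis_complement_def)

text \<open>The forest contains all (d-1)-cells, so every d-chain is a relative cycle. Relative
  boundaries are arbitrary on the facets of the forest, and on the omitted facets \<open>S\<close>
  they form the image of the square matrix with rows \<open>S\<close>.\<close>

lemma relative_homology_order:
  assumes S: "basis_complement S"
  shows "finite (carrier (rel_cellular_homology (int d) \<Omega> (cells \<Sigma> - S)))"
    and "order (rel_cellular_homology (int d) \<Omega> (cells \<Sigma> - S)) = nat \<bar>minor S\<bar>"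
proof -
  let ?T = "cells \<Sigma> - S"
  have SR: "S \<subseteq> R" and card: "card S = card C" and nz: "minor S \<noteq> 0"
    using S by (simp_all add: basis_complement_iff)
  have bijS: "bij_betw (row_enum S) {0..<card C} S"
    using bij_row_enum [OF SR] card by simp
  have low: "cells_of \<Omega> (int d - 1) \<subseteq> ?T"
    using SR by (auto simp: cells_\<Sigma> cells_of_def)
  have RT: "R \<inter> ?T = R - S"
    using R_subset by auto
  have "rel_cell_cycles \<Omega> ?T (int d) = carrier (free_Abelian_group R)"
    unfolding rel_cell_cycles_def cellular_chains_def Int_absorb2 [OF low]
    by (intro subset_antisym subsetI) (simp_all add: keys_bd)
  then have eq: "rel_cellular_homology (int d) \<Omega> ?T = free_Abelian_group R Mod rel_cell_boundaries \<Omega> ?T (int d)"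
    by (simp add: rel_cellular_homology_def cellular_chains_def group.subgroup_generated_group_carrier)
  have H: "x \<in> rel_cell_boundaries \<Omega> ?T (int d) \<longleftrightarrow> Poly_Mapping.keys x \<subseteq> R \<and>
      (\<exists>c. \<forall>f\<in>S. poly_mapping.lookup x f = (\<Sum>e\<in>C. c e * incidence \<Omega> e f))" (is "_ \<longleftrightarrow> ?P") for x
  proof
    assume "x \<in> rel_cell_boundaries \<Omega> ?T (int d)"
    then obtain b u where x: "x = bd \<Omega> b + u" and b: "Poly_Mapping.keys b \<subseteq> C"
        and u: "Poly_Mapping.keys u \<subseteq> R \<inter> ?T"
      unfolding rel_cell_boundaries_def cellular_chains_def by auto
    have "Poly_Mapping.keys x \<subseteq> R"
      using Poly_Mapping.keys_add [of "bd \<Omega> b" u] keys_bd [OF b] u unfolding x by auto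
    moreover have "poly_mapping.lookup x f = (\<Sum>e\<in>C. poly_mapping.lookup b e * incidence \<Omega> e f)" if "f \<in> S" for f
      using lookup_eq_0_keys [OF u, of f] that by (simp add: x lookup_add lookup_bd [OF b])
    ultimately show ?P
      by (intro conjI exI [of _ "poly_mapping.lookup b"] ballI)
  next
    assume P: ?P
    then obtain c where c: "\<forall>f\<in>S. poly_mapping.lookup x f = (\<Sum>e\<in>C. c e * incidence \<Omega> e f)"
      by (elim conjE exE)
    let ?b = "frag_sum C c"
    have b: "Poly_Mapping.keys ?b \<subseteq> C"
      by (rule keys_frag_sum) simp
    \<comment> \<open>The remainder serves as the chain on the forest: it vanishes on
      \<open>S\<close> by the choice of \<open>c\<close>, and outside \<open>R\<close> because both
      terms do.\<close>
    have "Poly_Mapping.keys (x - bd \<Omega> ?b) \<subseteq> R \<inter> ?T"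
      unfolding RT
    proof (rule keys_subsetI)
      fix f
      assume f: "f \<notin> R - S"
      show "poly_mapping.lookup (x - bd \<Omega> ?b) f = 0"
      proof (cases "f \<in> S")
        case True
        with c show ?thesis
          by (simp add: lookup_minus lookup_bd [OF b] lookup_frag_sum)
      next
        case False
        with f have "f \<notin> R"
          by simp
        then have "poly_mapping.lookup x f = 0" "poly_mapping.lookup (bd \<Omega> ?b) f = 0"
          using P keys_bd [OF b] by (auto intro!: lookup_eq_0_keys [of _ R])
        then show ?thesis
          by (simp add: lookup_minus)
      qed
    qed
    moreover have "x = bd \<Omega> ?b + (x - bd \<Omega> ?b)"
      by simp
    ultimately show "x \<in> rel_cell_boundaries \<Omega> ?T (int d)"
      unfolding rel_cell_boundaries_def cellular_chains_def mem_Collect_eq using b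
      by (intro exI [of _ ?b] exI [of _ "x - bd \<Omega> ?b"] conjI) simp_all
  qed
  show "finite (carrier (rel_cellular_homology (int d) \<Omega> ?T))"
    "order (rel_cellular_homology (int d) \<Omega> ?T) = nat \<bar>minor S\<bar>"
    using order_free_Abelian_group_Mod [OF finite_R SR bij_facet_enum bijS _ H] nz
    unfolding eq minor_def by simp_all
qed

text \<open>Without (d+2)-cells every cochain in degree d+1 is a cocycle. The relative d-cochains
  live on the omitted facets, so the coboundaries are the image of the transposed square
  matrix.\<close>

lemma relative_cohomology_order:
  assumes S: "basis_complement S"
  shows "finite (carrier (rel_cellular_cohomology (int d + 1) \<Omega> (cells \<Sigma> - S)))"
    and "order (rel_cellular_cohomology (int d + 1) \<Omega> (cells \<Sigma> - S)) = nat \<bar>minor S\<bar>"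
proof -
  let ?T = "cells \<Sigma> - S"
  have SR: "S \<subseteq> R" and card: "card S = card C" and nz: "minor S \<noteq> 0"
    using S by (simp_all add: basis_complement_iff)
  have bijS: "bij_betw (row_enum S) {0..<card C} S"
    using bij_row_enum [OF SR] card by simp
  have CT: "C - ?T = C"
    by (auto simp: cells_\<Sigma> cells_of_def)
  have RT: "R - ?T = S"
    using R_subset SR by auto
  have top: "bd_transpose \<Omega> c = 0" if "Poly_Mapping.keys c \<subseteq> C" for c
    using keys_bd_transpose [OF that] no_cells_above by simp
  have "{c \<in> carrier (rel_cochains \<Omega> ?T (int d + 1)). bd_transpose \<Omega> c = 0} = carrier (free_Abelian_group C)"
    using top by (auto simp: rel_cochains_def CT)
  then have eq: "rel_cellular_cohomology (int d + 1) \<Omega> ?T =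
      free_Abelian_group C Mod bd_transpose \<Omega> ` carrier (free_Abelian_group S)"
    by (simp add: rel_cellular_cohomology_def rel_cochains_def CT RT group.subgroup_generated_group_carrier)
  have lookup: "poly_mapping.lookup (bd_transpose \<Omega> c) e = (\<Sum>f\<in>S. poly_mapping.lookup c f * incidence \<Omega> e f)"
    if c: "Poly_Mapping.keys c \<subseteq> S" and e: "e \<in> C" for c e
  proof -
    have "poly_mapping.lookup (bd_transpose \<Omega> c) e = (\<Sum>f\<in>R. poly_mapping.lookup c f * incidence \<Omega> e f)"
      using lookup_bd_transpose [of c "int d" e] c SR e by (auto simp: cells_of_def)
    also have "\<dots> = (\<Sum>f\<in>S. poly_mapping.lookup c f * incidence \<Omega> e f)"
      using SR finite_R lookup_eq_0_keys [OF c] by (intro sum.mono_neutral_right) auto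
    finally show ?thesis .
  qed
  have H: "x \<in> bd_transpose \<Omega> ` carrier (free_Abelian_group S) \<longleftrightarrow> Poly_Mapping.keys x \<subseteq> C \<and>
      (\<exists>c. \<forall>e\<in>C. poly_mapping.lookup x e = (\<Sum>f\<in>S. c f * incidence \<Omega> e f))" (is "_ \<longleftrightarrow> ?P") for x
  proof
    assume "x \<in> bd_transpose \<Omega> ` carrier (free_Abelian_group S)"
    then obtain c where c: "Poly_Mapping.keys c \<subseteq> S" and x: "x = bd_transpose \<Omega> c"
      by auto
    have "Poly_Mapping.keys x \<subseteq> C"
      using keys_bd_transpose [of c "int d"] c SR unfolding x by auto
    with lookup [OF c] show ?P
      unfolding x by (intro conjI exI [of _ "poly_mapping.lookup c"] ballI)
  next
    assume P: ?P
    then obtain c where c: "\<forall>e\<in>C. poly_mapping.lookup x e = (\<Sum>f\<in>S. c f * incidence \<Omega> e f)"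
      by (elim conjE exE)
    have finS: "finite S"
      using SR finite_R finite_subset by blast
    let ?c = "frag_sum S c"
    have keys: "Poly_Mapping.keys ?c \<subseteq> S"
      by (rule keys_frag_sum [OF finS])
    have "x = bd_transpose \<Omega> ?c"
    proof (rule poly_mapping_eqI)
      fix e
      show "poly_mapping.lookup x e = poly_mapping.lookup (bd_transpose \<Omega> ?c) e"
      proof (cases "e \<in> C")
        case True
        with c show ?thesis
          by (simp add: lookup [OF keys] lookup_frag_sum [OF finS])
      next
        case False
        have "Poly_Mapping.keys (bd_transpose \<Omega> ?c) \<subseteq> C"
          using keys_bd_transpose [of ?c "int d"] keys SR by auto
        with P False show ?thesis
          by (simp add: lookup_eq_0_keys [of _ C])
      qed
    qed
    with keys show "x \<in> bd_transpose \<Omega> ` carrier (free_Abelian_group S)"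
      by (intro image_eqI [of _ _ ?c]) simp_all
  qed
  have det: "fdet (card C) (\<lambda>i j. incidence \<Omega> (facet_enum i) (row_enum S j)) = minor S"
    unfolding minor_def by (rule fdet_transpose)
  show "finite (carrier (rel_cellular_cohomology (int d + 1) \<Omega> ?T))"
    "order (rel_cellular_cohomology (int d + 1) \<Omega> ?T) = nat \<bar>minor S\<bar>"
    using order_free_Abelian_group_Mod [OF finite_C subset_refl bijS bij_facet_enum _ H] nz
    unfolding eq det by simp_all
qed

text \<open>The matrix of the boundary followed by its transpose on chains of degree d+1.\<close>

definition gram :: "'c \<Rightarrow> 'c \<Rightarrow> int" where
  "gram e e' = (\<Sum>f\<in>R. incidence \<Omega> e f * incidence \<Omega> e' f)"

lemma gram_det:
  "fdet (card C) (\<lambda>i j. gram (facet_enum j) (facet_enum i)) = (\<Sum>S | S \<subseteq> R \<and> card S = card C. (minor S)\<^sup>2)"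
proof -
  have "fdet (card C) (\<lambda>i j. gram (facet_enum j) (facet_enum i)) =
      fdet (card C) (\<lambda>i j. \<Sum>f\<in>R. incidence \<Omega> (facet_enum i) f * incidence \<Omega> (facet_enum j) f)"
    by (simp add: gram_def mult.commute)
  also have "\<dots> = (\<Sum>S | S \<subseteq> R \<and> card S = card C. minor S * minor S)"
    unfolding minor_def
  proof (rule Cauchy_Binet [OF finite_R, where en = row_enum])
    fix S
    assume "S \<subseteq> R" "card S = card C"
    then show "bij_betw (row_enum S) {0..<card C} S"
      using bij_row_enum [of S] by simp
  qed
  finally show ?thesis
    by (simp add: power2_eq_square)
qed

text \<open>If the Gram matrix kills \<open>v\<close>, then pairing with \<open>v\<close> gives a
  vanishing sum of squares, namely of the coordinates of the boundary of \<open>v\<close>;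
  injectivity of the top boundary map then gives \<open>v = 0\<close>. The argument does not
  presuppose that a nonzero minor, hence a forest, exists.\<close>

lemma gram_det_nonzero: "fdet (card C) (\<lambda>i j. gram (facet_enum j) (facet_enum i)) \<noteq> 0"
proof
  let ?m = "card C"
  assume "fdet ?m (\<lambda>i j. gram (facet_enum j) (facet_enum i)) = 0"
  then obtain v where vg: "(\<exists>j<?m. v j \<noteq> 0) \<and> (\<forall>i<?m. (\<Sum>j<?m. gram (facet_enum j) (facet_enum i) * v j) = 0)"
    unfolding fdet_eq_0_iff ..
  note v = conjunct1 [OF vg] and g = conjunct2 [OF vg]
  let ?w = "\<lambda>f. \<Sum>j<?m. v j * incidence \<Omega> (facet_enum j) f"
  have "(\<Sum>f\<in>R. ?w f * ?w f) = (\<Sum>f\<in>R. \<Sum>i<?m. \<Sum>j<?m. v i * (incidence \<Omega> (facet_enum j) f * incidence \<Omega> (facet_enum i) f * v j))"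
    by (simp add: sum_product mult_ac)
  also have "\<dots> = (\<Sum>i<?m. \<Sum>f\<in>R. \<Sum>j<?m. v i * (incidence \<Omega> (facet_enum j) f * incidence \<Omega> (facet_enum i) f * v j))"
    by (rule sum.swap)
  also have "\<dots> = (\<Sum>i<?m. \<Sum>j<?m. \<Sum>f\<in>R. v i * (incidence \<Omega> (facet_enum j) f * incidence \<Omega> (facet_enum i) f * v j))"
    by (intro sum.cong refl sum.swap)
  also have "\<dots> = (\<Sum>i<?m. v i * (\<Sum>j<?m. gram (facet_enum j) (facet_enum i) * v j))"
    by (simp add: gram_def sum_distrib_left sum_distrib_right mult_ac)
  also have "\<dots> = 0"
    using g by simp
  finally have "\<forall>f\<in>R. ?w f * ?w f = 0"
    by (subst (asm) sum_nonneg_eq_0_iff) (auto simp: finite_R)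
  then have w: "\<forall>f\<in>R. ?w f = 0"
    by simp
  let ?c = "\<lambda>e. v (inv_into {0..<?m} facet_enum e)"
  have "(\<Sum>e\<in>C. ?c e * incidence \<Omega> e f) = ?w f" for f
    unfolding sum_enumeration [OF bij_facet_enum] using enumeration_inv(1) [OF bij_facet_enum]
    by (intro sum.cong) auto
  then have c: "\<forall>f\<in>R. (\<Sum>e\<in>C. ?c e * incidence \<Omega> e f) = 0"
    using w by simp
  have "v j = 0" if "j < ?m" for j
    using injective [OF c enumeration_inv(4) [OF bij_facet_enum that]]
      enumeration_inv(1) [OF bij_facet_enum that] by simp
  with v show False
    by blast
qed

lemma cocritical_order:
  shows "finite (carrier (cocritical_group d \<Omega>))"
    and "order (cocritical_group d \<Omega>) = nat \<bar>fdet (card C) (\<lambda>i j. gram (facet_enum j) (facet_enum i))\<bar>"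
proof -
  let ?h = "\<lambda>c. bd_transpose \<Omega> (bd \<Omega> c)"
  have keys: "Poly_Mapping.keys (?h b) \<subseteq> C" if "Poly_Mapping.keys b \<subseteq> C" for b
    using keys_bd_transpose [of "bd \<Omega> b" "int d"] keys_bd [OF that] by simp
  have lookup: "poly_mapping.lookup (?h b) e' = (\<Sum>e\<in>C. poly_mapping.lookup b e * gram e e')"
    if b: "Poly_Mapping.keys b \<subseteq> C" and e': "e' \<in> C" for b e'
  proof -
    have "Poly_Mapping.keys (bd \<Omega> b) \<subseteq> R"
      using keys_bd [OF b] by simp
    then have "poly_mapping.lookup (?h b) e' = (\<Sum>f\<in>R. poly_mapping.lookup (bd \<Omega> b) f * incidence \<Omega> e' f)"
      using e' by (simp add: lookup_bd_transpose) (simp add: cells_of_def)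
    also have "\<dots> = (\<Sum>f\<in>R. \<Sum>e\<in>C. poly_mapping.lookup b e * (incidence \<Omega> e f * incidence \<Omega> e' f))"
      by (simp add: lookup_bd [OF b] sum_distrib_right mult.assoc)
    also have "\<dots> = (\<Sum>e\<in>C. \<Sum>f\<in>R. poly_mapping.lookup b e * (incidence \<Omega> e f * incidence \<Omega> e' f))"
      by (rule sum.swap)
    finally show ?thesis
      by (simp add: gram_def sum_distrib_left)
  qed
  have H: "x \<in> ?h ` carrier (cellular_chains \<Omega> (int d + 1)) \<longleftrightarrow> Poly_Mapping.keys x \<subseteq> C \<and>
      (\<exists>c. \<forall>e'\<in>C. poly_mapping.lookup x e' = (\<Sum>e\<in>C. c e * gram e e'))" (is "_ \<longleftrightarrow> ?P") for x
  proof
    assume "x \<in> ?h ` carrier (cellular_chains \<Omega> (int d + 1))"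
    then obtain b where b: "Poly_Mapping.keys b \<subseteq> C" and x: "x = ?h b"
      by (auto simp: cellular_chains_def)
    with keys [OF b] lookup [OF b] show ?P
      unfolding x by (intro conjI exI [of _ "poly_mapping.lookup b"] ballI)
  next
    assume P: ?P
    then obtain c where c: "\<forall>e'\<in>C. poly_mapping.lookup x e' = (\<Sum>e\<in>C. c e * gram e e')"
      by (elim conjE exE)
    let ?b = "frag_sum C c"
    have b: "Poly_Mapping.keys ?b \<subseteq> C"
      by (rule keys_frag_sum [OF finite_C])
    have "x = ?h ?b"
    proof (rule poly_mapping_eqI)
      fix e'
      show "poly_mapping.lookup x e' = poly_mapping.lookup (?h ?b) e'"
      proof (cases "e' \<in> C")
        case True
        with c show ?thesis
          by (simp add: lookup [OF b] lookup_frag_sum [OF finite_C])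
      next
        case False
        with P keys [OF b] show ?thesis
          by (simp add: lookup_eq_0_keys [of _ C])
      qed
    qed
    with b show "x \<in> ?h ` carrier (cellular_chains \<Omega> (int d + 1))"
      by (intro image_eqI [of _ _ ?b]) (simp_all add: cellular_chains_def)
  qed
  have eq: "cocritical_group d \<Omega> = free_Abelian_group C Mod ?h ` carrier (cellular_chains \<Omega> (int d + 1))"
    by (simp add: cocritical_group_def cellular_chains_def)
  show "finite (carrier (cocritical_group d \<Omega>))"
    "order (cocritical_group d \<Omega>) = nat \<bar>fdet (card C) (\<lambda>i j. gram (facet_enum j) (facet_enum i))\<bar>"
    using order_free_Abelian_group_Mod [OF finite_C subset_refl bij_facet_enum bij_facet_enum gram_det_nonzero H]
    unfolding eq by simp_all
qed

text \<open>\<open>g\<close> stands for the order of either relative group, as only its value in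
  terms of minors matters. Integer squares absorb the signs of the minors, and the bijection between
  forests and omitted facets reindexes the sum.\<close>

lemma sum_over_forests:
  assumes "\<And>S. basis_complement S \<Longrightarrow> g (cells \<Sigma> - S) = nat \<bar>minor S\<bar>"
  shows "order (cocritical_group d \<Omega>) = (\<Sum>\<Upsilon> | cellular_spanning_forest d \<Sigma> \<Upsilon>. (g \<Upsilon>)\<^sup>2)"
proof -
  let ?h = "\<lambda>S. cells \<Sigma> - S"
  have forests: "{\<Upsilon>. cellular_spanning_forest d \<Sigma> \<Upsilon>} = ?h ` {S. basis_complement S}"
    unfolding cellular_spanning_forest_iff by blast
  have inj: "inj_on ?h {S. basis_complement S}"
  proof (rule inj_onI)
    fix S S'
    assume "S \<in> {S. basis_complement S}" "S' \<in> {S. basis_complement S}" and eq: "?h S = ?h S'"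
    then have "S \<subseteq> cells \<Sigma>" "S' \<subseteq> cells \<Sigma>"
      using R_subset by (auto simp: basis_complement_def)
    with eq show "S = S'"
      by blast
  qed
  have "int (order (cocritical_group d \<Omega>)) = (\<Sum>S | S \<subseteq> R \<and> card S = card C. (minor S)\<^sup>2)"
    unfolding cocritical_order gram_det by (simp add: sum_nonneg)
  \<comment> \<open>Subsets of the right size with a vanishing minor contribute nothing; the others
    are exactly the complements of forests.\<close>
  also have "\<dots> = (\<Sum>S | basis_complement S. (minor S)\<^sup>2)"
    using finite_R by (intro sum.mono_neutral_right) (auto simp: basis_complement_iff)
  also have "\<dots> = (\<Sum>S | basis_complement S. int ((g (?h S))\<^sup>2))"
    using assms by (intro sum.cong) auto
  also have "\<dots> = int (\<Sum>S | basis_complement S. (g (?h S))\<^sup>2)"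
    by simp
  also have "(\<Sum>S | basis_complement S. (g (?h S))\<^sup>2) = (\<Sum>\<Upsilon> | cellular_spanning_forest d \<Sigma> \<Upsilon>. (g \<Upsilon>)\<^sup>2)"
    unfolding forests using inj by (simp add: sum.reindex)
  finally show ?thesis
    by (simp only: of_nat_eq_iff)
qed

end

theorem theorem8p2:
  fixes d :: nat and \<Sigma> \<Omega> :: "('a, 'c) cw_complex"
  assumes "finite_cw_complex \<Sigma>" and "has_cw_dim \<Sigma> (int d)"
    and "acyclization d \<Sigma> \<Omega>"
  shows "finite (carrier (cocritical_group d \<Omega>)) \<and>
    (\<forall>\<Upsilon>. cellular_spanning_forest d \<Sigma> \<Upsilon> \<longrightarrow>
       finite (carrier (rel_cellular_cohomology (int d + 1) \<Omega> \<Upsilon>)) \<and>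
       finite (carrier (rel_cellular_homology (int d) \<Omega> \<Upsilon>))) \<and>
    order (cocritical_group d \<Omega>) =
      (\<Sum>\<Upsilon> | cellular_spanning_forest d \<Sigma> \<Upsilon>. (order (rel_cellular_cohomology (int d + 1) \<Omega> \<Upsilon>))\<^sup>2) \<and>
    order (cocritical_group d \<Omega>) =
      (\<Sum>\<Upsilon> | cellular_spanning_forest d \<Sigma> \<Upsilon>. (order (rel_cellular_homology (int d) \<Omega> \<Upsilon>))\<^sup>2)"
proof -
  interpret acyclic_extension d \<Sigma> \<Omega>
    by (rule acyclic_extension.intro [OF assms(1,3)])
  show ?thesis
  proof (intro conjI allI impI)
    show "finite (carrier (cocritical_group d \<Omega>))"
      by (rule cocritical_order)
    fix \<Upsilon>
    assume "cellular_spanning_forest d \<Sigma> \<Upsilon>"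
    then obtain S where "basis_complement S" "\<Upsilon> = cells \<Sigma> - S"
      unfolding cellular_spanning_forest_iff by blast
    then show "finite (carrier (rel_cellular_cohomology (int d + 1) \<Omega> \<Upsilon>))"
      "finite (carrier (rel_cellular_homology (int d) \<Omega> \<Upsilon>))"
      using relative_cohomology_order(1) relative_homology_order(1) by simp_all
  next
    show "order (cocritical_group d \<Omega>) =
        (\<Sum>\<Upsilon> | cellular_spanning_forest d \<Sigma> \<Upsilon>. (order (rel_cellular_cohomology (int d + 1) \<Omega> \<Upsilon>))\<^sup>2)"
      by (rule sum_over_forests) (rule relative_cohomology_order(2))
    show "order (cocritical_group d \<Omega>) =
        (\<Sum>\<Upsilon> | cellular_spanning_forest d \<Sigma> \<Upsilon>. (order (rel_cellular_homology (int d) \<Omega> \<Upsilon>))\<^sup>2)"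
      by (rule sum_over_forests) (rule relative_homology_order(2))
  qed
qed

end
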